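(* For every infinite bit sequence $X$ of effective Hausdorff dimension $\alpha$ there exists a strongly $\alpha$-random infinite bit sequence $X'$ such that the Besicovitch distance between $X$ and $X'$ is $0$.
   Context: $\mathrm{C}(x)$ denotes the plain Kolmogorov complexity of the binary string $x$ (minimal length of a program producing $x$ for a fixed optimal programming language). The effective Hausdorff dimension of an infinite bit sequence $X=x_1x_2\ldots$ is $\liminf_{n\to\infty}\mathrm{C}(x_1\ldots x_n)/n$. The Besicovitch distance between $X=x_1x_2\ldots$ and $Y=y_1y_2\ldots$ is $\limsup_{n\to\infty} d(x_1\ldots x_n,y_1\ldots y_n)/n$, where $d$ is the Hamming distance. For a real $\alpha\in[0,1]$, a strong $\alpha$-test is a uniformly computably enumerable sequence $(V_k)_{k\ge1}$ of sets of binary strings such that for every $k$ and every prefix-free subset $\widehat V\subseteq V_k$ one has $\sum_{\sigma\in\widehat V}2^{-\alpha|\sigma|}\le2^{-k}$. A sequence $X'$ is strongly $\alpha$-random if for every strong $\alpha$-test $(V_k)$ there is some $k$ such that no prefix of $X'$ belongs to $V_k$. *)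

theory Defs
  imports Complex_Main "HOL-Library.Nat_Bijection" "HOL-Library.Sublist"
    "HOL-Library.Extended_Nat" "HOL-Library.Extended_Real" "HOL-Library.Liminf_Limsup"
    "HOL-Analysis.Infinite_Sum"
begin

section \<open>Partial recursive functions\<close>

text \<open>Kleene's partial recursive functions, presented as unary functions on the naturals:
  several arguments are coded into one by the pairing bijection \<^const>\<open>prod_encode\<close>,
  and \<^const>\<open>None\<close> means that the computation diverges.\<close>

primrec prim_rec :: "(nat \<rightharpoonup> nat) \<Rightarrow> (nat \<rightharpoonup> nat) \<Rightarrow> nat \<Rightarrow> nat \<rightharpoonup> nat" where
  "prim_rec f g a 0 = f a"
| "prim_rec f g a (Suc n) =
     Option.bind (prim_rec f g a n) (\<lambda>v. g (prod_encode (a, prod_encode (n, v))))"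

text \<open>Unbounded search: all values before the first zero have to be defined.\<close>

definition minimization :: "(nat \<rightharpoonup> nat) \<Rightarrow> nat \<rightharpoonup> nat" where
  "minimization f a =
     (if \<exists>n. f (prod_encode (a, n)) = Some 0 \<and> (\<forall>m<n. f (prod_encode (a, m)) \<noteq> None)
      then Some (LEAST n. f (prod_encode (a, n)) = Some 0)
      else None)"

inductive partial_recursive :: "(nat \<rightharpoonup> nat) \<Rightarrow> bool" where
  zero: "partial_recursive (\<lambda>_. Some 0)"
| succ: "partial_recursive (\<lambda>x. Some (Suc x))"
| proj_fst: "partial_recursive (\<lambda>x. Some (fst (prod_decode x)))"
| proj_snd: "partial_recursive (\<lambda>x. Some (snd (prod_decode x)))"
| pair: "partial_recursive f \<Longrightarrow> partial_recursive g \<Longrightarrow>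
    partial_recursive
      (\<lambda>x. Option.bind (f x) (\<lambda>y. Option.bind (g x) (\<lambda>z. Some (prod_encode (y, z)))))"
| comp: "partial_recursive f \<Longrightarrow> partial_recursive g \<Longrightarrow>
    partial_recursive (\<lambda>x. Option.bind (f x) g)"
| prec: "partial_recursive f \<Longrightarrow> partial_recursive g \<Longrightarrow>
    partial_recursive (\<lambda>x. case prod_decode x of (a, n) \<Rightarrow> prim_rec f g a n)"
| mu: "partial_recursive f \<Longrightarrow> partial_recursive (minimization f)"


section \<open>Computability on binary strings\<close>

type_synonym bitstring = "bool list"

definition string_encode :: "bitstring \<Rightarrow> nat" where
  "string_encode \<sigma> = list_encode (map of_bool \<sigma>)"

definition partial_computable :: "(bitstring \<rightharpoonup> bitstring) \<Rightarrow> bool" where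
  "partial_computable U \<longleftrightarrow>
     (\<exists>f. partial_recursive f \<and>
          (\<forall>\<sigma>. f (string_encode \<sigma>) = map_option string_encode (U \<sigma>)))"

text \<open>The sequence is indexed by the positive integers; \<open>V 0\<close> is irrelevant.\<close>

definition uniformly_ce :: "(nat \<Rightarrow> bitstring set) \<Rightarrow> bool" where
  "uniformly_ce V \<longleftrightarrow>
     (\<exists>f. partial_recursive f \<and>
          (\<forall>k\<ge>1. \<forall>\<sigma>. \<sigma> \<in> V k \<longleftrightarrow> f (prod_encode (k, string_encode \<sigma>)) \<noteq> None))"


section \<open>Plain Kolmogorov complexity and effective Hausdorff dimension\<close>

text \<open>The complexity of \<open>x\<close> with respect to the programming language \<open>U\<close>;
  it is \<open>\<infinity>\<close> if no program produces \<open>x\<close>.\<close>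

definition complexity :: "(bitstring \<rightharpoonup> bitstring) \<Rightarrow> bitstring \<Rightarrow> enat" where
  "complexity U x = (INF p\<in>{p. U p = Some x}. enat (length p))"

definition optimal :: "(bitstring \<rightharpoonup> bitstring) \<Rightarrow> bool" where
  "optimal U \<longleftrightarrow> partial_computable U \<and>
     (\<forall>V. partial_computable V \<longrightarrow>
        (\<exists>c::nat. \<forall>x. complexity U x \<le> complexity V x + enat c))"

text \<open>Infinite bit sequences are functions on the naturals, with \<open>X 0\<close> the first bit.\<close>

type_synonym bitseq = "nat \<Rightarrow> bool"

definition initial_segment :: "bitseq \<Rightarrow> nat \<Rightarrow> bitstring" where
  "initial_segment X n = map X [0..<n]"

definition effective_dimension :: "(bitstring \<rightharpoonup> bitstring) \<Rightarrow> bitseq \<Rightarrow> ereal" where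
  "effective_dimension U X =
     liminf (\<lambda>n. ereal_of_enat (complexity U (initial_segment X n)) / ereal (real n))"


section \<open>Besicovitch distance\<close>

definition hamming_distance :: "bitstring \<Rightarrow> bitstring \<Rightarrow> nat" where
  "hamming_distance x y = card {i. i < length x \<and> x ! i \<noteq> y ! i}"

definition besicovitch_distance :: "bitseq \<Rightarrow> bitseq \<Rightarrow> ereal" where
  "besicovitch_distance X Y =
     limsup (\<lambda>n. ereal (real (hamming_distance (initial_segment X n) (initial_segment Y n))
                         / real n))"


section \<open>Strong randomness\<close>

definition prefix_free :: "bitstring set \<Rightarrow> bool" where
  "prefix_free W \<longleftrightarrow> (\<forall>\<sigma>\<in>W. \<forall>\<tau>\<in>W. prefix \<sigma> \<tau> \<longrightarrow> \<sigma> = \<tau>)"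

text \<open>Summability is required explicitly because \<^const>\<open>infsum\<close> is \<open>0\<close> on divergent real sums.\<close>

definition strong_test :: "real \<Rightarrow> (nat \<Rightarrow> bitstring set) \<Rightarrow> bool" where
  "strong_test \<alpha> V \<longleftrightarrow> uniformly_ce V \<and>
     (\<forall>k\<ge>1. \<forall>W. W \<subseteq> V k \<and> prefix_free W \<longrightarrow>
        (\<lambda>\<sigma>. 2 powr (- \<alpha> * real (length \<sigma>))) summable_on W \<and>
        (\<Sum>\<^sub>\<infinity>\<sigma>\<in>W. 2 powr (- \<alpha> * real (length \<sigma>))) \<le> 2 powr (- real k))"

definition strongly_random :: "real \<Rightarrow> bitseq \<Rightarrow> bool" where
  "strongly_random \<alpha> X \<longleftrightarrow>
     (\<forall>V. strong_test \<alpha> V \<longrightarrow> (\<exists>k\<ge>1. \<forall>n. initial_segment X n \<notin> V k))"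

end

theory Submission
  imports Defs "HOL-Analysis.Convex"
begin

text \<open>Two different mechanisms are at work. Write \<open>x\<close> for the prefix of \<open>X\<close> of length \<open>n\<close>.

  If \<open>\<alpha> < 1\<close>, flip the bits of \<open>X\<close> independently with slowly vanishing probability. By
  hypercontractivity of the noise operator, few strings of length \<open>n\<close> are carried by the noise into a
  component of a strong test with noticeable probability. These strings can be enumerated, hence they
  are compressible below the complexity of \<open>x\<close>, and \<open>x\<close> is not among them. By Borel--Cantelli almost
  every perturbation escapes every test.

  If \<open>\<alpha> = 1\<close>, cut \<open>X\<close> into the blocks \<open>[2\<^sup>r, 2\<^sup>r\<^sup>+\<^sup>1)\<close>, allow a slowly vanishing fraction of errors
  in each of them, and consider the measure of those tails \<open>Z\<close> for which every admissible modification
  of \<open>x\<close> followed by \<open>Z\<close> is hit by the tests. If this measure jumps when \<open>x\<close> is extended by one block,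
  then isoperimetry in the Hamming cube shows that this block belongs to a small enumerable set, which
  contradicts the complexity of \<open>X\<close>. So the measure stays below \<open>1/2\<close> and compactness yields the
  modified sequence. In contrast to choosing the modification block by block, this quantity only refers
  to \<open>x\<close>, so that the errors made so far do not have to be described.

  The rate at which the error tolerance vanishes depends on \<open>X\<close> and is not computable, but as a
  function of the logarithm of the length it costs only logarithmically many bits of advice.\<close>

section \<open>Computability\<close>

text \<open>Neither mechanism covers the other case. The noise argument saves
  \<open>(1 - \<alpha>) * n / 2 ^ phase\<close> bits, which is nothing at \<alpha> = 1. Isoperimetry
  only puts a block into a set slightly smaller than that of all blocks, which contradicts nothing
  when the complexity is far below the length. The strong tests are countable but not listed
  effectively, so a description can refer to finitely many of them only, at the price of a constant
  depending on them. For \<alpha> < 1 the tests are treated singly, and the constant only delays the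
  component to be avoided. For \<alpha> = 1 the active tests act together, so the schedule lets the
  phase become \<open>J\<close> only when the constant for the first \<open>J\<close> tests is
  negligible. Every saving has to beat an overhead linear in the logarithm \<open>i\<close> of the
  length; the schedules therefore keep it above a multiple of \<open>i * i\<close>. No measure on
  infinite sequences occurs: probabilities are finite sums over strings of one length, and a limit
  is taken only at the end.\<close>

abbreviation pfst :: "nat \<Rightarrow> nat" where "pfst x \<equiv> fst (prod_decode x)"
abbreviation psnd :: "nat \<Rightarrow> nat" where "psnd x \<equiv> snd (prod_decode x)"

definition recursive :: "(nat \<Rightarrow> nat) \<Rightarrow> bool" where
  "recursive f \<longleftrightarrow> partial_recursive (\<lambda>x. Some (f x))"

definition decidable :: "(nat \<Rightarrow> bool) \<Rightarrow> bool" where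
  "decidable P \<longleftrightarrow> recursive (\<lambda>x. of_bool (P x))"

named_theorems rec_intros

section \<open>Closure properties of the total recursive functions\<close>

lemma recursive_compose: "recursive f \<Longrightarrow> recursive g \<Longrightarrow> recursive (\<lambda>x. f (g x))"
  unfolding recursive_def using partial_recursive.comp[of "\<lambda>x. Some (g x)" "\<lambda>x. Some (f x)"] by simp

lemma recursive_id [rec_intros]: "recursive (\<lambda>x. x)"
  unfolding recursive_def using partial_recursive.pair[OF partial_recursive.proj_fst partial_recursive.proj_snd]
  by simp

lemma recursive_pair [rec_intros]: "recursive f \<Longrightarrow> recursive g \<Longrightarrow> recursive (\<lambda>x. prod_encode (f x, g x))"
  unfolding recursive_def using partial_recursive.pair[of "\<lambda>x. Some (f x)" "\<lambda>x. Some (g x)"] by simp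

lemma recursive_pfst [rec_intros]: "recursive f \<Longrightarrow> recursive (\<lambda>x. pfst (f x))"
  using recursive_compose[of pfst f] partial_recursive.proj_fst unfolding recursive_def by simp

lemma recursive_psnd [rec_intros]: "recursive f \<Longrightarrow> recursive (\<lambda>x. psnd (f x))"
  using recursive_compose[of psnd f] partial_recursive.proj_snd unfolding recursive_def by simp

lemma recursive_Suc [rec_intros]: "recursive f \<Longrightarrow> recursive (\<lambda>x. Suc (f x))"
  using recursive_compose[of Suc f] partial_recursive.succ unfolding recursive_def by simp

lemma recursive_const [rec_intros]: "recursive (\<lambda>x. c)"
proof (induction c)
  case 0 show ?case unfolding recursive_def by (rule partial_recursive.zero)
qed (rule recursive_Suc)

text \<open>All functions are unary, so two arguments enter through a pair. The rule substitutes
  arbitrary recursive arguments, which lets \<open>intro\<close> work through nested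
  expressions.\<close>

lemma recursive_compose2:
  assumes "recursive (\<lambda>p. F (pfst p) (psnd p))" "recursive f" "recursive g"
  shows "recursive (\<lambda>x. F (f x) (g x))"
  using recursive_compose[OF assms(1) recursive_pair[OF assms(2,3)]] by simp

lemma recursive_compose3:
  assumes "recursive (\<lambda>p. F (pfst p) (pfst (psnd p)) (psnd (psnd p)))" "recursive f" "recursive g" "recursive h"
  shows "recursive (\<lambda>x. F (f x) (g x) (h x))"
  using recursive_compose[OF assms(1) recursive_pair[OF assms(2) recursive_pair[OF assms(3,4)]]] by simp

lemma decidable_compose: "decidable P \<Longrightarrow> recursive g \<Longrightarrow> decidable (\<lambda>x. P (g x))"
  unfolding decidable_def by (rule recursive_compose[of "\<lambda>x. of_bool (P x)"])

lemma decidable_compose2: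
  assumes "decidable (\<lambda>p. P (pfst p) (psnd p))" "recursive f" "recursive g"
  shows "decidable (\<lambda>x. P (f x) (g x))"
  using decidable_compose[OF assms(1) recursive_pair[OF assms(2,3)]] by simp

text \<open>\<open>s\<close> and \<open>h\<close> are total, so \<open>prim_rec\<close> never
  diverges on them and agrees with \<open>rec_nat\<close>.\<close>

lemma recursive_rec_nat:
  assumes "recursive n" "recursive s" "recursive (\<lambda>p. h (pfst p) (pfst (psnd p)) (psnd (psnd p)))"
  shows "recursive (\<lambda>x. rec_nat (s x) (h x) (n x))"
proof -
  let ?s = "\<lambda>x. Some (s x)" and ?h = "\<lambda>p. Some (h (pfst p) (pfst (psnd p)) (psnd (psnd p)))"
  have *: "prim_rec ?s ?h a m = Some (rec_nat (s a) (h a) m)" for a m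
    by (induction m) auto
  have "recursive (\<lambda>p. rec_nat (s (pfst p)) (h (pfst p)) (psnd p))"
    using partial_recursive.prec[of ?s ?h] assms(2,3) unfolding recursive_def * by (simp add: case_prod_beta)
  from recursive_compose2[OF this recursive_id assms(1)] show ?thesis .
qed

lemma recursive_cong: "recursive f \<Longrightarrow> (\<And>x. f x = g x) \<Longrightarrow> recursive g"
  by (metis ext)

lemma decidableI: "recursive f \<Longrightarrow> (\<And>x. f x = of_bool (P x)) \<Longrightarrow> decidable P"
  unfolding decidable_def by (rule recursive_cong)

lemma recursive_add [rec_intros]:
  assumes "recursive f" "recursive g" shows "recursive (\<lambda>x. f x + g x)"
proof (rule recursive_cong)
  show "recursive (\<lambda>x. rec_nat (f x) (\<lambda>_ v. Suc v) (g x))"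
    by (intro recursive_rec_nat[where h = "\<lambda>_ _ v. Suc v"] assms rec_intros)
  have "rec_nat a (\<lambda>_ v. Suc v) m = a + m" for a m by (induction m) auto
  then show "rec_nat (f x) (\<lambda>_ v. Suc v) (g x) = f x + g x" for x .
qed

lemma recursive_mult [rec_intros]:
  assumes "recursive f" "recursive g" shows "recursive (\<lambda>x. f x * g x)"
proof (rule recursive_cong)
  show "recursive (\<lambda>x. rec_nat 0 (\<lambda>_ v. f x + v) (g x))"
    by (intro recursive_rec_nat[where h = "\<lambda>x _ v. f x + v"] assms rec_intros recursive_compose[OF assms(1)])
  have "rec_nat 0 (\<lambda>_ v. a + v) m = a * m" for a m by (induction m) auto
  then show "rec_nat 0 (\<lambda>_ v. f x + v) (g x) = f x * g x" for x .
qed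

lemma recursive_power [rec_intros]:
  assumes "recursive f" "recursive g" shows "recursive (\<lambda>x. f x ^ g x)"
proof (rule recursive_cong)
  show "recursive (\<lambda>x. rec_nat (Suc 0) (\<lambda>_ v. f x * v) (g x))"
    by (intro recursive_rec_nat[where h = "\<lambda>x _ v. f x * v"] assms rec_intros recursive_compose[OF assms(1)])
  have "rec_nat (Suc 0) (\<lambda>_ v. a * v) m = a ^ m" for a m by (induction m) auto
  then show "rec_nat (Suc 0) (\<lambda>_ v. f x * v) (g x) = f x ^ g x" for x .
qed

lemma recursive_diff [rec_intros]:
  assumes "recursive f" "recursive g" shows "recursive (\<lambda>x. f x - g x)"
proof (rule recursive_cong)
  have "recursive (\<lambda>x. rec_nat 0 (\<lambda>n _. n) x)"
    by (intro recursive_rec_nat[where h = "\<lambda>_ n _. n"] rec_intros)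
  moreover have "rec_nat 0 (\<lambda>n _. n) m = m - 1" for m :: nat by (induction m) auto
  ultimately have pred: "recursive (\<lambda>x. x - 1)" by (rule recursive_cong)
  show "recursive (\<lambda>x. rec_nat (f x) (\<lambda>_ v. v - 1) (g x))"
    by (intro recursive_rec_nat[where h = "\<lambda>_ _ v. v - 1"] assms rec_intros recursive_compose[OF pred])
  have "rec_nat a (\<lambda>_ v. v - 1) m = a - m" for a m by (induction m) auto
  then show "rec_nat (f x) (\<lambda>_ v. v - 1) (g x) = f x - g x" for x .
qed

lemma recursive_sum [rec_intros]:
  assumes "recursive b" "recursive (\<lambda>p. h (pfst p) (psnd p))"
  shows "recursive (\<lambda>x. \<Sum>i<b x. h x i)"
proof (rule recursive_cong)
  show "recursive (\<lambda>x. rec_nat 0 (\<lambda>i v. v + h x i) (b x))"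
    by (intro recursive_rec_nat[where h = "\<lambda>x i v. v + h x i"] assms(1) rec_intros recursive_compose2[OF assms(2)])
  have "rec_nat 0 (\<lambda>i v. v + h x i) m = (\<Sum>i<m. h x i)" for x m by (induction m) auto
  then show "rec_nat 0 (\<lambda>i v. v + h x i) (b x) = (\<Sum>i<b x. h x i)" for x .
qed

lemma recursive_prod [rec_intros]:
  assumes "recursive b" "recursive (\<lambda>p. h (pfst p) (psnd p))"
  shows "recursive (\<lambda>x. \<Prod>i<b x. h x i)"
proof (rule recursive_cong)
  show "recursive (\<lambda>x. rec_nat (Suc 0) (\<lambda>i v. v * h x i) (b x))"
    by (intro recursive_rec_nat[where h = "\<lambda>x i v. v * h x i"] assms(1) rec_intros recursive_compose2[OF assms(2)])
  have "rec_nat (Suc 0) (\<lambda>i v. v * h x i) m = (\<Prod>i<m. h x i)" for x m by (induction m) auto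
  then show "rec_nat (Suc 0) (\<lambda>i v. v * h x i) (b x) = (\<Prod>i<b x. h x i)" for x .
qed

lemma recursive_of_bool [rec_intros]: "decidable P \<Longrightarrow> recursive (\<lambda>x. of_bool (P x))"
  by (simp add: decidable_def)

lemma decidable_const [rec_intros]: "decidable (\<lambda>_. c)"
  unfolding decidable_def by (rule recursive_const)

lemma decidable_not [rec_intros]:
  assumes "decidable P" shows "decidable (\<lambda>x. \<not> P x)"
  by (rule decidableI[of "\<lambda>x. 1 - of_bool (P x)"]) (intro rec_intros assms, auto)

lemma decidable_conj [rec_intros]:
  assumes "decidable P" "decidable Q" shows "decidable (\<lambda>x. P x \<and> Q x)"
  by (rule decidableI[of "\<lambda>x. of_bool (P x) * of_bool (Q x)"]) (intro rec_intros assms, auto)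

lemma decidable_imp [rec_intros]:
  assumes "decidable P" "decidable Q" shows "decidable (\<lambda>x. P x \<longrightarrow> Q x)"
  by (rule decidableI[of "\<lambda>x. 1 - of_bool (P x) * of_bool (\<not> Q x)"]) (intro rec_intros assms, auto)

lemma decidable_disj [rec_intros]:
  assumes "decidable P" "decidable Q" shows "decidable (\<lambda>x. P x \<or> Q x)"
  by (rule decidableI[of "\<lambda>x. of_bool (\<not> P x \<longrightarrow> Q x)"]) (intro rec_intros assms, auto)

lemma decidable_le [rec_intros]:
  assumes "recursive f" "recursive g" shows "decidable (\<lambda>x. f x \<le> g x)"
  by (rule decidableI[of "\<lambda>x. 1 - (f x - g x)"]) (intro rec_intros assms, auto)

lemma decidable_less [rec_intros]:
  assumes "recursive f" "recursive g" shows "decidable (\<lambda>x. f x < g x)"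
  by (rule decidableI[of "\<lambda>x. of_bool (\<not> g x \<le> f x)"]) (intro rec_intros assms, auto)

lemma decidable_eq [rec_intros]:
  assumes "recursive f" "recursive g" shows "decidable (\<lambda>x. f x = g x)"
  by (rule decidableI[of "\<lambda>x. of_bool (f x \<le> g x \<and> g x \<le> f x)"]) (intro rec_intros assms, auto)

lemma decidable_iff [rec_intros]:
  assumes "decidable P" "decidable Q" shows "decidable (\<lambda>x. P x \<longleftrightarrow> Q x)"
  by (rule decidableI[of "\<lambda>x. of_bool ((P x \<longrightarrow> Q x) \<and> (Q x \<longrightarrow> P x))"]) (intro rec_intros assms, auto)

lemma recursive_if [rec_intros]:
  assumes "decidable P" "recursive f" "recursive g" shows "recursive (\<lambda>x. if P x then f x else g x)"
  by (rule recursive_cong[of "\<lambda>x. of_bool (P x) * f x + of_bool (\<not> P x) * g x"]) (intro rec_intros assms, auto)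

lemma decidable_all [rec_intros]:
  assumes "recursive b" "decidable (\<lambda>p. P (pfst p) (psnd p))"
  shows "decidable (\<lambda>x. \<forall>i<b x. P x i)"
  by (rule decidableI[of "\<lambda>x. \<Prod>i<b x. of_bool (P x i)"])
    (intro rec_intros assms, auto intro!: prod.neutral)

lemma decidable_ex [rec_intros]:
  assumes "recursive b" "decidable (\<lambda>p. P (pfst p) (psnd p))"
  shows "decidable (\<lambda>x. \<exists>i<b x. P x i)"
  by (rule decidableI[of "\<lambda>x. of_bool (\<not> (\<forall>i<b x. \<not> P x i))"]) (intro rec_intros assms, auto)

lemma recursive_div [rec_intros]:
  assumes "recursive f" "recursive g" shows "recursive (\<lambda>x. f x div g x)"
proof (rule recursive_cong)
  \<comment> \<open>The quotient counts the positive multiples of \<open>g x\<close> up to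
    \<open>f x\<close>.\<close>
  show "recursive (\<lambda>x. if g x = 0 then 0 else \<Sum>i<f x. of_bool (Suc i * g x \<le> f x))"
    by (intro rec_intros assms recursive_compose[OF assms(1)] recursive_compose[OF assms(2)])
  have "(if n = 0 then 0 else \<Sum>i<m. of_bool (Suc i * n \<le> m)) = m div n" for m n :: nat
  proof (cases "n = 0")
    case False
    have "(Suc i * n \<le> m) = (i < m div n)" for i
      using False by (metis Suc_le_eq less_eq_div_iff_mult_less_eq neq0_conv)
    then have "(\<Sum>i<m. of_bool (Suc i * n \<le> m)) = card {i\<in>{..<m}. i < m div n}"
      by (simp add: sum.If_cases of_bool_def Int_def)
    also have "{i\<in>{..<m}. i < m div n} = {..<m div n}"
      by (auto intro: less_le_trans[OF _ div_le_dividend])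
    finally show ?thesis using False by simp
  qed auto
  then show "(if g x = 0 then 0 else \<Sum>i<f x. of_bool (Suc i * g x \<le> f x)) = f x div g x" for x .
qed

lemma recursive_mod [rec_intros]:
  assumes "recursive f" "recursive g" shows "recursive (\<lambda>x. f x mod g x)"
  by (rule recursive_cong[of "\<lambda>x. f x - f x div g x * g x"])
    (intro rec_intros assms, simp add: minus_div_mult_eq_mod)

lemma decidable_bit [rec_intros]:
  assumes "recursive f" "recursive g" shows "decidable (\<lambda>x. bit (f x) (g x))"
  by (rule decidableI[of "\<lambda>x. (f x div 2 ^ g x) mod 2"])
    (intro rec_intros assms, auto simp: bit_iff_odd mod_2_eq_odd)

text \<open>Strings of length \<open>n\<close> are handled as numbers below \<open>2\<^sup>n\<close>, the first letter being the lowest bit.\<close>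

definition bits :: "nat \<Rightarrow> nat \<Rightarrow> bitstring" where
  "bits n x = map (bit x) [0..<n]"

lemma length_bits [simp]: "length (bits n x) = n"
  by (simp add: bits_def)

lemma recursive_string_encode_bits [rec_intros]:
  assumes "recursive f" "recursive g"
  shows "recursive (\<lambda>x. string_encode (bits (f x) (g x)))"
proof -
  \<comment> \<open>\<open>list_encode\<close> grows at the front, so the list is built from its
    last bit; hence the index \<open>l - 1 - i\<close>.\<close>
  have aux: "rec_nat 0 (\<lambda>i v. Suc (prod_encode (of_bool (bit x (l - 1 - i)), v))) m
      = list_encode (map of_bool (map (bit x) [l - m..<l]))" if "m \<le> l" for x l m
    using that
  proof (induction m)
    case (Suc m)
    have "[l - Suc m..<l] = (l - Suc m) # [l - m..<l]"
      using Suc.prems by (metis Suc_diff_Suc Suc_le_eq upt_conv_Cons diff_less zero_less_Suc less_le_trans)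
    then show ?case using Suc by simp
  qed simp
  have *: "rec_nat 0 (\<lambda>i v. Suc (prod_encode (of_bool (bit x (l - 1 - i)), v))) l = string_encode (bits l x)" for x l
    using aux[of l l x] by (simp add: string_encode_def bits_def)
  have "recursive (\<lambda>x. rec_nat 0 (\<lambda>i v. Suc (prod_encode (of_bool (bit (g x) (f x - 1 - i)), v))) (f x))"
    by (intro recursive_rec_nat[of f "\<lambda>_. 0" "\<lambda>x i v. Suc (prod_encode (of_bool (bit (g x) (f x - 1 - i)), v))"]
        rec_intros assms recursive_compose[OF assms(1)] recursive_compose[OF assms(2)])
  then show ?thesis unfolding * .
qed

lemma partial_recursive_search:
  assumes "decidable (\<lambda>p. P (pfst p) (psnd p))"
  shows "partial_recursive (\<lambda>x. if \<exists>n. P x n then Some (LEAST n. P x n) else None)"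
proof -
  let ?f = "\<lambda>p. Some (of_bool (\<not> P (pfst p) (psnd p)) :: nat)"
  have "partial_recursive ?f"
    using decidable_not[OF assms] unfolding decidable_def recursive_def .
  then have "partial_recursive (minimization ?f)" by (rule partial_recursive.mu)
  also have "minimization ?f = (\<lambda>x. if \<exists>n. P x n then Some (LEAST n. P x n) else None)"
    by (auto simp: minimization_def fun_eq_iff)
  finally show ?thesis .
qed

text \<open>\<open>F x t\<close> is \<open>0\<close> while the computation of \<open>f x\<close> has not halted with fuel \<open>t\<close>,
  and the successor of its result afterwards.\<close>

definition fuelled :: "(nat \<rightharpoonup> nat) \<Rightarrow> (nat \<Rightarrow> nat \<Rightarrow> nat) \<Rightarrow> bool" where
  "fuelled f F \<longleftrightarrow> recursive (\<lambda>p. F (pfst p) (psnd p)) \<and>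
     (\<forall>x y. f x = Some y \<longleftrightarrow> (\<exists>t. F x t = Suc y)) \<and>
     (\<forall>x t t' y. F x t = Suc y \<longrightarrow> t \<le> t' \<longrightarrow> F x t' = Suc y)"

lemma fuelledD:
  assumes "fuelled f F"
  shows "recursive g \<Longrightarrow> recursive h \<Longrightarrow> recursive (\<lambda>x. F (g x) (h x))"
    and "f x = Some y \<longleftrightarrow> (\<exists>t. F x t = Suc y)"
    and "F x t = Suc y \<Longrightarrow> t \<le> t' \<Longrightarrow> F x t' = Suc y"
  using assms recursive_compose2[of F g h] unfolding fuelled_def by blast+

lemma fuelled_total: "recursive f \<Longrightarrow> fuelled (\<lambda>x. Some (f x)) (\<lambda>x t. Suc (f x))"
  unfolding fuelled_def
  using recursive_Suc[OF recursive_compose[OF _ recursive_pfst[OF recursive_id]]] by auto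

text \<open>By monotonicity the sum of the individual witnesses serves for all. It supplies the
  single stage at which a finite part of an enumeration is complete.\<close>

lemma uniform_fuel:
  fixes P :: "nat \<Rightarrow> nat \<Rightarrow> bool"
  assumes "\<And>m t t'. m < n \<Longrightarrow> P m t \<Longrightarrow> t \<le> t' \<Longrightarrow> P m t'" and "\<forall>m<n. \<exists>t. P m t"
  shows "\<exists>t. \<forall>m<n. P m t"
proof -
  obtain T where T: "\<forall>m<n. P m (T m)" using assms(2) by metis
  have "P m (\<Sum>m<n. T m)" if "m < n" for m
  proof (rule assms(1)[OF that])
    show "P m (T m)" using T that by blast
    show "T m \<le> (\<Sum>m<n. T m)" by (rule member_le_sum) (use that in auto)
  qed
  then show ?thesis by blast
qed

text \<open>The extra functions \<open>h\<close> and \<open>k\<close> make one construction serve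
  both pairing and composition.\<close>

lemma fuelled_bind:
  assumes "fuelled f F" "fuelled g G" "recursive (\<lambda>p. h (pfst p) (psnd p))"
    "recursive (\<lambda>p. k (pfst p) (pfst (psnd p)) (psnd (psnd p)))"
  shows "fuelled (\<lambda>x. Option.bind (f x) (\<lambda>y. Option.bind (g (h x y)) (\<lambda>z. Some (k x y z))))
     (\<lambda>x t. if F x t = 0 \<or> G (h x (F x t - 1)) t = 0 then 0
       else Suc (k x (F x t - 1) (G (h x (F x t - 1)) t - 1)))" (is "fuelled ?b ?H")
proof -
  note F = fuelledD[OF assms(1)] and G = fuelledD[OF assms(2)]
  have H: "?H x t = Suc w \<longleftrightarrow> (\<exists>y z. F x t = Suc y \<and> G (h x y) t = Suc z \<and> w = k x y z)" for x t w
    by (cases "F x t"; cases "G (h x (F x t - 1)) t") auto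
  have m: "?H x t' = Suc w" if "?H x t = Suc w" "t \<le> t'" for x t t' w
    using that F(3)[OF _ that(2)] G(3)[OF _ that(2)] unfolding H by blast
  have "?b x = Some w \<longleftrightarrow> (\<exists>t. ?H x t = Suc w)" for x w
  proof
    assume "?b x = Some w"
    then obtain y z where yz: "f x = Some y" "g (h x y) = Some z" "w = k x y z"
      by (auto simp: bind_eq_Some_conv)
    then obtain t s where "F x t = Suc y" "G (h x y) s = Suc z" using F(2) G(2) by metis
    then have "F x (max t s) = Suc y" "G (h x y) (max t s) = Suc z"
      using F(3)[OF _ max.cobounded1] G(3)[OF _ max.cobounded2] by blast+
    then show "\<exists>t. ?H x t = Suc w" unfolding H using yz(3) by blast
  next
    assume "\<exists>t. ?H x t = Suc w"
    then obtain t y z where "F x t = Suc y" "G (h x y) t = Suc z" "w = k x y z" unfolding H by blast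
    moreover from this have "f x = Some y" "g (h x y) = Some z" unfolding F(2) G(2) by blast+
    ultimately show "?b x = Some w" by simp
  qed
  moreover have "recursive (\<lambda>p. ?H (pfst p) (psnd p))"
    by (intro rec_intros F(1) G(1) recursive_compose2[OF assms(3)] recursive_compose3[OF assms(4)])
  ultimately show ?thesis using m unfolding fuelled_def by blast
qed

text \<open>All rounds share the fuel \<open>t\<close>; a round that has not halted yields 0, and 0
  persists.\<close>

lemma fuelled_prec:
  assumes "fuelled f F" "fuelled g G"
  shows "fuelled (\<lambda>x. case prod_decode x of (a, n) \<Rightarrow> prim_rec f g a n)
     (\<lambda>x t. rec_nat (F (pfst x) t)
        (\<lambda>n v. if v = 0 then 0 else G (prod_encode (pfst x, prod_encode (n, v - 1))) t) (psnd x))"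
    (is "fuelled ?h ?H")
proof -
  note F = fuelledD[OF assms(1)] and G = fuelledD[OF assms(2)]
  define R where "R a t = rec_nat (F a t) (\<lambda>n v. if v = 0 then 0 else G (prod_encode (a, prod_encode (n, v - 1))) t)" for a t
  have [simp]: "R a t 0 = F a t"
    "R a t (Suc n) = (if R a t n = 0 then 0 else G (prod_encode (a, prod_encode (n, R a t n - 1))) t)" for a t n
    by (auto simp: R_def)
  have m: "R a t n = Suc y \<Longrightarrow> t \<le> t' \<Longrightarrow> R a t' n = Suc y" for a t t' n y
  proof (induction n arbitrary: y)
    case 0 then show ?case using F(3)[of a t y t'] by simp
  next
    case (Suc n)
    then obtain u where "R a t n = Suc u" by (cases "R a t n") auto
    then show ?case
      using Suc.IH[of u] Suc.prems G(3)[of "prod_encode (a, prod_encode (n, u))" t y t'] by simp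
  qed
  have R: "prim_rec f g a n = Some y \<longleftrightarrow> (\<exists>t. R a t n = Suc y)" for a n y
  proof (induction n arbitrary: y)
    case 0 then show ?case using F(2) by simp
  next
    case (Suc n)
    show ?case
    proof
      assume "prim_rec f g a (Suc n) = Some y"
      then obtain u where u: "prim_rec f g a n = Some u" "g (prod_encode (a, prod_encode (n, u))) = Some y"
        by (auto simp: bind_eq_Some_conv)
      then obtain t s where "R a t n = Suc u" "G (prod_encode (a, prod_encode (n, u))) s = Suc y"
        using Suc.IH G(2) by metis
      then have "R a (max t s) n = Suc u" "G (prod_encode (a, prod_encode (n, u))) (max t s) = Suc y"
        using m[OF _ max.cobounded1] G(3)[OF _ max.cobounded2] by blast+
      then have "R a (max t s) (Suc n) = Suc y" by simp
      then show "\<exists>t. R a t (Suc n) = Suc y" by blast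
    next
      assume "\<exists>t. R a t (Suc n) = Suc y"
      then obtain t where "R a t (Suc n) = Suc y" by blast
      then obtain u where "R a t n = Suc u" "G (prod_encode (a, prod_encode (n, u))) t = Suc y"
        by (cases "R a t n") auto
      then have "prim_rec f g a n = Some u" "g (prod_encode (a, prod_encode (n, u))) = Some y"
        using Suc.IH G(2) by metis+
      then show "prim_rec f g a (Suc n) = Some y" by simp
    qed
  qed
  have "recursive (\<lambda>p. ?H (pfst p) (psnd p))"
    by (intro recursive_rec_nat[where h = "\<lambda>p n v. if v = 0 then 0 else
          G (prod_encode (pfst (pfst p), prod_encode (n, v - 1))) (psnd p)"] rec_intros F(1) G(1))
  then have rec: "recursive (\<lambda>p. R (pfst (pfst p)) (psnd p) (psnd (pfst p)))"
    by (simp add: R_def)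
  have "fuelled (\<lambda>x. prim_rec f g (pfst x) (psnd x)) (\<lambda>x t. R (pfst x) t (psnd x))"
    unfolding fuelled_def
  proof (intro conjI allI impI)
    show "R (pfst x) t' (psnd x) = Suc y" if "R (pfst x) t (psnd x) = Suc y" "t \<le> t'" for x t t' y
      using that by (rule m)
  qed (rule rec R)+
  then have "fuelled (\<lambda>x. prim_rec f g (pfst x) (psnd x)) ?H" unfolding R_def .
  then show ?thesis by (simp only: case_prod_beta)
qed

text \<open>The fuel also bounds the search. \<open>Suc 0\<close> means halted with result zero and
  \<open>1 <\<close> means halted with a nonzero result, so at most one summand differs from
  0.\<close>

lemma fuelled_mu:
  assumes "fuelled f F"
  shows "fuelled (minimization f) (\<lambda>x t. \<Sum>n<t. of_bool (F (prod_encode (x, n)) t = Suc 0 \<and>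
     (\<forall>m<n. 1 < F (prod_encode (x, m)) t)) * Suc n)" (is "fuelled ?h ?H")
proof -
  note F = fuelledD[OF assms(1)]
  define Q where "Q x t n \<longleftrightarrow> F (prod_encode (x, n)) t = Suc 0 \<and> (\<forall>m<n. 1 < F (prod_encode (x, m)) t)" for x t n
  have mon1: "1 < F x t \<Longrightarrow> t \<le> t' \<Longrightarrow> 1 < F x t'" for x t t'
    using F(3)[of x t _ t'] by (metis One_nat_def less_natE)
  have mon: "Q x t n \<Longrightarrow> t \<le> t' \<Longrightarrow> Q x t' n" for x t t' n
    unfolding Q_def using F(3) mon1 by blast
  have uniq: "n = n'" if "Q x t n" "Q x t n'" for x t n n'
    using that unfolding Q_def by (metis less_irrefl linorder_neqE_nat One_nat_def)
  have H: "?H x t = Suc n \<longleftrightarrow> n < t \<and> Q x t n" for x t n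
  proof (cases "\<exists>k<t. Q x t k")
    case True
    then obtain k where k: "k < t" "Q x t k" by blast
    have "?H x t = (\<Sum>n<t. if n = k then Suc k else 0)"
      unfolding Q_def[symmetric]
    proof (rule sum.cong)
      show "of_bool (Q x t n) * Suc n = (if n = k then Suc k else 0)" for n
        using uniq[of x t n k] k(2) by (cases "n = k") auto
    qed simp
    then have "?H x t = Suc k" using k(1) by simp
    then show ?thesis using k uniq[OF _ k(2)] by (metis Suc_inject)
  next
    case False
    then have "?H x t = 0" unfolding Q_def[symmetric] by simp
    then show ?thesis using False by (metis nat.distinct(1))
  qed
  have m: "?H x t' = Suc y" if "?H x t = Suc y" "t \<le> t'" for x t t' y
    using that mon[OF _ that(2)] unfolding H by (metis less_le_trans)
  have min: "minimization f x = Some n \<longleftrightarrow>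
      f (prod_encode (x, n)) = Some 0 \<and> (\<forall>m<n. \<exists>v. f (prod_encode (x, m)) = Some (Suc v))" (is "?L \<longleftrightarrow> ?R") for x n
  proof
    assume ?L
    then obtain k where k: "f (prod_encode (x, k)) = Some 0" "\<forall>m<k. f (prod_encode (x, m)) \<noteq> None"
      and n: "n = (LEAST n. f (prod_encode (x, n)) = Some 0)"
      by (auto simp: minimization_def split: if_splits)
    have "n \<le> k" unfolding n using k(1) by (rule Least_le)
    moreover have "f (prod_encode (x, n)) = Some 0" unfolding n using k(1) by (rule LeastI)
    moreover have "f (prod_encode (x, m)) \<noteq> Some 0" if "m < n" for m
      using not_less_Least[OF that[unfolded n]] .
    ultimately show ?R using k(2) by (metis less_le_trans not0_implies_Suc option.exhaust)
  next
    assume R: ?R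
    have "(LEAST n. f (prod_encode (x, n)) = Some 0) = n"
      using R by (intro Least_equality) (auto, metis nat.distinct(1) not_le option.inject)
    moreover have "\<exists>k. f (prod_encode (x, k)) = Some 0 \<and> (\<forall>m<k. f (prod_encode (x, m)) \<noteq> None)"
      using R by (intro exI[of _ n]) auto
    ultimately show ?L by (simp add: minimization_def)
  qed
  have "minimization f x = Some n \<longleftrightarrow> (\<exists>t. ?H x t = Suc n)" for x n
  proof
    assume "minimization f x = Some n"
    then have *: "\<exists>t. F (prod_encode (x, n)) t = Suc 0" "\<forall>m<n. \<exists>t. 1 < F (prod_encode (x, m)) t"
      unfolding min using F(2) by (blast, metis lessI Suc_less_eq One_nat_def zero_less_Suc)
    obtain t where t: "F (prod_encode (x, n)) t = Suc 0" using * by blast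
    obtain s where s: "\<forall>m<n. 1 < F (prod_encode (x, m)) s"
      using uniform_fuel[of n "\<lambda>m t. 1 < F (prod_encode (x, m)) t"] * mon1 by blast
    define r where "r = max (Suc n) (max t s)"
    have r: "n < r" "t \<le> r" "s \<le> r" by (auto simp: r_def)
    have "Q x r n" unfolding Q_def using F(3)[OF t r(2)] s mon1[OF _ r(3)] by blast
    then have "?H x r = Suc n" unfolding H using r(1) by blast
    then show "\<exists>t. ?H x t = Suc n" by blast
  next
    assume "\<exists>t. ?H x t = Suc n"
    then obtain t where t: "Q x t n" unfolding H by blast
    show "minimization f x = Some n"
      unfolding min
    proof (intro conjI allI impI)
      show "f (prod_encode (x, n)) = Some 0" using t unfolding Q_def F(2) by blast
      fix k assume "k < n"
      then have "1 < F (prod_encode (x, k)) t" using t unfolding Q_def by blast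
      then have "F (prod_encode (x, k)) t = Suc (Suc (F (prod_encode (x, k)) t - 2))" by linarith
      then show "\<exists>v. f (prod_encode (x, k)) = Some (Suc v)" unfolding F(2) by blast
    qed
  qed
  moreover have "recursive (\<lambda>p. ?H (pfst p) (psnd p))" by (intro rec_intros F(1))
  ultimately show ?thesis using m unfolding fuelled_def by blast
qed

text \<open>Kleene's normal form, which makes dovetailing possible.\<close>

theorem partial_recursive_fuelled:
  assumes "partial_recursive f" shows "\<exists>F. fuelled f F"
  using assms
proof induction
  case zero show ?case using fuelled_total[OF recursive_const] by blast
next
  case succ show ?case using fuelled_total[OF recursive_Suc[OF recursive_id]] by blast
next
  case proj_fst show ?case using fuelled_total[OF recursive_pfst[OF recursive_id]] by blast
next
  case proj_snd show ?case using fuelled_total[OF recursive_psnd[OF recursive_id]] by blast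
next
  case (pair f g)
  then obtain F G where "fuelled f F" "fuelled g G" by blast
  then have "fuelled (\<lambda>x. Option.bind (f x) (\<lambda>y. Option.bind (g x) (\<lambda>z. Some (prod_encode (y, z)))))
      (\<lambda>x t. if F x t = 0 \<or> G x t = 0 then 0 else Suc (prod_encode (F x t - 1, G x t - 1)))"
    by (rule fuelled_bind) (intro rec_intros)+
  then show ?case by blast
next
  case (comp f g)
  then obtain F G where "fuelled f F" "fuelled g G" by blast
  then have "fuelled (\<lambda>x. Option.bind (f x) (\<lambda>y. Option.bind (g y) (\<lambda>z. Some z)))
      (\<lambda>x t. if F x t = 0 \<or> G (F x t - 1) t = 0 then 0 else Suc (G (F x t - 1) t - 1))"
    by (rule fuelled_bind) (intro rec_intros)+
  then show ?case by auto
next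
  case (prec f g) then show ?case using fuelled_prec by blast
next
  case (mu f) then show ?case using fuelled_mu by blast
qed

text \<open>Presents a c.e. set as an increasing union of decidable stages, the only form in which
  tests are used later.\<close>

lemma partial_recursive_domain_decidable_stages:
  assumes "partial_recursive f"
  obtains P :: "nat \<Rightarrow> nat \<Rightarrow> bool" where "decidable (\<lambda>p. P (pfst p) (psnd p))"
    "\<And>x. f x \<noteq> None \<longleftrightarrow> (\<exists>t. P x t)" "\<And>x t t'. P x t \<Longrightarrow> t \<le> t' \<Longrightarrow> P x t'"
proof -
  obtain F where "fuelled f F" using partial_recursive_fuelled[OF assms] by blast
  note F = fuelledD[OF this]
  show thesis
  proof (rule that[of "\<lambda>x t. 0 < F x t"])
    show "decidable (\<lambda>p. 0 < F (pfst p) (psnd p))" by (intro rec_intros F(1))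
    show "f x \<noteq> None \<longleftrightarrow> (\<exists>t. 0 < F x t)" for x
      using F(2)[of x] by (metis gr0_conv_Suc not_None_eq)
    show "0 < F x t \<Longrightarrow> t \<le> t' \<Longrightarrow> 0 < F x t'" for x t t'
      using F(3)[of x t _ t'] by (metis gr0_conv_Suc)
  qed
qed

section \<open>Countability of the partial recursive functions\<close>

datatype code = Zero | Succ | Fst | Snd | Pair code code | Comp code code | Prec code code | Mu code

instance code :: countable by countable_datatype

primrec denotation :: "code \<Rightarrow> nat \<rightharpoonup> nat" where
  "denotation Zero = (\<lambda>_. Some 0)"
| "denotation Succ = (\<lambda>x. Some (Suc x))"
| "denotation Fst = (\<lambda>x. Some (pfst x))"
| "denotation Snd = (\<lambda>x. Some (psnd x))"
| "denotation (Pair f g) = (\<lambda>x. Option.bind (denotation f x) (\<lambda>y.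
     Option.bind (denotation g x) (\<lambda>z. Some (prod_encode (y, z)))))"
| "denotation (Comp f g) = (\<lambda>x. Option.bind (denotation f x) (denotation g))"
| "denotation (Prec f g) = (\<lambda>x. case prod_decode x of (a, n) \<Rightarrow> prim_rec (denotation f) (denotation g) a n)"
| "denotation (Mu f) = minimization (denotation f)"

text \<open>The inductive predicate speaks of functions and not of programs;
  \<open>denotation\<close> maps a countable syntax onto them.\<close>

lemma countable_partial_recursive: "countable (Collect partial_recursive)"
proof -
  have "f \<in> range denotation" if "partial_recursive f" for f
    using that
  proof induction
    case zero show ?case by (rule range_eqI[of _ _ Zero]) simp
  next
    case succ show ?case by (rule range_eqI[of _ _ Succ]) simp
  next
    case proj_fst show ?case by (rule range_eqI[of _ _ Fst]) simp
  next
    case proj_snd show ?case by (rule range_eqI[of _ _ Snd]) simp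
  next
    case (pair f g)
    then obtain c d where "f = denotation c" "g = denotation d" by blast
    then show ?case by (intro range_eqI[of _ _ "Pair c d"]) simp
  next
    case (comp f g)
    then obtain c d where "f = denotation c" "g = denotation d" by blast
    then show ?case by (intro range_eqI[of _ _ "Comp c d"]) simp
  next
    case (prec f g)
    then obtain c d where "f = denotation c" "g = denotation d" by blast
    then show ?case by (intro range_eqI[of _ _ "Prec c d"]) simp
  next
    case (mu f)
    then obtain c where "f = denotation c" by blast
    then show ?case by (intro range_eqI[of _ _ "Mu c"]) simp
  qed
  then have "Collect partial_recursive \<subseteq> range denotation" by auto
  then show ?thesis by (rule countable_subset) simp
qed

section \<open>Reading the fields of a program from its code\<close>

definition tail_code :: "nat \<Rightarrow> nat \<Rightarrow> nat" where
  "tail_code c i = rec_nat c (\<lambda>_ v. psnd (v - 1)) i"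

definition code_length :: "nat \<Rightarrow> nat" where
  "code_length c = (\<Sum>i<c. of_bool (tail_code c i \<noteq> 0))"

definition code_bit :: "nat \<Rightarrow> nat \<Rightarrow> bool" where
  "code_bit c i \<longleftrightarrow> tail_code c i \<noteq> 0 \<and> pfst (tail_code c i - 1) = 1"

definition leading_ones :: "nat \<Rightarrow> nat" where
  "leading_ones c = (\<Sum>i<c. of_bool (\<forall>j<Suc i. code_bit c j))"

definition code_number :: "nat \<Rightarrow> nat \<Rightarrow> nat \<Rightarrow> nat" where
  "code_number c s l = (\<Sum>i<l. of_bool (code_bit c (s + i)) * 2 ^ i)"

lemma recursive_tail_code [rec_intros]:
  "recursive f \<Longrightarrow> recursive g \<Longrightarrow> recursive (\<lambda>x. tail_code (f x) (g x))"
  unfolding tail_code_def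
  by (intro recursive_rec_nat[where h = "\<lambda>_ _ v. psnd (v - 1)"] rec_intros)

lemma decidable_code_bit [rec_intros]:
  "recursive f \<Longrightarrow> recursive g \<Longrightarrow> decidable (\<lambda>x. code_bit (f x) (g x))"
  unfolding code_bit_def by (intro rec_intros)

lemma recursive_code_length [rec_intros]:
  assumes "recursive f" shows "recursive (\<lambda>x. code_length (f x))"
  by (rule recursive_compose[OF _ assms]) (unfold code_length_def, intro rec_intros)

lemma recursive_leading_ones [rec_intros]:
  assumes "recursive f" shows "recursive (\<lambda>x. leading_ones (f x))"
  by (rule recursive_compose[OF _ assms]) (unfold leading_ones_def, intro rec_intros)

lemma recursive_code_number [rec_intros]:
  assumes "recursive f" "recursive g" "recursive h"
  shows "recursive (\<lambda>x. code_number (f x) (g x) (h x))"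
  by (rule recursive_compose3[OF _ assms]) (unfold code_number_def, intro rec_intros)

text \<open>A nonempty list is coded as the successor of a pair. Past the end the iteration stays at
  0, because 0 codes the pair of zeros.\<close>

lemma tail_code_list_encode: "tail_code (list_encode xs) i = list_encode (drop i xs)"
proof -
  have *: "tail_code c (Suc i) = psnd (tail_code c i - 1)" for c i
    by (simp add: tail_code_def)
  have "prod_encode (0, 0) = 0" by (simp add: prod_encode_def)
  then have "psnd 0 = 0" using prod_encode_inverse[of "(0, 0)"] by simp
  then have "psnd (list_encode xs - 1) = list_encode (tl xs)" for xs
    by (cases xs) auto
  then show ?thesis
    by (induction i) (simp_all add: * drop_Suc tl_drop tail_code_def[of _ 0])
qed

text \<open>Shows that the code itself is a sufficient summation bound in \<open>code_length\<close>
  and \<open>leading_ones\<close>.\<close>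

lemma length_le_list_encode: "length xs \<le> list_encode xs"
proof (induction xs)
  case (Cons x xs)
  have "list_encode xs \<le> prod_encode (x, list_encode xs)" by (rule le_prod_encode_2)
  then show ?case using Cons by simp
qed simp

lemma code_bit_string_encode: "code_bit (string_encode p) i \<longleftrightarrow> i < length p \<and> p ! i"
proof (cases "i < length p")
  case True
  then have "drop i p = p ! i # drop (Suc i) p" by (rule Cons_nth_drop_Suc[symmetric])
  then show ?thesis using True
    by (simp add: code_bit_def string_encode_def tail_code_list_encode drop_map)
qed (simp add: code_bit_def string_encode_def tail_code_list_encode)

lemma sum_of_bool_less: "a \<le> m \<Longrightarrow> (\<Sum>i<m. of_bool (i < a)) = (a :: nat)" for m a :: nat
proof -
  assume "a \<le> m"
  then have "{..<m} \<inter> {i. i < a} = {..<a}" by auto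
  then show ?thesis by (simp add: of_bool_def sum.If_cases)
qed

lemma code_length_string_encode: "code_length (string_encode p) = length p"
proof -
  have "tail_code (string_encode p) i \<noteq> 0 \<longleftrightarrow> i < length p" for i
  proof (cases "i < length p")
    case True
    then have "drop i p = p ! i # drop (Suc i) p" by (rule Cons_nth_drop_Suc[symmetric])
    then show ?thesis using True by (simp add: string_encode_def tail_code_list_encode drop_map)
  qed (simp add: string_encode_def tail_code_list_encode)
  moreover have "length p \<le> string_encode p"
    using length_le_list_encode[of "map of_bool p"] by (simp add: string_encode_def)
  ultimately show ?thesis unfolding code_length_def by (simp only: sum_of_bool_less)
qed

lemma leading_ones_string_encode:
  "leading_ones (string_encode (replicate b True @ False # r)) = b"
proof -
  let ?p = "replicate b True @ False # r"
  have "(\<forall>j<Suc i. code_bit (string_encode ?p) j) \<longleftrightarrow> i < b" for i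
  proof
    assume *: "\<forall>j<Suc i. code_bit (string_encode ?p) j"
    show "i < b"
    proof (rule ccontr)
      assume "\<not> i < b"
      then have "code_bit (string_encode ?p) b" using * by simp
      then show False by (simp add: code_bit_string_encode nth_append)
    qed
  qed (auto simp: code_bit_string_encode nth_append)
  moreover have "b \<le> string_encode ?p"
    using length_le_list_encode[of "map of_bool ?p"] by (simp add: string_encode_def)
  ultimately show ?thesis unfolding leading_ones_def by (simp only: sum_of_bool_less)
qed

lemma code_number_string_encode:
  assumes "x < 2 ^ l" shows "code_number (string_encode (p @ bits l x @ r)) (length p) l = x"
proof -
  have "code_number (string_encode (p @ bits l x @ r)) (length p) l = (\<Sum>i<l. of_bool (bit x i) * 2 ^ i)"
    unfolding code_number_def
    by (intro sum.cong) (auto simp: code_bit_string_encode nth_append bits_def)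
  also have "\<dots> = take_bit l x"
    unfolding take_bit_sum by (simp add: push_bit_eq_mult lessThan_atLeast0)
  finally show ?thesis using assms by (simp add: take_bit_nat_eq_self)
qed

lemma complexity_le: "U p = Some x \<Longrightarrow> complexity U x \<le> enat (length p)"
  unfolding complexity_def by (rule INF_lower) simp

text \<open>An element \<open>z\<close> of a section of a c.e. relation is found from the parameter \<open>a\<close>, sent as
  \<open>1\<^sup>b 0\<close> followed by \<open>b\<close> bits, from its \<open>l\<close> low bits, and from its position in the enumeration
  of those elements that share these bits. Fresh elements are recognised by the minimality of \<open>t\<close>.\<close>

definition enumerated :: "(nat \<Rightarrow> nat \<Rightarrow> nat \<Rightarrow> bool) \<Rightarrow> nat \<Rightarrow> nat \<Rightarrow> nat set" where
  "enumerated D a z = {z'. z' mod 2 ^ pfst a = z mod 2 ^ pfst a \<and> (\<exists>t. D a z' t)}"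

lemma complexity_enumerated:
  assumes opt: "optimal U" and dec: "decidable (\<lambda>p. D (pfst p) (pfst (psnd p)) (psnd (psnd p)))"
  obtains c where "\<And>a b m z t. \<lbrakk>a < 2 ^ b; D a z t; finite (enumerated D a z); card (enumerated D a z) \<le> 2 ^ m\<rbrakk> \<Longrightarrow>
    complexity U (bits (pfst (psnd a)) z) \<le> enat (2 * b + pfst a + m + c)"
proof -
  define St where "St a u s \<longleftrightarrow> D a (pfst s) (psnd s) \<and> (\<forall>t<psnd s. \<not> D a (pfst s) t) \<and>
    pfst s mod 2 ^ pfst a = u" for a u s
  \<comment> \<open>\<open>q\<close> packs the low bits and the rank: its remainder gives the low
    bits, its quotient the number of events that precede the wanted one.\<close>
  define Hit where "Hit a q s \<longleftrightarrow> St a (q mod 2 ^ pfst a) s \<and>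
    (\<Sum>s'<s. of_bool (St a (q mod 2 ^ pfst a) s')) = q div 2 ^ pfst a" for a q s
  define A where "A c = code_number c (leading_ones c + 1) (leading_ones c)" for c
  \<comment> \<open>The last field needs no delimiter: it is whatever the program has left, as plain
    complexity allows.\<close>
  define Q where "Q c = code_number c (2 * leading_ones c + 1) (code_length c - (2 * leading_ones c + 1))" for c
  have D: "decidable (\<lambda>x. D (f x) (g x) (h x))" if "recursive f" "recursive g" "recursive h" for f g h
    using recursive_compose3[OF dec[unfolded decidable_def] that] unfolding decidable_def .
  have St: "decidable (\<lambda>x. St (f x) (g x) (h x))" if "recursive f" "recursive g" "recursive h" for f g h
    unfolding St_def by (intro rec_intros D that recursive_compose[OF that(1)] recursive_compose[OF that(3)])
  have Hit: "decidable (\<lambda>x. Hit (f x) (g x) (h x))" if "recursive f" "recursive g" "recursive h" for f g h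
    unfolding Hit_def
    by (intro rec_intros St that recursive_compose[OF that(1)] recursive_compose[OF that(2)])
  define F where "F c = (if \<exists>s. Hit (A c) (Q c) s then Some (LEAST s. Hit (A c) (Q c) s) else None)" for c
  have pF: "partial_recursive F"
  proof -
    have "decidable (\<lambda>p. Hit (A (pfst p)) (Q (pfst p)) (psnd p))"
      unfolding A_def Q_def by (intro Hit rec_intros)
    then show ?thesis unfolding F_def by (rule partial_recursive_search)
  qed
  define O' where "O' c s = bits (pfst (psnd (A c))) (pfst s)" for c s
  define V where "V p = map_option (O' (string_encode p)) (F (string_encode p))" for p
  have "partial_computable V"
  proof -
    have 1: "partial_recursive (\<lambda>x. Option.bind (Some x) (\<lambda>y. Option.bind (F x) (\<lambda>z. Some (prod_encode (y, z)))))"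
      by (rule partial_recursive.pair[OF _ pF]) (use recursive_id in \<open>simp add: recursive_def\<close>)
    have "recursive (\<lambda>x. string_encode (O' (pfst x) (psnd x)))"
      unfolding O'_def A_def by (intro rec_intros)
    from partial_recursive.comp[OF 1 this[unfolded recursive_def]]
    have "partial_recursive (\<lambda>c. map_option (\<lambda>s. string_encode (O' c s)) (F c))"
      by (simp add: map_conv_bind_option comp_def)
    then show ?thesis unfolding partial_computable_def V_def
      by (intro exI conjI) (assumption, simp add: option.map_comp comp_def)
  qed
  then obtain c where c: "complexity U x \<le> complexity V x + enat c" for x
    using opt unfolding optimal_def by blast
  show thesis
  \<comment> \<open>The extra 1 pays for the separating \<open>False\<close>.\<close>
  proof (rule that[of "c + 1"])
    fix a b m z t
    define l N where "l = pfst a" and "N = pfst (psnd a)"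
    define S where "S = enumerated D a z"
    assume ab: "a < 2 ^ b" and Dz: "D a z t" and "finite (enumerated D a z)" "card (enumerated D a z) \<le> 2 ^ m"
    then have S: "finite S" "card S \<le> 2 ^ m" by (simp_all add: S_def)
    define u where "u = z mod 2 ^ l"
    define s0 where "s0 = prod_encode (z, LEAST t. D a z t)"
    define T where "T = {s. s < s0 \<and> St a u s}"
    define j where "j = card T"
    define q where "q = u + 2 ^ l * j"
    have pa: "pfst a = l" "pfst (psnd a) = N" by (simp_all add: l_def N_def)
    have u: "u < 2 ^ l" by (simp add: u_def)
    have qm: "q mod 2 ^ l = u" "q div 2 ^ l = j" using u by (simp_all add: q_def)
    have s0: "St a u s0" using Dz by (auto simp: St_def s0_def pa u_def LeastI dest: not_less_Least)
    have St_unique: "s = s'" if "St a u s" "St a u s'" "pfst s = pfst s'" for s s'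
    proof -
      have "psnd s = psnd s'" using that unfolding St_def by (metis linorder_neqE_nat)
      then show ?thesis using that(3) by (metis prod.expand prod_decode_eq)
    qed
    \<comment> \<open>Earlier events belong to distinct elements other than \<open>z\<close>; hence
      \<open>j < card S\<close>, and \<open>q\<close> fits into \<open>l + m\<close> bits.\<close>
    have "inj_on pfst T" by (intro inj_onI) (auto simp: T_def intro: St_unique)
    moreover have "pfst ` T \<subseteq> S - {z}"
    proof
      fix y assume "y \<in> pfst ` T"
      then obtain s where s: "s < s0" "St a u s" "y = pfst s" by (auto simp: T_def)
      have "y \<noteq> z" using St_unique[OF s(2) s0] s by (auto simp: s0_def)
      then show "y \<in> S - {z}" using s by (auto simp: S_def enumerated_def St_def pa u_def)
    qed
    ultimately have "j \<le> card (S - {z})" unfolding j_def using S(1)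
      by (metis card_image card_mono finite_Diff)
    moreover have "z \<in> S" using Dz by (auto simp: S_def enumerated_def)
    ultimately have "j < card S" using S(1) by (metis card_Diff1_less le_less_trans)
    then have j: "j < 2 ^ m" using S(2) by simp
    have q: "q < 2 ^ (l + m)"
    proof -
      have "q < 2 ^ l + 2 ^ l * j" using u by (simp add: q_def)
      also have "\<dots> = 2 ^ l * (j + 1)" by (simp add: algebra_simps)
      also have "\<dots> \<le> 2 ^ l * 2 ^ m" using j by (intro mult_left_mono) auto
      finally show ?thesis by (simp add: power_add)
    qed
    define p where "p = replicate b True @ False # bits b a @ bits (l + m) q"
    define C where "C = string_encode p"
    have lead: "leading_ones C = b" unfolding C_def p_def by (rule leading_ones_string_encode)
    have lenC: "code_length C = 2 * b + 1 + (l + m)" unfolding C_def code_length_string_encode by (simp add: p_def)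
    have AC: "A C = a"
      using code_number_string_encode[OF ab, of "replicate b True @ [False]" "bits (l + m) q"]
      unfolding A_def lead by (simp add: C_def p_def)
    have QC: "Q C = q"
      using code_number_string_encode[OF q, of "replicate b True @ False # bits b a" "[]"]
      unfolding Q_def lead lenC by (simp add: C_def p_def mult_2)
    have sumcard: "(\<Sum>s'<s. of_bool (St a u s')) = card {s'. s' < s \<and> St a u s'}" for s :: nat
    proof -
      have "{..<s} \<inter> {s'. St a u s'} = {s'. s' < s \<and> St a u s'}" by auto
      then show ?thesis by (simp add: of_bool_def sum.If_cases)
    qed
    have H: "Hit a q s \<longleftrightarrow> St a u s \<and> card {s'. s' < s \<and> St a u s'} = j" for s
      unfolding Hit_def pa qm sumcard by simp
    have "s = s0" if s: "Hit a q s" for s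
    proof (rule ccontr)
      \<comment> \<open>The number of earlier events grows strictly along events, so the rank
        \<open>j\<close> singles out \<open>s0\<close>.\<close>
      have lt: "card {r. r < s1 \<and> St a u r} < card {r. r < s2 \<and> St a u r}" if "s1 < s2" "St a u s1" for s1 s2
        using that by (intro psubset_card_mono) (auto intro: less_trans)
      assume "s \<noteq> s0"
      then consider "s < s0" | "s0 < s" by linarith
      then show False using lt[of s s0] lt[of s0 s] s s0 unfolding H j_def T_def by cases auto
    qed
    moreover have "Hit a q s0" unfolding H using s0 by (simp add: j_def T_def)
    ultimately have "(LEAST s. Hit a q s) = s0" "\<exists>s. Hit a q s"
      by (metis LeastI, blast)
    then have "V p = Some (bits N z)"
      unfolding V_def C_def[symmetric] F_def AC QC O'_def pa by (simp add: s0_def)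
    then have "complexity V (bits N z) \<le> enat (length p)" by (rule complexity_le)
    also have "length p = 2 * b + 1 + (l + m)" by (simp add: p_def)
    finally have "complexity V (bits N z) + enat c \<le> enat (2 * b + 1 + (l + m)) + enat c"
      by (rule add_right_mono)
    with c[of "bits N z"] have "complexity U (bits N z) \<le> enat (2 * b + 1 + (l + m)) + enat c"
      by (rule order_trans)
    then show "complexity U (bits (pfst (psnd a)) z) \<le> enat (2 * b + pfst a + m + (c + 1))"
      by (simp add: pa algebra_simps)
  qed
qed

section \<open>Strings as numbers\<close>

lemma bit_less_power: "x < 2 ^ n \<Longrightarrow> bit x i \<Longrightarrow> i < n" for x :: nat
  by (metis bit_take_bit_iff take_bit_nat_eq_self)

text \<open>In this coding \<open>x + 2 ^ n * y\<close> is the string \<open>x\<close> of length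
  \<open>n\<close> followed by \<open>y\<close>.\<close>

lemma bit_append:
  fixes x y :: nat
  assumes "x < 2 ^ n"
  shows "bit (x + 2 ^ n * y) i \<longleftrightarrow> (if i < n then bit x i else bit y (i - n))"
proof -
  have "bit (x + push_bit n y) i \<longleftrightarrow> bit x i \<or> bit (push_bit n y) i"
    by (rule bit_disjunctive_add_iff) (use bit_less_power[OF assms] in \<open>force simp: bit_push_bit_iff_nat\<close>)
  then show ?thesis using bit_less_power[OF assms, of i]
    by (auto simp: push_bit_nat_def bit_push_bit_iff_nat[unfolded push_bit_nat_def] mult.commute)
qed

lemma bit_add_power:
  fixes x :: nat
  assumes "x < 2 ^ n"
  shows "bit (x + 2 ^ n) i \<longleftrightarrow> i = n \<or> bit x i"
  using bit_append[OF assms, of 1 i] bit_less_power[OF assms, of i] by (auto simp: bit_Suc_0_iff)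

text \<open>Sections of a subset of the cube by its top bit, that is, by the last letter. The
  inductions on the dimension, for distances and for noise, split along it.\<close>

definition low :: "nat \<Rightarrow> nat set \<Rightarrow> nat set" where "low n A = {x. x < 2 ^ n \<and> x \<in> A}"
definition high :: "nat \<Rightarrow> nat set \<Rightarrow> nat set" where "high n A = {x. x < 2 ^ n \<and> x + 2 ^ n \<in> A}"

lemma split_low_high:
  assumes "A \<subseteq> {..<2 ^ Suc n}"
  shows "A = low n A \<union> (\<lambda>x. x + 2 ^ n) ` high n A"
proof -
  have "x \<in> (\<lambda>x. x + 2 ^ n) ` high n A" if "x \<in> A" "\<not> x < 2 ^ n" for x
    using that assms by (intro image_eqI[of _ _ "x - 2 ^ n"]) (auto simp: high_def)
  then show ?thesis by (auto simp: low_def high_def)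
qed

lemma sum_split_low_high:
  assumes "A \<subseteq> {..<2 ^ Suc n}"
  shows "sum f A = (\<Sum>x\<in>low n A. f x) + (\<Sum>x\<in>high n A. f (x + 2 ^ n))"
proof -
  have "sum f A = sum f (low n A \<union> (\<lambda>x. x + 2 ^ n) ` high n A)" using split_low_high[OF assms] by simp
  also have "\<dots> = sum f (low n A) + sum f ((\<lambda>x. x + 2 ^ n) ` high n A)"
    by (rule sum.union_disjoint) (auto simp: low_def high_def)
  also have "sum f ((\<lambda>x. x + 2 ^ n) ` high n A) = (\<Sum>x\<in>high n A. f (x + 2 ^ n))"
    by (subst sum.reindex) (auto simp: inj_on_def)
  finally show ?thesis .
qed

lemma card_split_low_high:
  "A \<subseteq> {..<2 ^ Suc n} \<Longrightarrow> card A = card (low n A) + card (high n A)"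
  using sum_split_low_high[of A n "\<lambda>_. 1 :: nat"] by simp

lemma low_high_subset: "low n A \<subseteq> {..<2 ^ n}" "high n A \<subseteq> {..<2 ^ n}"
  by (auto simp: low_def high_def)

definition differences :: "nat \<Rightarrow> nat \<Rightarrow> nat \<Rightarrow> nat" where
  "differences n x y = card {i. i < n \<and> bit x i \<noteq> bit y i}"

lemma differences_Suc:
  "differences (Suc n) x y = differences n x y + of_bool (bit x n \<noteq> bit y n)"
proof -
  have "{i. i < Suc n \<and> bit x i \<noteq> bit y i} =
      (if bit x n \<noteq> bit y n then insert n else id) {i. i < n \<and> bit x i \<noteq> bit y i}"
    by (auto simp: less_Suc_eq)
  then show ?thesis by (auto simp: differences_def)
qed

lemma differences_cong:
  "(\<And>i. i < n \<Longrightarrow> bit x i = bit x' i) \<Longrightarrow> (\<And>i. i < n \<Longrightarrow> bit y i = bit y' i) \<Longrightarrow>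
   differences n x y = differences n x' y'"
  unfolding differences_def by (intro arg_cong[where f = card]) auto

lemma differences_Suc_low_high:
  assumes "x < 2 ^ n" "y < 2 ^ n"
  shows "differences (Suc n) x y = differences n x y" (is ?A)
    "differences (Suc n) (x + 2 ^ n) (y + 2 ^ n) = differences n x y" (is ?B)
    "differences (Suc n) (x + 2 ^ n) y = Suc (differences n x y)" (is ?C)
    "differences (Suc n) x (y + 2 ^ n) = Suc (differences n x y)" (is ?D)
proof -
  have b: "\<not> bit x n" "\<not> bit y n" using assms bit_less_power by blast+
  have "bit (x + 2 ^ n) i = bit x i" "bit (y + 2 ^ n) i = bit y i" if "i < n" for i
    using assms that by (auto simp: bit_add_power)
  then have "differences n (x + 2 ^ n) (y + 2 ^ n) = differences n x y"
    "differences n (x + 2 ^ n) y = differences n x y" "differences n x (y + 2 ^ n) = differences n x y"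
    by (auto intro: differences_cong)
  then show ?A ?B ?C ?D
    using b assms by (auto simp: differences_Suc bit_add_power)
qed

section \<open>Distant sets\<close>

text \<open>Under these constraints the extreme case is \<open>p = l * M\<close> and
  \<open>q = M / l\<close>. This combines the two mixed products in the induction below.\<close>

lemma sum_le_of_product_le:
  fixes p q l M :: real
  assumes "0 \<le> p" "0 \<le> q" "p \<le> l * M" "q \<le> l * M" "p * q \<le> M\<^sup>2" "1 \<le> l" "0 < M"
  shows "p + q \<le> (l + 1 / l) * M"
proof -
  have *: "p + q \<le> (l + 1 / l) * M" if "q \<le> p" "0 \<le> q" "p \<le> l * M" "p * q \<le> M\<^sup>2" for p q
  proof (cases "p \<le> M")
    case True
    have "2 \<le> l + 1 / l"
    proof -
      have "0 \<le> (l - 1)\<^sup>2 / l" using assms by simp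
      also have "\<dots> = l + 1 / l - 2" using assms by (simp add: field_simps power2_eq_square)
      finally show ?thesis by simp
    qed
    then have "2 * M \<le> (l + 1 / l) * M" using assms by (intro mult_right_mono) auto
    then show ?thesis using True that by linarith
  next
    case False
    then have p: "0 < p" using assms by linarith
    \<comment> \<open>Since \<open>p\<close> lies between \<open>M / l\<close> and
      \<open>l * M\<close>, this product is nonnegative; expanded, it bounds
      \<open>p + M\<^sup>2 / p\<close>, and \<open>q\<close> is at most the second summand.\<close>
    have "0 \<le> (l * M - p) * (p - M / l)"
    proof (intro mult_nonneg_nonneg)
      have "M / l \<le> M / 1" using assms by (intro divide_left_mono) auto
      then show "0 \<le> p - M / l" using False by simp
    qed (use that in simp)
    also have "\<dots> = (l + 1 / l) * M * p - p * p - M\<^sup>2"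
      using assms by (simp add: field_simps power2_eq_square)
    finally have "(p + q) * p \<le> (l + 1 / l) * M * p" using that(4) by (simp add: algebra_simps)
    then show ?thesis using p by simp
  qed
  show ?thesis
  proof (cases "q \<le> p")
    case True then show ?thesis using * assms by blast
  next
    case False then show ?thesis using *[of p q] assms by (simp add: mult.commute add.commute)
  qed
qed

text \<open>Talagrand's induction for two sets instead of one set and the distance to it.\<close>

lemma card_mult_card_distant:
  fixes l :: real
  assumes "A \<subseteq> {..<2 ^ n}" "B \<subseteq> {..<2 ^ n}" "1 \<le> l"
    and "\<And>x y. x \<in> A \<Longrightarrow> y \<in> B \<Longrightarrow> D \<le> differences n x y"
  shows "real (card A) * real (card B) * l ^ D \<le> (2 + l + 1 / l) ^ n"
  using assms
proof (induction n arbitrary: A B D)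
  case 0
  have c: "card A \<le> 1" "card B \<le> 1" using 0(1,2) card_mono[of "{0::nat}" A] card_mono[of "{0::nat}" B] by auto
  show ?case
  proof (cases "A = {} \<or> B = {}")
    case False
    then have "D = 0" using 0(4) by (fastforce simp: differences_def)
    then show ?thesis using c mult_mono[of "real (card A)" 1 "real (card B)" 1] by auto
  qed auto
next
  case (Suc n)
  \<comment> \<open>\<open>M\<close> bounds the product for halves with equal top bits. With
    opposite top bits one difference is already spent, which costs a factor
    \<open>l\<close>.\<close>
  define M where "M = (2 + l + 1 / l) ^ n / l ^ D"
  have l: "0 < l" using Suc.prems by simp
  have M: "0 < M" using l by (simp add: M_def add_pos_pos)
  let ?A0 = "low n A" and ?A1 = "high n A" and ?B0 = "low n B" and ?B1 = "high n B"
  note sub = low_high_subset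
  have far: "D \<le> differences n x y" if "x \<in> ?A0" "y \<in> ?B0" for x y
    using Suc.prems(4)[of x y] that differences_Suc_low_high(1)[of x n y] by (auto simp: low_def)
  have far': "D \<le> differences n x y" if "x \<in> ?A1" "y \<in> ?B1" for x y
    using Suc.prems(4)[of "x + 2 ^ n" "y + 2 ^ n"] that differences_Suc_low_high(2)[of x n y] by (auto simp: high_def)
  have near: "D - 1 \<le> differences n x y" if "x \<in> ?A0" "y \<in> ?B1" for x y
    using Suc.prems(4)[of x "y + 2 ^ n"] that differences_Suc_low_high(4)[of x n y] by (auto simp: low_def high_def)
  have near': "D - 1 \<le> differences n x y" if "x \<in> ?A1" "y \<in> ?B0" for x y
    using Suc.prems(4)[of "x + 2 ^ n" y] that differences_Suc_low_high(3)[of x n y] by (auto simp: low_def high_def)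
  have lM: "(2 + l + 1 / l) ^ n / l ^ (D - 1) \<le> l * M"
  proof (cases D)
    case 0 then show ?thesis using Suc.prems(3) M by (simp add: M_def)
  next
    case (Suc D') then show ?thesis using l by (simp add: M_def)
  qed
  have le: "real a * real b \<le> K / l ^ D" if "real a * real b * l ^ D \<le> K" for a b K D
    using that l by (simp add: field_simps)
  have 00: "real (card ?A0) * real (card ?B0) \<le> M"
    using le[OF Suc.IH[OF sub(1) sub(1) Suc.prems(3) far]] by (simp add: M_def)
  have 11: "real (card ?A1) * real (card ?B1) \<le> M"
    using le[OF Suc.IH[OF sub(2) sub(2) Suc.prems(3) far']] by (simp add: M_def)
  have 01: "real (card ?A0) * real (card ?B1) \<le> l * M"
    using order_trans[OF le[OF Suc.IH[OF sub(1) sub(2) Suc.prems(3) near]] lM] .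
  have 10: "real (card ?A1) * real (card ?B0) \<le> l * M"
    using order_trans[OF le[OF Suc.IH[OF sub(2) sub(1) Suc.prems(3) near']] lM] .
  \<comment> \<open>The two mixed products have the same product as the two pure ones, so they
    cannot both be as large as \<open>l * M\<close> unless \<open>l = 1\<close>. This improves
    \<open>2 * l\<close> to \<open>l + 1 / l\<close>.\<close>
  have "real (card ?A0) * real (card ?B1) * (real (card ?A1) * real (card ?B0))
      = (real (card ?A0) * real (card ?B0)) * (real (card ?A1) * real (card ?B1))" by (simp add: algebra_simps)
  also have "\<dots> \<le> M * M" using 00 11 M by (intro mult_mono) auto
  finally have "real (card ?A0) * real (card ?B1) + real (card ?A1) * real (card ?B0) \<le> (l + 1 / l) * M"
    using 01 10 Suc.prems(3) M by (intro sum_le_of_product_le) (auto simp: power2_eq_square)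
  then have "real (card A) * real (card B) \<le> (2 + l + 1 / l) * M"
    using 00 11 unfolding card_split_low_high[OF Suc.prems(1)] card_split_low_high[OF Suc.prems(2)]
    by (simp add: algebra_simps)
  then show ?case using l by (simp add: M_def field_simps)
qed

lemma powr_one_plus_le:
  fixes z q :: real
  assumes "0 \<le> z" "0 \<le> q" "q \<le> 1"
  shows "(1 + z) powr q \<le> 1 + q * z"
  using Youngs_inequality_0[of q "1 - q" "1 + z" 1] assms by (simp add: algebra_simps)

lemma one_plus_le_two_powr: "0 \<le> h \<Longrightarrow> 1 + h \<le> 2 powr (2 * h)" for h :: real
proof -
  assume "0 \<le> h"
  moreover have "1 / 2 \<le> ln (2 :: real)" using ln_le_minus_one[of "1 / 2 :: real"] by (simp add: ln_div)
  ultimately have "h * 1 \<le> h * (2 * ln 2)" by (intro mult_left_mono) auto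
  then have *: "exp h \<le> exp (2 * h * ln 2)" by simp
  show ?thesis using order_trans[OF exp_ge_add_one_self *] by (simp add: powr_def)
qed

text \<open>With \<open>l = 1 + d\<close> one has \<open>2 + l + 1 / l = 4 + d\<^sup>2 / l\<close>,
  an excess of at most \<open>2 powr (d\<^sup>2 * n / 2)\<close> in total, while
  \<open>2 powr d \<le> l\<close> makes the factor \<open>l ^ D\<close> at least the square of
  that.\<close>

lemma card_mult_card_distant_power2:
  assumes A: "A \<subseteq> {..<2 ^ n}" and B: "B \<subseteq> {..<2 ^ n}"
    and d: "0 < d" "d \<le> 1"
    and far: "\<And>x y. x \<in> A \<Longrightarrow> y \<in> B \<Longrightarrow> d * real n \<le> real (differences n x y)"
  shows "real (card A) * real (card B) \<le> 4 ^ n * 2 powr (- (d\<^sup>2 * real n / 2))"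
proof -
  define l where "l = 1 + d"
  define D where "D = nat \<lceil>d * real n\<rceil>"
  have l: "1 \<le> l" using d by (simp add: l_def)
  have "real (card A) * real (card B) * l ^ D \<le> (2 + l + 1 / l) ^ n"
  proof (rule card_mult_card_distant[OF A B l])
    fix x y assume "x \<in> A" "y \<in> B"
    then show "D \<le> differences n x y" using far[of x y] by (simp add: D_def nat_le_iff ceiling_le_iff)
  qed
  also have "\<dots> \<le> (4 * 2 powr (d\<^sup>2 / 2)) ^ n"
  proof (rule power_mono)
    have "2 + l + 1 / l = 4 + d\<^sup>2 / l" using d by (simp add: l_def field_simps power2_eq_square)
    also have "d\<^sup>2 / l \<le> d\<^sup>2 / 1" using l by (intro divide_left_mono) auto
    also have "4 + d\<^sup>2 / 1 = 4 * (1 + d\<^sup>2 / 4)" by simp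
    also have "1 + d\<^sup>2 / 4 \<le> 2 powr (d\<^sup>2 / 2)" using one_plus_le_two_powr[of "d\<^sup>2 / 4"] by simp
    finally show "2 + l + 1 / l \<le> 4 * 2 powr (d\<^sup>2 / 2)" by simp
  qed (use l in \<open>simp add: add_nonneg_nonneg\<close>)
  also have "\<dots> = 4 ^ n * 2 powr (d\<^sup>2 * real n / 2)"
    by (simp add: power_mult_distrib powr_power mult.commute)
  finally have 1: "real (card A) * real (card B) * l ^ D \<le> 4 ^ n * 2 powr (d\<^sup>2 * real n / 2)" .
  have "2 powr (d\<^sup>2 * real n) = (2 powr d) powr (d * real n)"
    by (simp add: powr_powr power2_eq_square mult.assoc)
  also have "\<dots> \<le> l powr (d * real n)"
  proof (rule powr_mono2)
    show "2 powr d \<le> l" using powr_one_plus_le[of 1 d] d by (simp add: l_def)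
  qed (use d in auto)
  also have "\<dots> \<le> l powr real D"
    using l by (intro powr_mono) (auto simp: D_def real_nat_ceiling_ge)
  also have "\<dots> = l ^ D" using l by (simp add: powr_realpow)
  finally have "real (card A) * real (card B) * 2 powr (d\<^sup>2 * real n) \<le> real (card A) * real (card B) * l ^ D"
    by (intro mult_left_mono) auto
  with 1 have "real (card A) * real (card B) * 2 powr (d\<^sup>2 * real n) \<le> 4 ^ n * 2 powr (d\<^sup>2 * real n / 2)" by linarith
  then have "real (card A) * real (card B) \<le> 4 ^ n * 2 powr (d\<^sup>2 * real n / 2) / 2 powr (d\<^sup>2 * real n)"
    by (simp add: field_simps)
  also have "\<dots> = 4 ^ n * 2 powr (d\<^sup>2 * real n / 2 - d\<^sup>2 * real n)"
    by (simp only: powr_diff times_divide_eq_right)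
  also have "d\<^sup>2 * real n / 2 - d\<^sup>2 * real n = - (d\<^sup>2 * real n / 2)" by linarith
  finally show ?thesis .
qed

section \<open>Noise\<close>

text \<open>Bonami's two-point inequality between the 2-norm and the p-norm. It follows from the
  quadratic bound \<open>1 + p * (p - 1) / 2 * b\<^sup>2 \<le> \<phi> b\<close> and Bernoulli's
  inequality with exponent \<open>2 / p\<close>.\<close>

lemma bonami_two_point:
  fixes p b :: real
  assumes p: "1 \<le> p" "p \<le> 2" and b: "0 \<le> b" "b \<le> 1"
  shows "1 + (p - 1) * b\<^sup>2 \<le> (((1 + b) powr p + (1 - b) powr p) / 2) powr (2 / p)"
proof -
  define r where "r = p - 1"
  \<comment> \<open>This is the sign of the derivative of \<open>\<phi>\<close> minus its quadratic
    part.\<close>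
  have odd_part: "2 * r * x \<le> (1 + x) powr r - (1 - x) powr r" if x: "0 \<le> x" "x < 1" for x
  proof -
    have "(1 + 0) powr r - (1 - 0) powr r - 2 * r * 0 \<le> (1 + x) powr r - (1 - x) powr r - 2 * r * x"
    proof (rule DERIV_nonneg_imp_nondecreasing[OF x(1)])
      fix u assume u: "0 \<le> u" "u \<le> x"
      then have u1: "u < 1" using x by simp
      have "((\<lambda>u. (1 + u) powr r - (1 - u) powr r - 2 * r * u) has_real_derivative
          r * ((1 + u) powr (r - 1) + (1 - u) powr (r - 1) - 2)) (at u)"
        using u u1 by (auto intro!: derivative_eq_intros simp: algebra_simps powr_diff)
      \<comment> \<open>Arithmetic and geometric mean: the product of the two terms is at least 1,
        because \<open>r - 1\<close> is not positive.\<close>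
      moreover have "2 \<le> (1 + u) powr (r - 1) + (1 - u) powr (r - 1)"
      proof -
        define s t where "s = (1 + u) powr (r - 1)" and "t = (1 - u) powr (r - 1)"
        have "s * t = ((1 + u) * (1 - u)) powr (r - 1)"
          using u u1 by (simp add: s_def t_def powr_mult)
        also have "\<dots> = (1 - u\<^sup>2) powr (r - 1)" by (simp add: algebra_simps power2_eq_square)
        also have "\<dots> \<ge> (1 - u\<^sup>2) powr 0"
          using u u1 p power_le_one[of u 2] power_strict_mono[of u 1 2]
          by (intro powr_mono') (auto simp: r_def)
        finally have "1 \<le> s * t" using u u1 power_strict_mono[of u 1 2] by simp
        moreover have "(s + t)\<^sup>2 = (s - t)\<^sup>2 + 4 * (s * t)" by (simp add: power2_eq_square algebra_simps)
        ultimately have "2\<^sup>2 \<le> (s + t)\<^sup>2"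
          using zero_le_power2[of "s - t"] unfolding power2_eq_square[of "2 :: real"] by linarith
        then have "2 \<le> s + t" by (rule power2_le_imp_le) (simp add: s_def t_def)
        then show ?thesis by (simp add: s_def t_def)
      qed
      ultimately show "\<exists>y. ((\<lambda>u. (1 + u) powr r - (1 - u) powr r - 2 * r * u) has_real_derivative y) (at u) \<and> 0 \<le> y"
        using p by (intro exI conjI) (assumption, simp add: r_def)
    qed
    then show ?thesis by simp
  qed
  define \<phi> where "\<phi> b = ((1 + b) powr p + (1 - b) powr p) / 2" for b
  have "\<phi> 0 - p * (p - 1) / 2 * 0\<^sup>2 \<le> \<phi> b - p * (p - 1) / 2 * b\<^sup>2"
  \<comment> \<open>The open version avoids differentiating \<open>(1 - x) powr p\<close> at
    \<open>b = 1\<close>; continuity suffices there.\<close>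
  proof (rule DERIV_nonneg_imp_increasing_open[OF b(1)])
    fix x assume x: "0 < x" "x < b"
    then have x1: "x < 1" using b by simp
    have "((\<lambda>b. \<phi> b - p * (p - 1) / 2 * b\<^sup>2) has_real_derivative
        p / 2 * ((1 + x) powr r - (1 - x) powr r - 2 * r * x)) (at x)"
      unfolding \<phi>_def r_def using x x1
      by (auto intro!: derivative_eq_intros simp: field_simps power2_eq_square)
    moreover have "0 \<le> p / 2 * ((1 + x) powr r - (1 - x) powr r - 2 * r * x)"
      using odd_part[of x] x x1 p by simp
    ultimately show "\<exists>y. ((\<lambda>b. \<phi> b - p * (p - 1) / 2 * b\<^sup>2) has_real_derivative y) (at x) \<and> 0 \<le> y"
      by blast
  next
    show "continuous_on {0..b} (\<lambda>b. \<phi> b - p * (p - 1) / 2 * b\<^sup>2)"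
      unfolding \<phi>_def using p b by (intro continuous_intros continuous_on_powr') auto
  qed
  then have \<phi>: "1 + p * (p - 1) / 2 * b\<^sup>2 \<le> \<phi> b" by (simp add: \<phi>_def field_simps)
  have "1 + (p - 1) * b\<^sup>2 = 1 + (2 / p) * (p * (p - 1) / 2 * b\<^sup>2)" using p by simp
  also have "\<dots> \<le> (1 + p * (p - 1) / 2 * b\<^sup>2) powr (2 / p)"
  proof -
    define z where "z = p * (p - 1) / 2 * b\<^sup>2"
    have z: "0 \<le> z" using p by (simp add: z_def)
    have "1 + (2 / p) * z \<le> (1 + z) powr (2 / p)"
    proof -
      have "(1 + (2 / p) * z) powr (p / 2) \<le> 1 + z"
        using powr_one_plus_le[of "(2 / p) * z" "p / 2"] z p by simp
      then have "((1 + (2 / p) * z) powr (p / 2)) powr (2 / p) \<le> (1 + z) powr (2 / p)"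
        using p by (intro powr_mono2) auto
      then show ?thesis using p z by (simp add: powr_powr)
    qed
    then show ?thesis by (simp add: z_def)
  qed
  also have "\<dots> \<le> \<phi> b powr (2 / p)" using \<phi> p by (intro powr_mono2) auto
  finally show ?thesis by (simp add: \<phi>_def)
qed

text \<open>Writing the values as \<open>a * (1 + b)\<close> and \<open>a * (1 - b)\<close>, noise
  \<open>d\<close> turns the form into \<open>2 * a\<^sup>2 * (1 + (1 - 2 * d) * b\<^sup>2)\<close>,
  whence \<open>p - 1 = 1 - 2 * d\<close>. More noise only lowers the form. The power of 2 converts
  means into sums.\<close>

lemma two_point_quadratic:
  fixes F0 F1 d e p :: real
  assumes F: "0 \<le> F0" "0 \<le> F1" and d: "0 < d" "d \<le> e" "e \<le> 1 / 2" and p: "p = 2 - 2 * d"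
  shows "(1 - e) * (F0\<^sup>2 + F1\<^sup>2) + 2 * e * (F0 * F1)
    \<le> 2 powr (1 - 2 / p) * (F0 powr p + F1 powr p) powr (2 / p)"
proof -
  have *: "(1 - e) * (F0\<^sup>2 + F1\<^sup>2) + 2 * e * (F0 * F1)
      \<le> 2 powr (1 - 2 / p) * (F0 powr p + F1 powr p) powr (2 / p)"
    if F: "0 < F0" "0 \<le> F1" "F1 \<le> F0" for F0 F1
  proof -
    define a b where "a = (F0 + F1) / 2" and "b = (F0 - F1) / (F0 + F1)"
    have pos: "0 < F0 + F1" using F by simp
    have a: "0 < a" using pos by (simp add: a_def)
    have b: "0 \<le> b" "b \<le> 1" using F pos by (auto simp: b_def field_simps)
    have ab: "a * b = (F0 - F1) / 2" using pos unfolding a_def b_def by (simp add: divide_simps)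
    have F0: "F0 = a * (1 + b)" and F1: "F1 = a * (1 - b)"
      unfolding distrib_left right_diff_distrib ab by (simp_all add: a_def field_simps)
    have p1: "1 \<le> p" "p \<le> 2" using d p by auto
    have "0 \<le> (e - d) * (F0 - F1)\<^sup>2" using d by simp
    then have "(1 - e) * (F0\<^sup>2 + F1\<^sup>2) + 2 * e * (F0 * F1) \<le> (1 - d) * (F0\<^sup>2 + F1\<^sup>2) + 2 * d * (F0 * F1)"
      by (simp add: power2_eq_square algebra_simps)
    also have "\<dots> = 2 * a\<^sup>2 * (1 + (p - 1) * b\<^sup>2)"
      unfolding F0 F1 p by (simp add: power2_eq_square algebra_simps)
    also have "\<dots> \<le> 2 * a\<^sup>2 * (((1 + b) powr p + (1 - b) powr p) / 2) powr (2 / p)"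
      by (intro mult_left_mono bonami_two_point p1 b) simp
    also have "\<dots> = 2 powr (1 - 2 / p) * (a powr p * ((1 + b) powr p + (1 - b) powr p)) powr (2 / p)"
    proof -
      have "(a powr p) powr (2 / p) = a\<^sup>2" using a p1 by (simp add: powr_powr powr_numeral)
      moreover have "2 powr (1 - 2 / p) * (z powr (2 / p)) = 2 * (z / 2) powr (2 / p)" if "0 \<le> z" for z :: real
        using that by (simp add: powr_diff powr_divide)
      ultimately show ?thesis by (simp add: powr_mult)
    qed
    also have "a powr p * ((1 + b) powr p + (1 - b) powr p) = F0 powr p + F1 powr p"
      unfolding F0 F1 powr_mult[of a "1 + b"] powr_mult[of a "1 - b"] by (rule distrib_left)
    finally show ?thesis .
  qed
  consider "F0 = 0" "F1 = 0" | "0 < F0" "F1 \<le> F0" | "0 < F1" "F0 \<le> F1" using F by linarith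
  then show ?thesis
  proof cases
    case 3 then show ?thesis using *[of F1 F0] F by (simp add: add.commute mult.commute)
  qed (use * F in auto)
qed

text \<open>Cauchy-Schwarz for a form that is semidefinite because \<open>e \<le> 1 / 2\<close>,
  with the remainder written out.\<close>

lemma two_point_bilinear:
  fixes F0 F1 G0 G1 d e p :: real
  assumes F: "0 \<le> F0" "0 \<le> F1" and G: "0 \<le> G0" "0 \<le> G1"
    and d: "0 < d" "d \<le> e" "e \<le> 1 / 2" and p: "p = 2 - 2 * d"
  shows "(1 - e) * (F0 * G0 + F1 * G1) + e * (F0 * G1 + F1 * G0)
    \<le> 2 powr (1 - 2 / p) * ((F0 powr p + F1 powr p) powr (1 / p) * (G0 powr p + G1 powr p) powr (1 / p))"
proof -
  define q where "q x y = (1 - e) * (x\<^sup>2 + y\<^sup>2) + 2 * e * (x * y)" for x y :: real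
  define u where "u = (1 - e) * (F0 * G0 + F1 * G1) + e * (F0 * G1 + F1 * G0)"
  define c where "c = 2 powr (1 - 2 / p)"
  define f g where "f = F0 powr p + F1 powr p" and "g = G0 powr p + G1 powr p"
  have "q F0 F1 * q G0 G1 - u\<^sup>2 = (1 - 2 * e) * (F0 * G1 - F1 * G0)\<^sup>2"
    by (simp add: q_def u_def power2_eq_square algebra_simps)
  also have "\<dots> \<ge> 0" using d by simp
  finally have "u\<^sup>2 \<le> q F0 F1 * q G0 G1" by simp
  also have "\<dots> \<le> (c * f powr (2 / p)) * (c * g powr (2 / p))"
    using two_point_quadratic[OF F d p] two_point_quadratic[OF G d p] F G d
    by (intro mult_mono) (auto simp: q_def c_def f_def g_def)
  also have "\<dots> = (c * (f powr (1 / p) * g powr (1 / p)))\<^sup>2"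
    by (simp add: power2_eq_square powr_add[symmetric] mult.assoc mult.left_commute)
  finally have "u \<le> c * (f powr (1 / p) * g powr (1 / p))"
    by (rule power2_le_imp_le) (simp add: c_def)
  then show ?thesis by (simp add: u_def c_def f_def g_def)
qed

text \<open>The probability that independent flips, of bit \<open>i\<close> with probability
  \<open>\<delta> i\<close>, turn \<open>x\<close> into \<open>y\<close>.\<close>

definition noise :: "(nat \<Rightarrow> real) \<Rightarrow> nat \<Rightarrow> nat \<Rightarrow> nat \<Rightarrow> real" where
  "noise \<delta> n x y = (\<Prod>i<n. if bit x i = bit y i then 1 - \<delta> i else \<delta> i)"

lemma noise_cong:
  "(\<And>i. i < n \<Longrightarrow> bit x i = bit x' i) \<Longrightarrow> (\<And>i. i < n \<Longrightarrow> bit y i = bit y' i) \<Longrightarrow>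
   noise \<delta> n x y = noise \<delta> n x' y'"
  unfolding noise_def by (intro prod.cong) auto

lemma noise_Suc:
  "noise \<delta> (Suc n) x y = noise \<delta> n x y * (if bit x n = bit y n then 1 - \<delta> n else \<delta> n)"
  by (simp add: noise_def)

lemma noise_Suc_low_high:
  assumes "x < 2 ^ n" "y < 2 ^ n"
  shows "noise \<delta> (Suc n) x y = noise \<delta> n x y * (1 - \<delta> n)" (is ?A)
    "noise \<delta> (Suc n) (x + 2 ^ n) (y + 2 ^ n) = noise \<delta> n x y * (1 - \<delta> n)" (is ?B)
    "noise \<delta> (Suc n) (x + 2 ^ n) y = noise \<delta> n x y * \<delta> n" (is ?C)
    "noise \<delta> (Suc n) x (y + 2 ^ n) = noise \<delta> n x y * \<delta> n" (is ?D)
proof -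
  have b: "\<not> bit x n" "\<not> bit y n" using assms bit_less_power by blast+
  have "bit (x + 2 ^ n) i = bit x i" "bit (y + 2 ^ n) i = bit y i" if "i < n" for i
    using assms that by (auto simp: bit_add_power)
  then have "noise \<delta> n (x + 2 ^ n) (y + 2 ^ n) = noise \<delta> n x y"
    "noise \<delta> n (x + 2 ^ n) y = noise \<delta> n x y" "noise \<delta> n x (y + 2 ^ n) = noise \<delta> n x y"
    by (auto intro: noise_cong)
  then show ?A ?B ?C ?D
    using b assms by (auto simp: noise_Suc bit_add_power)
qed

text \<open>Hypercontractivity for indicator functions: the two-point inequality tensorises, and it remains
  true at a coordinate with more noise than \<open>d\<close>.\<close>

lemma noise_small_sets:
  assumes "A \<subseteq> {..<2 ^ n}" "V \<subseteq> {..<2 ^ n}"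
    and d: "0 < d" "\<And>i. i < n \<Longrightarrow> d \<le> \<delta> i" "\<And>i. i < n \<Longrightarrow> \<delta> i \<le> 1 / 2" "d < 1" and p: "p = 2 - 2 * d"
  shows "(\<Sum>x\<in>A. \<Sum>y\<in>V. noise \<delta> n x y)
    \<le> 2 powr (real n * (1 - 2 / p)) * (real (card A) powr (1 / p) * real (card V) powr (1 / p))"
  using assms(1,2) d(2,3)
proof (induction n arbitrary: A V)
  case 0
  have c: "A = {} \<or> A = {0}" "V = {} \<or> V = {0}" using 0(1,2) by (auto simp: subset_singleton_iff lessThan_Suc)
  then show ?case by (auto simp: noise_def)
next
  case (Suc n)
  define S where "S A V = (\<Sum>x\<in>A. \<Sum>y\<in>V. noise \<delta> n x y)" for A V
  define c where "c = 2 powr (real n * (1 - 2 / p))"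
  let ?A0 = "low n A" and ?A1 = "high n A" and ?V0 = "low n V" and ?V1 = "high n V"
  \<comment> \<open>The p-norm of an indicator function. Its p-th power is the cardinality, which is
    additive over the two halves.\<close>
  define F where "F A = real (card A) powr (1 / p)" for A :: "nat set"
  have IH: "S A V \<le> c * (F A * F V)" if "A \<subseteq> {..<2 ^ n}" "V \<subseteq> {..<2 ^ n}" for A V
    unfolding S_def c_def F_def by (rule Suc.IH[OF that]) (use Suc.prems in auto)
  note sub = low_high_subset
  define e where "e = \<delta> n"
  have e: "d \<le> e" "e \<le> 1 / 2" using Suc.prems by (auto simp: e_def)
  have p0: "0 < p" using d p by simp
  have "(\<Sum>x\<in>A. \<Sum>y\<in>V. noise \<delta> (Suc n) x y) =
      (\<Sum>x\<in>?A0. (\<Sum>y\<in>?V0. noise \<delta> (Suc n) x y) + (\<Sum>y\<in>?V1. noise \<delta> (Suc n) x (y + 2 ^ n)))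
    + (\<Sum>x\<in>?A1. (\<Sum>y\<in>?V0. noise \<delta> (Suc n) (x + 2 ^ n) y) + (\<Sum>y\<in>?V1. noise \<delta> (Suc n) (x + 2 ^ n) (y + 2 ^ n)))"
    unfolding sum_split_low_high[OF Suc.prems(1)] sum_split_low_high[OF Suc.prems(2)] ..
  also have "\<dots> = (\<Sum>x\<in>?A0. (\<Sum>y\<in>?V0. noise \<delta> n x y * (1 - e)) + (\<Sum>y\<in>?V1. noise \<delta> n x y * e))
    + (\<Sum>x\<in>?A1. (\<Sum>y\<in>?V0. noise \<delta> n x y * e) + (\<Sum>y\<in>?V1. noise \<delta> n x y * (1 - e)))"
    by (intro arg_cong2[where f = "(+)"] sum.cong refl)
      (auto simp: noise_Suc_low_high low_def high_def e_def)
  also have "\<dots> = (1 - e) * (S ?A0 ?V0 + S ?A1 ?V1) + e * (S ?A0 ?V1 + S ?A1 ?V0)"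
    unfolding S_def sum.distrib sum_distrib_right[symmetric] by (simp only: algebra_simps)
  also have "\<dots> \<le> (1 - e) * (c * (F ?A0 * F ?V0) + c * (F ?A1 * F ?V1)) + e * (c * (F ?A0 * F ?V1) + c * (F ?A1 * F ?V0))"
    using e d by (intro add_mono mult_left_mono IH sub) auto
  also have "\<dots> = c * ((1 - e) * (F ?A0 * F ?V0 + F ?A1 * F ?V1) + e * (F ?A0 * F ?V1 + F ?A1 * F ?V0))"
    by (simp add: algebra_simps)
  also have "\<dots> \<le> c * (2 powr (1 - 2 / p) * ((F ?A0 powr p + F ?A1 powr p) powr (1 / p) * (F ?V0 powr p + F ?V1 powr p) powr (1 / p)))"
    by (intro mult_left_mono two_point_bilinear[OF _ _ _ _ d(1) e p]) (auto simp: F_def c_def)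
  also have "F ?A0 powr p + F ?A1 powr p = real (card A)"
    using p0 by (simp add: F_def powr_powr card_split_low_high[OF Suc.prems(1)])
  also have "F ?V0 powr p + F ?V1 powr p = real (card V)"
    using p0 by (simp add: F_def powr_powr card_split_low_high[OF Suc.prems(2)])
  also have "c * (2 powr (1 - 2 / p) * (real (card A) powr (1 / p) * real (card V) powr (1 / p)))
    = 2 powr (real (Suc n) * (1 - 2 / p)) * (real (card A) powr (1 / p) * real (card V) powr (1 / p))"
  proof -
    have "real (Suc n) * (1 - 2 / p) = real n * (1 - 2 / p) + (1 - 2 / p)" by (simp add: algebra_simps add_divide_distrib)
    then show ?thesis by (simp only: c_def powr_add mult.assoc)
  qed
  finally show ?case .
qed

lemma noise_nonneg: "(\<And>i. i < n \<Longrightarrow> 0 \<le> \<delta> i \<and> \<delta> i \<le> 1) \<Longrightarrow> 0 \<le> noise \<delta> n x y"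
  unfolding noise_def by (intro prod_nonneg) auto

text \<open>The expectation of a product of independent weights \<open>t i\<close>, one for each
  flipped bit. Weight 1 gives the total mass, weight 2 on a block the exponential moment of its
  number of flips.\<close>

lemma sum_noise_product:
  "(\<Sum>y<2 ^ n. noise \<delta> n x y * (\<Prod>i<n. if bit x i = bit y i then 1 else t i))
    = (\<Prod>i<n. 1 - \<delta> i + \<delta> i * t i)"
proof (induction n)
  case (Suc n)
  define h where "h n y = noise \<delta> n x y * (\<Prod>i<n. if bit x i = bit y i then 1 else t i)" for n y
  have b: "\<not> bit y n" if "y < 2 ^ n" for y :: nat using that bit_less_power by blast
  have lo: "low n {..<2 ^ Suc n} = {..<2 ^ n}" "high n {..<2 ^ Suc n} = {..<2 ^ n}"
    by (auto simp: low_def high_def)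
  have h1: "h n (y + 2 ^ n) = h n y" if "y < 2 ^ n" for y
    unfolding h_def using that
    by (intro arg_cong2[where f = "(*)"] noise_cong prod.cong) (auto simp: bit_add_power)
  have h2: "h (Suc n) y = h n y * (if bit x n = bit y n then 1 - \<delta> n else \<delta> n * t n)" for y
    by (simp add: h_def noise_Suc)
  have "(\<Sum>y<2 ^ Suc n. h (Suc n) y) = (\<Sum>y<2 ^ n. h (Suc n) y) + (\<Sum>y<2 ^ n. h (Suc n) (y + 2 ^ n))"
    using sum_split_low_high[of "{..<2 ^ Suc n}" n "h (Suc n)"] unfolding lo by simp
  also have "\<dots> = (\<Sum>y<2 ^ n. h n y * (1 - \<delta> n + \<delta> n * t n))"
    unfolding sum.distrib[symmetric] h2
    by (intro sum.cong refl) (auto simp: h1 b bit_add_power algebra_simps)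
  finally show ?case using Suc by (simp add: h_def sum_distrib_right[symmetric])
qed (simp add: noise_def)

text \<open>The bits beyond \<open>m\<close> sum out to 1. Hits at all lengths can thus be compared
  under one law on strings of length \<open>n\<close>.\<close>

lemma noise_marginal:
  assumes "m \<le> n" "\<And>y y'. (\<And>i. i < m \<Longrightarrow> bit y i = bit y' i) \<Longrightarrow> h y = (h y' :: real)"
  shows "(\<Sum>y<2 ^ n. noise \<delta> n x y * h y) = (\<Sum>y<2 ^ m. noise \<delta> m x y * h y)"
  using assms(1)
proof (induction n rule: dec_induct)
  case (step n)
  have b: "\<not> bit y n" if "y < 2 ^ n" for y :: nat using that bit_less_power by blast
  have lo: "low n {..<2 ^ Suc n} = {..<2 ^ n}" "high n {..<2 ^ Suc n} = {..<2 ^ n}"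
    by (auto simp: low_def high_def)
  have h1: "h (y + 2 ^ n) = h y" "noise \<delta> n x (y + 2 ^ n) = noise \<delta> n x y" if "y < 2 ^ n" for y
    using that step(1) by (auto simp: bit_add_power intro!: assms(2) noise_cong)
  have "(\<Sum>y<2 ^ Suc n. noise \<delta> (Suc n) x y * h y) =
     (\<Sum>y<2 ^ n. noise \<delta> (Suc n) x y * h y) + (\<Sum>y<2 ^ n. noise \<delta> (Suc n) x (y + 2 ^ n) * h (y + 2 ^ n))"
    using sum_split_low_high[of "{..<2 ^ Suc n}" n "\<lambda>y. noise \<delta> (Suc n) x y * h y"] unfolding lo by simp
  also have "\<dots> = (\<Sum>y<2 ^ n. noise \<delta> n x y * h y)"
    unfolding sum.distrib[symmetric]
    by (intro sum.cong refl) (auto simp: h1 b bit_add_power noise_Suc algebra_simps)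
  finally show ?case using step by simp
qed simp

section \<open>Sequences, levels and schedules\<close>

definition segment_number :: "bitseq \<Rightarrow> nat \<Rightarrow> nat" where
  "segment_number X n = horner_sum of_bool 2 (map X [0..<n])"

lemma bit_segment_number: "bit (segment_number X n) i \<longleftrightarrow> i < n \<and> X i"
  by (auto simp: segment_number_def bit_horner_sum_bit_iff)

lemma segment_number_less: "segment_number X n < 2 ^ n"
proof -
  have "take_bit n (segment_number X n) = segment_number X n"
    by (rule bit_eqI) (auto simp: bit_take_bit_iff bit_segment_number)
  then show ?thesis by (metis take_bit_nat_less_exp)
qed

lemma bits_segment_number: "bits n (segment_number X n) = initial_segment X n"
  by (simp add: bits_def initial_segment_def bit_segment_number)

lemma bits_cong: "(\<And>i. i < n \<Longrightarrow> bit x i = bit y i) \<Longrightarrow> bits n x = bits n y"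
  by (simp add: bits_def)

lemma bits_eq_iff: "bits n x = bits n y \<longleftrightarrow> (\<forall>i<n. bit x i = bit y i)"
  by (auto simp: bits_def)

lemma inj_on_bits: "inj_on (bits n) {..<2 ^ n}"
proof (rule inj_onI)
  fix x y :: nat assume *: "x \<in> {..<2 ^ n}" "y \<in> {..<2 ^ n}" "bits n x = bits n y"
  show "x = y"
  proof (rule bit_eqI)
    show "bit x i = bit y i" for i
      using * bit_less_power[of x n i] bit_less_power[of y n i] by (auto simp: bits_eq_iff)
  qed
qed

text \<open>The binary logarithm rounded down, with value 0 at 0; as a bounded sum it is recursive
  by the closure rules.\<close>

definition level :: "nat \<Rightarrow> nat" where
  "level n = (\<Sum>j<n. of_bool (2 ^ Suc j \<le> n))"

lemma recursive_level [rec_intros]: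
  assumes "recursive f" shows "recursive (\<lambda>x. level (f x))"
  by (rule recursive_compose[OF _ assms]) (unfold level_def, intro rec_intros)

lemma level_eq:
  assumes "2 ^ i \<le> n" "n < 2 ^ Suc i" shows "level n = i"
proof -
  have "2 ^ Suc j \<le> n \<longleftrightarrow> j < i" for j
  proof
    assume "2 ^ Suc j \<le> n"
    then have "(2::nat) ^ Suc j < 2 ^ Suc i" using assms by (rule_tac le_less_trans)
    then show "j < i" by (simp only: power_strict_increasing_iff one_less_numeral_iff semiring_norm Suc_less_eq)
  next
    assume "j < i"
    then have "(2::nat) ^ Suc j \<le> 2 ^ i" by (intro power_increasing) auto
    then show "2 ^ Suc j \<le> n" using assms(1) by (rule order_trans)
  qed
  then have "level n = (\<Sum>j<n. of_bool (j < i))" by (simp only: level_def)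
  also have "\<dots> = i"
  proof (rule sum_of_bool_less)
    have "i < 2 ^ i" by (rule less_exp)
    then show "i \<le> n" using assms(1) by linarith
  qed
  finally show ?thesis .
qed

lemma power_level:
  assumes "1 \<le> n" shows "2 ^ level n \<le> n" "n < 2 ^ Suc (level n)"
proof -
  obtain i where "2 ^ i \<le> n" "n < 2 ^ Suc i"
    using ex_power_ivl1[of 2 n] assms by auto
  then show "2 ^ level n \<le> n" "n < 2 ^ Suc (level n)" using level_eq by auto
qed

lemma level_mono: "m \<le> n \<Longrightarrow> level m \<le> level n"
proof (cases "1 \<le> m")
  case True
  assume "m \<le> n"
  then have "(2::nat) ^ level m < 2 ^ Suc (level n)"
    using power_level[of m] power_level[of n] True by linarith
  then show ?thesis by (simp only: power_strict_increasing_iff one_less_numeral_iff semiring_norm less_Suc_eq_le)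
next
  case False
  then have "m = 0" by simp
  then show ?thesis by (simp add: level_def)
qed

lemma filterlim_level: "filterlim level at_top sequentially"
  unfolding filterlim_at_top
proof
  fix Z
  show "\<forall>\<^sub>F n in sequentially. Z \<le> level n"
    using eventually_ge_at_top[of "2 ^ Z"]
  proof eventually_elim
    case (elim n)
    then show ?case using level_mono[OF elim] level_eq[of Z "2 ^ Z"] by simp
  qed
qed

text \<open>A slowly growing function of the level is given by the set of levels at which it jumps;
  its values up to level \<open>i\<close> then cost only \<open>i + 1\<close> bits.\<close>

definition phase :: "(nat \<Rightarrow> bool) \<Rightarrow> nat \<Rightarrow> nat" where
  "phase E i = (\<Sum>r<Suc i. of_bool (E r))"

lemma recursive_phase [rec_intros]:
  assumes "recursive f" "recursive g" shows "recursive (\<lambda>x. phase (bit (f x)) (g x))"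
  by (rule recursive_compose2[OF _ assms]) (unfold phase_def, intro rec_intros)

lemma phase_cong: "(\<And>r. r \<le> i \<Longrightarrow> E r = E' r) \<Longrightarrow> phase E i = phase E' i"
  unfolding phase_def by (intro sum.cong) auto

lemma phase_mono: "i \<le> j \<Longrightarrow> phase E i \<le> phase E j"
  unfolding phase_def by (intro sum_mono2) auto

lemma phase_card: "phase E i = card {r. r \<le> i \<and> E r}"
proof -
  have "phase E i = card ({..<Suc i} \<inter> {r. E r})"
    unfolding phase_def of_bool_def by (subst sum.If_cases) auto
  also have "{..<Suc i} \<inter> {r. E r} = {r. r \<le> i \<and> E r}" by auto
  finally show ?thesis .
qed

text \<open>Condition \<open>s\<close> holds from some \<open>I s\<close> on; it suffices to place
  the jump to the value \<open>s\<close> no earlier than that.\<close>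

lemma schedule_exists:
  assumes "\<And>s. \<forall>\<^sub>F i in sequentially. Q s i"
  obtains E where "filterlim (phase E) at_top sequentially" "\<And>i. 1 \<le> phase E i \<Longrightarrow> Q (phase E i) i"
proof -
  obtain I where I: "\<And>s i. I s \<le> i \<Longrightarrow> Q s i"
    using assms unfolding eventually_sequentially by metis
  define e where "e = rec_nat (I 1) (\<lambda>r v. max (Suc v) (I (Suc (Suc r))))"
  have e: "e (Suc r) = max (Suc (e r)) (I (Suc (Suc r)))" for r by (simp add: e_def)
  have mono: "strict_mono e" unfolding strict_mono_Suc_iff e by auto
  \<comment> \<open>Jumps are numbered from 0, so the phase has the value \<open>Suc r\<close> from
    \<open>e r\<close> until the next jump.\<close>
  have eI: "I (Suc r) \<le> e r" for r by (cases r) (auto simp: e_def)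
  define E where "E r \<longleftrightarrow> r \<in> range e" for r
  have "{r. r \<le> i \<and> E r} = e ` {j. e j \<le> i}" for i by (auto simp: E_def)
  then have ph: "phase E i = card {j. e j \<le> i}" for i
    using mono by (simp add: phase_card card_image strict_mono_imp_inj_on inj_on_subset)
  have fin: "finite {j. e j \<le> i}" for i
    by (rule finite_subset[of _ "{..i}"]) (auto intro: order_trans[OF strict_mono_imp_increasing[OF mono]])
  show thesis
  proof
    show "filterlim (phase E) at_top sequentially"
      unfolding filterlim_at_top
    proof
      fix Z
      show "\<forall>\<^sub>F i in sequentially. Z \<le> phase E i"
        using eventually_ge_at_top[of "e Z"]
      proof eventually_elim
        case (elim i)
        have "{..<Z} \<subseteq> {j. e j \<le> i}"
        proof
          fix j assume "j \<in> {..<Z}"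
          then have "e j < e Z" using mono by (simp add: strict_mono_less)
          then show "j \<in> {j. e j \<le> i}" using elim by simp
        qed
        from card_mono[OF fin this] show ?case unfolding ph by simp
      qed
    qed
    fix i assume *: "1 \<le> phase E i"
    define s where "s = phase E i"
    have "e (s - 1) \<le> i"
    proof (rule ccontr)
      assume "\<not> e (s - 1) \<le> i"
      have "{j. e j \<le> i} \<subseteq> {..<s - 1}"
      proof
        fix j assume "j \<in> {j. e j \<le> i}"
        then have "e j < e (s - 1)" using \<open>\<not> e (s - 1) \<le> i\<close> by simp
        then show "j \<in> {..<s - 1}" using mono by (simp add: strict_mono_less)
      qed
      then have "card {j. e j \<le> i} \<le> card {..<s - 1}" by (intro card_mono) auto
      then have "s \<le> s - 1" unfolding s_def ph by simp
      then show False using * by (simp add: s_def)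
    qed
    then have "I s \<le> i" using eI[of "s - 1"] * by (simp add: s_def)
    then show "Q (phase E i) i" using I by (simp add: s_def)
  qed
qed

text \<open>Koenig's lemma: at each bit an infinite set of indices that agree on the earlier bits
  keeps an infinite subset that agrees on this one.\<close>

lemma limit_sequence:
  fixes y :: "nat \<Rightarrow> nat"
  obtains Y :: bitseq where "\<And>n m. \<exists>i\<ge>m. \<forall>b<n. bit (y i) b = Y b"
proof -
  define F where "F = rec_nat UNIV (\<lambda>n S. if infinite {i\<in>S. bit (y i) n} then {i\<in>S. bit (y i) n} else {i\<in>S. \<not> bit (y i) n})"
  define Y where "Y n \<longleftrightarrow> infinite {i\<in>F n. bit (y i) n}" for n
  have F: "F 0 = UNIV" "F (Suc n) = {i\<in>F n. bit (y i) n = Y n}" for n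
    by (auto simp: F_def Y_def)
  have "infinite (F n)" for n
  proof (induction n)
    case (Suc n)
    have "F n = {i\<in>F n. bit (y i) n} \<union> {i\<in>F n. \<not> bit (y i) n}" by auto
    then have "infinite {i\<in>F n. bit (y i) n} \<or> infinite {i\<in>F n. \<not> bit (y i) n}"
      using Suc by (metis finite_UnI)
    then show ?case unfolding F(2) by (cases "Y n") (auto simp: Y_def)
  qed (simp add: F)
  moreover have "i \<in> F n \<Longrightarrow> b < n \<Longrightarrow> bit (y i) b = Y b" for i n b
    by (induction n) (auto simp: F less_Suc_eq)
  ultimately show thesis by (intro that[of Y]) (metis infinite_nat_iff_unbounded_le)
qed

abbreviation block_errors :: "nat \<Rightarrow> bitseq \<Rightarrow> bitseq \<Rightarrow> nat" where
  "block_errors r X Y \<equiv> card {i. 2 ^ r \<le> i \<and> i < 2 ^ Suc r \<and> X i \<noteq> Y i}"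

text \<open>The blocks double in length, so a vanishing error fraction per block gives a vanishing
  fraction up to every power of two; rounding \<open>n\<close> up to a power of two at most doubles
  it.\<close>

lemma besicovitch_distance_eq_0:
  assumes ph: "filterlim (phase E) at_top sequentially"
    and close: "\<And>r. R \<le> r \<Longrightarrow>
      real (block_errors r X Y) \<le> C * 2 ^ r / 2 ^ phase E r"
  shows "besicovitch_distance X Y = 0"
proof -
  define d where "d n = card {i. i < n \<and> X i \<noteq> Y i}" for n
  have dist: "hamming_distance (initial_segment X n) (initial_segment Y n) = d n" for n
    unfolding hamming_distance_def d_def initial_segment_def
    by (intro arg_cong[where f = card]) auto
  have fin: "finite {i. i < n \<and> X i \<noteq> Y i}" for n by simp
  have dmono: "d m \<le> d n" if "m \<le> n" for m n
    unfolding d_def using that by (intro card_mono) auto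
  have "(\<lambda>n. real (d n) / real n) \<longlonglongrightarrow> 0"
  proof (rule tendstoI)
    fix \<epsilon> :: real assume \<epsilon>: "0 < \<epsilon>"
    have "\<forall>\<^sub>F r in sequentially. 4 * C / \<epsilon> \<le> real (phase E r)"
      using filterlim_compose[OF filterlim_real_sequentially ph] unfolding filterlim_at_top by blast
    \<comment> \<open>The constant 4 leaves \<epsilon> / 4 per block, hence \<epsilon> / 2 after
      rounding; the other half absorbs the first \<open>2 ^ R2\<close> bits.\<close>
    then obtain R1 where R1: "\<And>r. R1 \<le> r \<Longrightarrow> 4 * C / \<epsilon> \<le> real (phase E r)"
      unfolding eventually_sequentially by blast
    define R2 where "R2 = max R R1"
    have block: "real (block_errors r X Y) \<le> \<epsilon> / 4 * 2 ^ r" if "R2 \<le> r" for r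
    proof -
      have "4 * C / \<epsilon> \<le> real (phase E r)" using R1 that by (simp add: R2_def)
      also have "\<dots> \<le> 2 ^ phase E r" using less_exp[of "phase E r"] of_nat_less_iff[of "phase E r" "2 ^ phase E r", where 'a = real] by simp
      finally have "4 * C / \<epsilon> \<le> 2 ^ phase E r" .
      then have "C / 2 ^ phase E r \<le> \<epsilon> / 4" using \<epsilon> by (simp add: field_simps)
      then have "C / 2 ^ phase E r * 2 ^ r \<le> \<epsilon> / 4 * 2 ^ r" by (intro mult_right_mono) auto
      moreover have "real (block_errors r X Y) \<le> C * 2 ^ r / 2 ^ phase E r"
        using close that by (simp add: R2_def)
      ultimately show ?thesis by (simp only: times_divide_eq_left)
    qed
    have D: "real (d (2 ^ r)) \<le> 2 ^ R2 + \<epsilon> / 4 * 2 ^ r" if "R2 \<le> r" for r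
      using that
    proof (induction r rule: dec_induct)
      case base
      have "d (2 ^ R2) \<le> card {i. i < (2::nat) ^ R2}" unfolding d_def by (intro card_mono) auto
      then have "d (2 ^ R2) \<le> 2 ^ R2" by simp
      then have "real (d (2 ^ R2)) \<le> 2 ^ R2" by (metis of_nat_le_iff of_nat_numeral of_nat_power)
      moreover have "0 \<le> \<epsilon> / 4 * 2 ^ R2" using \<epsilon> by simp
      ultimately show ?case by linarith
    next
      case (step r)
      have "{i. i < 2 ^ Suc r \<and> X i \<noteq> Y i} = {i. i < 2 ^ r \<and> X i \<noteq> Y i} \<union> {i. 2 ^ r \<le> i \<and> i < 2 ^ Suc r \<and> X i \<noteq> Y i}"
        by auto
      then have "d (2 ^ Suc r) \<le> d (2 ^ r) + block_errors r X Y"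
        unfolding d_def by (simp only: card_Un_le)
      then have "real (d (2 ^ Suc r)) \<le> real (d (2 ^ r)) + real (block_errors r X Y)"
        by linarith
      then show ?case using step.IH block[OF step.hyps(1)] by simp
    qed
    have "\<forall>\<^sub>F n in sequentially. R2 \<le> level n" using filterlim_level unfolding filterlim_at_top by blast
    moreover have "\<forall>\<^sub>F n in sequentially. 2 * (2 ^ R2 / \<epsilon>) < real n"
      using filterlim_real_sequentially unfolding filterlim_at_top_dense by blast
    ultimately show "\<forall>\<^sub>F n in sequentially. dist (real (d n) / real n) 0 < \<epsilon>"
      using eventually_ge_at_top[of 1]
    proof eventually_elim
      case (elim n)
      have "real (d n) \<le> real (d (2 ^ Suc (level n)))"
        using dmono power_level[OF elim(3)] by simp
      also have "\<dots> \<le> 2 ^ R2 + \<epsilon> / 4 * 2 ^ Suc (level n)" by (rule D) (use elim in simp)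
      also have "\<dots> = 2 ^ R2 + \<epsilon> / 2 * 2 ^ level n" by simp
      also have "\<dots> \<le> 2 ^ R2 + \<epsilon> / 2 * real n"
      proof -
        have "(2::real) ^ level n \<le> real n"
          using power_level(1)[OF elim(3)] by (metis of_nat_le_iff of_nat_numeral of_nat_power)
        then show ?thesis using \<epsilon> by simp
      qed
      also have "\<dots> < \<epsilon> * real n" using elim(2) \<epsilon> by (simp add: field_simps)
      finally show ?case using elim(3) by (simp add: field_simps)
    qed
  qed
  then have "(\<lambda>n. ereal (real (d n) / real n)) \<longlonglongrightarrow> ereal 0" by (simp only: tendsto_ereal)
  from lim_imp_Limsup[OF _ this] show ?thesis
    by (simp add: besicovitch_distance_def dist zero_ereal_def)
qed

section \<open>Strong tests\<close>

text \<open>Strings of equal length form a prefix-free set, so the test condition counts them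
  directly.\<close>

lemma card_strong_test:
  assumes "strong_test \<alpha> V" "1 \<le> k"
  shows "real (card {y. y < 2 ^ n \<and> bits n y \<in> V k}) \<le> 2 powr (\<alpha> * real n - real k)"
proof -
  define Y where "Y = {y. y < 2 ^ n \<and> bits n y \<in> V k}"
  define W where "W = bits n ` Y"
  have fin: "finite W" by (simp add: W_def Y_def)
  have "W \<subseteq> V k" by (auto simp: W_def Y_def)
  moreover have "prefix_free W"
    unfolding prefix_free_def
  proof (intro ballI impI)
    fix \<sigma> \<tau> assume "\<sigma> \<in> W" "\<tau> \<in> W" "prefix \<sigma> \<tau>"
    moreover from this have "length \<sigma> = length \<tau>" by (auto simp: W_def)
    ultimately show "\<sigma> = \<tau>" by (auto elim!: prefixE)
  qed
  ultimately have "(\<Sum>\<sigma>\<in>W. 2 powr (- \<alpha> * real (length \<sigma>))) \<le> 2 powr (- real k)"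
    using assms infsum_finite[OF fin] unfolding strong_test_def by metis
  also have "(\<Sum>\<sigma>\<in>W. 2 powr (- \<alpha> * real (length \<sigma>))) = (\<Sum>\<sigma>\<in>W. 2 powr (- \<alpha> * real n))"
    by (intro sum.cong) (auto simp: W_def)
  also have "\<dots> = real (card Y) * 2 powr (- \<alpha> * real n)"
    using card_image[OF inj_on_subset[OF inj_on_bits, of Y n]] by (simp add: W_def Y_def subset_iff)
  finally have "real (card Y) * 2 powr (- \<alpha> * real n) * 2 powr (\<alpha> * real n) \<le> 2 powr (- real k) * 2 powr (\<alpha> * real n)"
    by (intro mult_right_mono) auto
  then show ?thesis unfolding Y_def mult.assoc powr_add[symmetric] by (simp add: algebra_simps)
qed

lemma card_cylinder:
  assumes "length \<sigma> \<le> M"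
  shows "card {w. w < 2 ^ M \<and> bits (length \<sigma>) w = \<sigma>} \<le> 2 ^ (M - length \<sigma>)"
proof -
  let ?l = "length \<sigma>" and ?S = "{w. w < 2 ^ M \<and> bits (length \<sigma>) w = \<sigma>}"
  have "inj_on (\<lambda>w. w div 2 ^ ?l) ?S"
  proof (rule inj_onI)
    fix v w assume v: "v \<in> ?S" and w: "w \<in> ?S" and eq: "v div 2 ^ ?l = w div 2 ^ ?l"
    have "bits ?l v = bits ?l w" using v w by simp
    then have "take_bit ?l v = take_bit ?l w"
      by (intro bit_eqI) (auto simp: bit_take_bit_iff bits_eq_iff)
    then show "v = w" using eq by (metis div_mult_mod_eq take_bit_eq_mod)
  qed
  moreover have "(\<lambda>w. w div 2 ^ ?l) ` ?S \<subseteq> {..<2 ^ (M - ?l)}"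
  proof
    fix q assume "q \<in> (\<lambda>w. w div 2 ^ ?l) ` ?S"
    then obtain w where "w < 2 ^ M" "q = w div 2 ^ ?l" by auto
    moreover have "(2::nat) ^ M = 2 ^ (M - ?l) * 2 ^ ?l" using assms by (simp flip: power_add)
    ultimately show "q \<in> {..<2 ^ (M - ?l)}" by (simp add: less_mult_imp_div_less)
  qed
  ultimately have "card ?S \<le> card {..<2 ^ (M - ?l) :: nat}" by (rule card_inj_on_le) simp
  then show ?thesis by simp
qed

text \<open>The prefix-minimal elements of \<open>V k\<close> form a prefix-free set whose cylinders
  cover everything hit, and at \<alpha> = 1 the weights of the test condition are the measures of
  these cylinders.\<close>

lemma card_strong_test_open:
  assumes "strong_test 1 V" "1 \<le> k"
  shows "real (card {w. w < 2 ^ M \<and> (\<exists>l<Suc M. bits l w \<in> V k)}) \<le> 2 ^ M / 2 ^ k"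
proof -
  define W where "W = {\<sigma>\<in>V k. length \<sigma> \<le> M \<and> (\<forall>\<tau>\<in>V k. prefix \<tau> \<sigma> \<longrightarrow> \<tau> = \<sigma>)}"
  have fin: "finite W"
    by (rule finite_subset[OF _ finite_lists_length_le[of UNIV M]]) (auto simp: W_def)
  have "W \<subseteq> V k" "prefix_free W" by (auto simp: W_def prefix_free_def)
  then have *: "(\<Sum>\<sigma>\<in>W. 2 powr (- 1 * real (length \<sigma>))) \<le> 2 powr (- real k)"
    using assms infsum_finite[OF fin] unfolding strong_test_def by metis
  have "{w. w < 2 ^ M \<and> (\<exists>l<Suc M. bits l w \<in> V k)} \<subseteq> (\<Union>\<sigma>\<in>W. {w. w < 2 ^ M \<and> bits (length \<sigma>) w = \<sigma>})"
  proof
    fix w assume "w \<in> {w. w < 2 ^ M \<and> (\<exists>l<Suc M. bits l w \<in> V k)}"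
    then have w: "w < 2 ^ M" and ex: "\<exists>l. l < Suc M \<and> bits l w \<in> V k" by auto
    define l where "l = (LEAST l. l < Suc M \<and> bits l w \<in> V k)"
    have l: "l < Suc M" "bits l w \<in> V k" using LeastI_ex[OF ex] by (auto simp: l_def)
    have "\<tau> = bits l w" if "\<tau> \<in> V k" "prefix \<tau> (bits l w)" for \<tau>
    proof -
      have le: "length \<tau> \<le> l" using prefix_length_le[OF that(2)] by simp
      have "\<tau> = take (length \<tau>) (bits l w)" using that(2) by (auto elim!: prefixE)
      also have "\<dots> = bits (length \<tau>) w" using le by (simp add: bits_def take_map)
      finally have t: "\<tau> = bits (length \<tau>) w" .
      then have "length \<tau> < Suc M \<and> bits (length \<tau>) w \<in> V k" using that(1) le l by simp
      then have "l \<le> length \<tau>" unfolding l_def by (rule Least_le)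
      then show ?thesis using t le by simp
    qed
    then have "bits l w \<in> W" using l by (simp add: W_def)
    then show "w \<in> (\<Union>\<sigma>\<in>W. {w. w < 2 ^ M \<and> bits (length \<sigma>) w = \<sigma>})"
      using w by (intro UN_I[of "bits l w"]) auto
  qed
  then have "card {w. w < 2 ^ M \<and> (\<exists>l<Suc M. bits l w \<in> V k)} \<le> card (\<Union>\<sigma>\<in>W. {w. w < 2 ^ M \<and> bits (length \<sigma>) w = \<sigma>})"
    by (rule card_mono[rotated]) (use fin in auto)
  also have "\<dots> \<le> (\<Sum>\<sigma>\<in>W. card {w. w < 2 ^ M \<and> bits (length \<sigma>) w = \<sigma>})"
    by (rule card_UN_le[OF fin])
  also have "\<dots> \<le> (\<Sum>\<sigma>\<in>W. 2 ^ (M - length \<sigma>))"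
    by (intro sum_mono card_cylinder) (simp add: W_def)
  finally have "real (card {w. w < 2 ^ M \<and> (\<exists>l<Suc M. bits l w \<in> V k)}) \<le> (\<Sum>\<sigma>\<in>W. 2 ^ (M - length \<sigma>))"
    by (metis (mono_tags, lifting) of_nat_le_iff of_nat_numeral of_nat_power of_nat_sum sum.cong)
  also have "\<dots> = (\<Sum>\<sigma>\<in>W. 2 ^ M * 2 powr (- 1 * real (length \<sigma>)))"
    by (intro sum.cong refl) (simp add: W_def power_diff powr_minus powr_realpow field_simps)
  also have "\<dots> \<le> 2 ^ M * 2 powr (- real k)"
    unfolding sum_distrib_left[symmetric] using * by (intro mult_left_mono) auto
  also have "\<dots> = 2 ^ M / 2 ^ k" by (simp add: powr_minus powr_realpow field_simps)
  finally show ?thesis .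
qed

text \<open>Makes the set of strong tests nonempty, so that it can be enumerated by all natural
  numbers.\<close>

lemma strong_test_empty: "strong_test \<alpha> (\<lambda>_. {})"
proof -
  have "partial_recursive (\<lambda>x. if \<exists>n::nat. False then Some (LEAST n::nat. False) else None)"
    by (rule partial_recursive_search[of "\<lambda>_ _. False"]) (rule decidable_const)
  then have "uniformly_ce (\<lambda>_. {})" unfolding uniformly_ce_def by (intro exI conjI) (assumption, simp)
  then show ?thesis by (simp add: strong_test_def)
qed

lemma strong_test_cong:
  assumes "strong_test \<alpha> V" "\<And>k. 1 \<le> k \<Longrightarrow> V k = V' k" shows "strong_test \<alpha> V'"
  using assms unfolding strong_test_def uniformly_ce_def by simp

text \<open>Only countability is used. The stages \<open>P j\<close> are decidable for each
  \<open>j\<close> separately, with no uniformity in \<open>j\<close>; constants of later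
  descriptions therefore depend on the tests involved.\<close>

lemma strong_tests_enumeration:
  "\<exists>(T :: nat \<Rightarrow> nat \<Rightarrow> bitstring set) (P :: nat \<Rightarrow> nat \<Rightarrow> nat \<Rightarrow> bool).
     (\<forall>j. strong_test \<alpha> (T j)) \<and>
     (\<forall>V. strong_test \<alpha> V \<longrightarrow> (\<exists>j. \<forall>k\<ge>1. V k = T j k)) \<and>
     (\<forall>j. decidable (\<lambda>p. P j (pfst p) (psnd p))) \<and>
     (\<forall>j k \<sigma>. \<sigma> \<in> T j k \<longleftrightarrow> (\<exists>t. P j (prod_encode (k, string_encode \<sigma>)) t)) \<and>
     (\<forall>j x t t'. P j x t \<longrightarrow> t \<le> t' \<longrightarrow> P j x t')"
proof -
  define D where "D f k = {\<sigma>. f (prod_encode (k, string_encode \<sigma>)) \<noteq> None}" for f :: "nat \<rightharpoonup> nat" and k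
  define S where "S = {f. partial_recursive f \<and> strong_test \<alpha> (D f)}"
  have D: "\<exists>f\<in>S. \<forall>k\<ge>1. V k = D f k" if V: "strong_test \<alpha> V" for V
  proof -
    obtain f where f: "partial_recursive f" "\<forall>k\<ge>1. \<forall>\<sigma>. \<sigma> \<in> V k \<longleftrightarrow> f (prod_encode (k, string_encode \<sigma>)) \<noteq> None"
      using V unfolding strong_test_def uniformly_ce_def by blast
    then have *: "V k = D f k" if "1 \<le> k" for k using that by (auto simp: D_def)
    then have "f \<in> S" using strong_test_cong[OF V] f by (simp add: S_def)
    then show ?thesis using * by blast
  qed
  have "S \<noteq> {}" using D[OF strong_test_empty] by blast
  moreover have "countable S" by (rule countable_subset[OF _ countable_partial_recursive]) (auto simp: S_def)
  ultimately have range: "range (from_nat_into S) = S" by (rule range_from_nat_into)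
  define f where "f = from_nat_into S"
  have fS: "f j \<in> S" for j using range by (auto simp: f_def)
  have "\<forall>j. \<exists>P. decidable (\<lambda>p. P (pfst p) (psnd p)) \<and> (\<forall>x. f j x \<noteq> None \<longleftrightarrow> (\<exists>t. P x t)) \<and>
      (\<forall>x t t'. P x t \<longrightarrow> t \<le> t' \<longrightarrow> P x t')"
  proof
    fix j
    have "partial_recursive (f j)" using fS by (auto simp: S_def)
    from partial_recursive_domain_decidable_stages[OF this]
    show "\<exists>P. decidable (\<lambda>p. P (pfst p) (psnd p)) \<and> (\<forall>x. f j x \<noteq> None \<longleftrightarrow> (\<exists>t. P x t)) \<and>
      (\<forall>x t t'. P x t \<longrightarrow> t \<le> t' \<longrightarrow> P x t')" by metis
  qed
  then obtain P where P: "\<And>j. decidable (\<lambda>p. P j (pfst p) (psnd p))"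
    "\<And>j x. f j x \<noteq> None \<longleftrightarrow> (\<exists>t. P j x t)" "\<And>j x t t'. P j x t \<Longrightarrow> t \<le> t' \<Longrightarrow> P j x t'"
    by metis
  show ?thesis
  proof (intro exI[of _ "\<lambda>j. D (f j)"] exI[of _ P] conjI allI impI)
    show "strong_test \<alpha> (D (f j))" for j using fS by (auto simp: S_def)
    show "\<exists>j. \<forall>k\<ge>1. V k = D (f j) k" if V: "strong_test \<alpha> V" for V
    proof -
      obtain g where "g \<in> S" "\<forall>k\<ge>1. V k = D g k" using D[OF V] by blast
      moreover from \<open>g \<in> S\<close> obtain j where "g = f j" using range by (auto simp: f_def)
      ultimately show ?thesis by blast
    qed
    show "\<sigma> \<in> D (f j) k \<longleftrightarrow> (\<exists>t. P j (prod_encode (k, string_encode \<sigma>)) t)" for j k \<sigma>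
      unfolding D_def mem_Collect_eq by (rule P(2))
  qed (fact P)+
qed

section \<open>Dimension and complexity\<close>

text \<open>Speaking of finite upper bounds \<open>c\<close> avoids arithmetic with infinite
  complexities.\<close>

lemma complexity_lower_bound:
  assumes "effective_dimension U X = ereal \<alpha>" "0 < \<epsilon>"
  shows "\<forall>\<^sub>F n in sequentially. \<forall>c::nat. complexity U (initial_segment X n) \<le> enat c \<longrightarrow> (\<alpha> - \<epsilon>) * real n \<le> real c"
proof -
  let ?f = "\<lambda>n. ereal_of_enat (complexity U (initial_segment X n)) / ereal (real n)"
  have "ereal (\<alpha> - \<epsilon>) < liminf ?f" using assms by (simp add: effective_dimension_def)
  then have "\<forall>\<^sub>F n in sequentially. ereal (\<alpha> - \<epsilon>) < ?f n" by (rule less_LiminfD)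
  with eventually_gt_at_top[of 0] show ?thesis
  proof eventually_elim
    case (elim n)
    show ?case
    proof (intro allI impI)
      fix c :: nat assume "complexity U (initial_segment X n) \<le> enat c"
      then obtain c' where c': "complexity U (initial_segment X n) = enat c'" "c' \<le> c"
        by (cases "complexity U (initial_segment X n)") auto
      then have "\<alpha> - \<epsilon> < real c' / real n" using elim by simp
      then have "(\<alpha> - \<epsilon>) * real n < real c'" using elim by (simp add: field_simps)
      then show "(\<alpha> - \<epsilon>) * real n \<le> real c" using c'(2) by linarith
    qed
  qed
qed

text \<open>The identity is a programming language, so the complexity of a prefix exceeds its length
  by at most a constant.\<close>

lemma effective_dimension_le_1:
  assumes "optimal U" "effective_dimension U X = ereal \<alpha>"
  shows "\<alpha> \<le> 1"
proof (rule ccontr)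
  assume "\<not> \<alpha> \<le> 1"
  then have \<alpha>: "1 < \<alpha>" by simp
  have "partial_computable Some"
    unfolding partial_computable_def using recursive_id unfolding recursive_def by auto
  then obtain c where c: "\<And>x. complexity U x \<le> complexity Some x + enat c"
    using assms(1) unfolding optimal_def by blast
  have up: "complexity U (initial_segment X n) \<le> enat (n + c)" for n
  proof -
    have "complexity Some (initial_segment X n) \<le> enat (length (initial_segment X n))"
      by (rule complexity_le) simp
    then have "complexity Some (initial_segment X n) + enat c \<le> enat n + enat c"
      by (intro add_right_mono) (simp add: initial_segment_def)
    with c[of "initial_segment X n"] show ?thesis by (simp add: order_trans)
  qed
  have "\<forall>\<^sub>F n in sequentially. (\<alpha> - (\<alpha> - 1) / 2) * real n \<le> real (n + c)"
  proof (rule eventually_mono[OF complexity_lower_bound[OF assms(2), of "(\<alpha> - 1) / 2"]])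
    fix n assume "\<forall>c. complexity U (initial_segment X n) \<le> enat c \<longrightarrow> (\<alpha> - (\<alpha> - 1) / 2) * real n \<le> real c"
    then show "(\<alpha> - (\<alpha> - 1) / 2) * real n \<le> real (n + c)" using up by blast
  qed (use \<alpha> in simp)
  moreover have "\<forall>\<^sub>F n in sequentially. 2 * real c / (\<alpha> - 1) < real n"
    using filterlim_real_sequentially unfolding filterlim_at_top_dense by blast
  ultimately have "\<forall>\<^sub>F n in sequentially. False"
  proof eventually_elim
    case (elim n)
    then show ?case using \<alpha> by (simp add: field_simps)
  qed
  then show False by simp
qed

text \<open>The square is what later beats advice whose length is linear in the level.\<close>

lemma eventually_square_times_power_le:
  "\<forall>\<^sub>F r in sequentially. r * r * 2 ^ s \<le> (2::nat) ^ r"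
proof -
  have cube: "r * (r * r) \<le> 27 * 2 ^ r" for r :: nat
  proof (induction r)
    case (Suc r)
    show ?case
    proof (cases "r < 4")
      case True
      then have "r = 0 \<or> r = 1 \<or> r = 2 \<or> r = 3" by auto
      then show ?thesis by auto
    next
      case False
      then have "4 * r \<le> r * r" "4 * (r * r) \<le> r * (r * r)" by (auto intro: mult_right_mono)
      moreover have "Suc r * (Suc r * Suc r) = r * (r * r) + 3 * (r * r) + 3 * r + 1" by (simp add: algebra_simps)
      ultimately have "Suc r * (Suc r * Suc r) \<le> 2 * (r * (r * r))" using False by linarith
      then show ?thesis using Suc by simp
    qed
  qed simp
  show ?thesis using eventually_ge_at_top[of "27 * 2 ^ s"]
  proof eventually_elim
    case (elim r)
    have "27 * (r * r * 2 ^ s) = (27 * 2 ^ s) * (r * r)" by simp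
    also have "\<dots> \<le> r * (r * r)" using elim by (intro mult_right_mono) auto
    also have "\<dots> \<le> 27 * 2 ^ r" by (rule cube)
    finally show ?case by simp
  qed
qed

text \<open>One jump set meets three demands: room for the error fraction, dominance over a constant
  attached to the phase, and the complexity bound with deficit \<open>\<epsilon> s\<close>. The last
  depends on how fast the lower limit is approached, which makes \<open>E\<close>
  noncomputable.\<close>

lemma complexity_schedule:
  fixes \<epsilon> :: "nat \<Rightarrow> real" and h c :: "nat \<Rightarrow> nat"
  assumes dim: "effective_dimension U X = ereal \<alpha>" and \<epsilon>: "\<And>s. 0 < \<epsilon> s"
  obtains E where "filterlim (phase E) at_top sequentially"
    "\<And>i. 1 \<le> phase E i \<Longrightarrow> i * i * 2 ^ h (phase E i) \<le> 2 ^ i"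
    "\<And>i. 1 \<le> phase E i \<Longrightarrow> c (phase E i) \<le> i"
    "\<And>i n m. \<lbrakk>1 \<le> phase E i; 2 ^ i \<le> n; complexity U (initial_segment X n) \<le> enat m\<rbrakk> \<Longrightarrow>
      (\<alpha> - \<epsilon> (phase E i)) * real n \<le> real m"
proof -
  define Q where "Q s i \<longleftrightarrow> i * i * 2 ^ h s \<le> 2 ^ i \<and> c s \<le> i \<and> (\<forall>n\<ge>2 ^ i. \<forall>m::nat.
    complexity U (initial_segment X n) \<le> enat m \<longrightarrow> (\<alpha> - \<epsilon> s) * real n \<le> real m)" for s i :: nat
  have "\<forall>\<^sub>F i in sequentially. Q s i" for s
  proof -
    obtain N where N: "\<And>n m. N \<le> n \<Longrightarrow> complexity U (initial_segment X n) \<le> enat m \<Longrightarrow> (\<alpha> - \<epsilon> s) * real n \<le> real m"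
      using complexity_lower_bound[OF dim \<epsilon>[of s]] unfolding eventually_sequentially by blast
    show ?thesis using eventually_square_times_power_le[of "h s"] eventually_ge_at_top[of N]
        eventually_ge_at_top[of "c s"]
    proof eventually_elim
      case (elim i)
      have "N \<le> 2 ^ i" using elim(2) less_exp[of i] by linarith
      then show ?case unfolding Q_def using N order_trans[of N "2 ^ i"] elim(1,3) by (intro conjI allI impI) auto
    qed
  qed
  then obtain E where E: "filterlim (phase E) at_top sequentially" "\<And>i. 1 \<le> phase E i \<Longrightarrow> Q (phase E i) i"
    using schedule_exists[of Q] by metis
  show thesis by (rule that[OF E(1)]) (use E(2) in \<open>simp_all add: Q_def\<close>)
qed

section \<open>Dimension less than one\<close>

text \<open>Nesting pairs squares the size at worst, so tuples of numbers with \<open>O(L)\<close>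
  bits have codes with \<open>O(L)\<close> bits.\<close>

lemma prod_encode_le: "prod_encode (x, y) \<le> (x + y + 1)\<^sup>2"
proof -
  have "triangle (x + y) \<le> (x + y) * Suc (x + y)" by (simp add: triangle_def)
  then show ?thesis by (simp add: prod_encode_def power2_eq_square algebra_simps)
qed

lemma le_two_power_log:
  assumes "0 < c" shows "\<exists>m. c \<le> 2 ^ m \<and> real m \<le> log 2 (real c) + 1"
proof (intro exI conjI)
  let ?m = "nat \<lceil>log 2 (real c)\<rceil>"
  have 0: "0 \<le> log 2 (real c)" using assms by simp
  have "real c = 2 powr log 2 (real c)" using assms by simp
  also have "\<dots> \<le> 2 powr real ?m" by (intro powr_mono real_nat_ceiling_ge) auto
  also have "\<dots> = real (2 ^ ?m)" by (simp add: powr_realpow)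
  finally show "c \<le> 2 ^ ?m" by (simp only: of_nat_le_iff)
  show "real ?m \<le> log 2 (real c) + 1" using 0 by simp
qed

text \<open>Double counting: the total noise from \<open>A\<close> to \<open>V\<close> is at least
  \<open>card A / (n + 1)\<^sup>2\<close>, while hypercontractivity bounds it by a product of powers
  of both cardinalities. Solving for \<open>card A\<close> produces the saving.\<close>

lemma noisy_hits_card:
  fixes \<alpha> d :: real
  assumes A: "A \<subseteq> {..<2 ^ n}" "A \<noteq> {}" and V: "V \<subseteq> {..<2 ^ n}" "real (card V) \<le> 2 powr (\<alpha> * real n)"
    and d: "0 < d" "d \<le> 1 / 4" "\<And>i. i < n \<Longrightarrow> d \<le> \<delta> i" "\<And>i. i < n \<Longrightarrow> \<delta> i \<le> 1 / 2"
    and \<alpha>: "\<alpha> \<le> 1"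
    and hits: "\<And>x. x \<in> A \<Longrightarrow> 1 \<le> (real n + 1)\<^sup>2 * (\<Sum>y\<in>V. noise \<delta> n x y)"
  shows "log 2 (real (card A)) \<le> \<alpha> * real n - 2 * d * (1 - \<alpha>) * real n + 8 * log 2 (real n + 1)"
proof -
  define p u L where "p = 2 - 2 * d" and "u = log 2 (real (card A))" and "L = log 2 (real n + 1)"
  have fin: "finite A" using A(1) by (rule finite_subset) simp
  then have cA: "0 < real (card A)" using A(2) by (simp add: card_gt_0_iff)
  have u: "real (card A) = 2 powr u" using cA by (simp add: u_def)
  have L0: "0 \<le> L" by (simp add: L_def)
  have L: "(real n + 1)\<^sup>2 = 2 powr (2 * L)"
  proof -
    have "real n + 1 = 2 powr L" by (simp add: L_def)
    then show ?thesis by (simp add: power2_eq_square powr_add[symmetric])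
  qed
  have p: "3 / 2 \<le> p" using d by (simp add: p_def)
  have "2 powr u = (\<Sum>x\<in>A. 1)" using u by simp
  also have "\<dots> \<le> (\<Sum>x\<in>A. (real n + 1)\<^sup>2 * (\<Sum>y\<in>V. noise \<delta> n x y))"
    by (rule sum_mono) (rule hits)
  also have "\<dots> = (real n + 1)\<^sup>2 * (\<Sum>x\<in>A. \<Sum>y\<in>V. noise \<delta> n x y)"
    by (simp only: sum_distrib_left)
  also have "\<dots> \<le> 2 powr (2 * L) * (2 powr (real n * (1 - 2 / p)) * (real (card A) powr (1 / p) * real (card V) powr (1 / p)))"
    unfolding L using d by (intro mult_left_mono noise_small_sets[OF A(1) V(1) d(1,3,4) _ p_def]) auto
  also have "\<dots> \<le> 2 powr (2 * L) * (2 powr (real n * (1 - 2 / p)) * ((2 powr u) powr (1 / p) * (2 powr (\<alpha> * real n)) powr (1 / p)))"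
    unfolding u using V(2) p by (intro mult_left_mono powr_mono2) auto
  also have "\<dots> = 2 powr (2 * L + real n * (1 - 2 / p) + u / p + \<alpha> * real n / p)"
    by (simp add: powr_powr powr_add)
  finally have "u \<le> 2 * L + real n * (1 - 2 / p) + u / p + \<alpha> * real n / p" by simp
  then have "u * p \<le> (2 * L + real n * (1 - 2 / p) + u / p + \<alpha> * real n / p) * p"
    using p by (intro mult_right_mono) auto
  also have "\<dots> = 2 * L * p + real n * p - 2 * real n + u + \<alpha> * real n"
    using p by (simp add: field_simps)
  finally have *: "u * (1 - 2 * d) \<le> 4 * L + \<alpha> * real n - 2 * d * real n - 4 * L * d"
    by (simp add: p_def algebra_simps)
  have "4 * L * 1 \<le> 8 * L * (1 - 2 * d)" using d L0 mult_left_mono[of "1 / 2" "1 - 2 * d" "8 * L"] by simp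
  moreover have "0 \<le> 4 * L * d" using d L0 by simp
  ultimately have "u * (1 - 2 * d) \<le> 8 * L * (1 - 2 * d) + (1 - 2 * d) * (\<alpha> * real n) - 2 * d * (1 - \<alpha>) * real n"
    using * by (simp add: algebra_simps)
  \<comment> \<open>Dividing \<alpha> - 2d by 1 - 2d gives at most \<alpha> - 2d(1 - \<alpha>); this
    square term is the difference.\<close>
  moreover have "0 \<le> 2 * d * (1 - \<alpha>) * real n * (2 * d)" using d \<alpha> by simp
  ultimately have "u * (1 - 2 * d) \<le> (\<alpha> * real n - 2 * d * (1 - \<alpha>) * real n + 8 * L) * (1 - 2 * d)"
    by (simp add: algebra_simps)
  then show ?thesis using d by (simp add: u_def L_def)
qed

text \<open>Constant on each dyadic block, and a dyadic rational, so that probabilities can be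
  compared in integers.\<close>

definition flip_rate :: "(nat \<Rightarrow> bool) \<Rightarrow> nat \<Rightarrow> real" where
  "flip_rate E i = 1 / 2 ^ Suc (phase E (level i))"

definition hit_probability :: "(nat \<Rightarrow> bool) \<Rightarrow> bitstring set \<Rightarrow> nat \<Rightarrow> nat \<Rightarrow> real" where
  "hit_probability E V n x = (\<Sum>y\<in>{y. y < 2 ^ n \<and> bits n y \<in> V}. noise (flip_rate E) n x y)"

lemma flip_rate_bounds: "0 < flip_rate E i" "flip_rate E i \<le> 1 / 2"
  using power_increasing[of 1 "Suc (phase E (level i))" "2 :: real"]
  by (auto simp: flip_rate_def field_simps)

lemma noise_flip_nonneg: "0 \<le> noise (flip_rate E) n x y"
proof (rule noise_nonneg)
  show "0 \<le> flip_rate E i \<and> flip_rate E i \<le> 1" for i using flip_rate_bounds[of E i] by auto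
qed

text \<open>Earlier bits are noisier than the last one; hypercontractivity with the rate of the last
  block still applies.\<close>

lemma flip_rate_antimono: "i \<le> n \<Longrightarrow> 1 / 2 ^ Suc (phase E (level n)) \<le> flip_rate E i"
  unfolding flip_rate_def by (intro divide_left_mono power_increasing) (auto intro: phase_mono level_mono)

text \<open>The numerator of the noise probability over the common denominator of all flip
  rates.\<close>

definition noise_weight :: "(nat \<Rightarrow> bool) \<Rightarrow> nat \<Rightarrow> nat \<Rightarrow> nat \<Rightarrow> nat" where
  "noise_weight E n x y = (\<Prod>i<n. if bit x i \<longleftrightarrow> bit y i then 2 ^ Suc (phase E (level i)) - 1 else 1)"

lemma noise_weight: "real (noise_weight E n x y) = noise (flip_rate E) n x y * (\<Prod>i<n. 2 ^ Suc (phase E (level i)))"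
proof -
  have *: "real (2 ^ k - 1) = 2 ^ k - 1" for k by (simp add: of_nat_diff)
  show ?thesis
    unfolding noise_weight_def noise_def flip_rate_def prod.distrib[symmetric] of_nat_prod
    by (intro prod.cong refl) (simp only: if_distrib[of real] of_nat_1 * split: if_split, simp add: field_simps)
qed

text \<open>The strings hit with noticeable probability are enumerable from \<open>n\<close>,
  \<open>k\<close> and the jumps of \<open>E\<close> up to the level of \<open>n\<close>, and there
  are few of them.\<close>

lemma noisy_hits_compressible:
  assumes opt: "optimal U" and T: "strong_test \<alpha> T" and \<alpha>: "\<alpha> \<le> 1"
    and P: "decidable (\<lambda>p. P (pfst p) (psnd p))"
      "\<And>k \<sigma>. \<sigma> \<in> T k \<longleftrightarrow> (\<exists>t. P (prod_encode (k, string_encode \<sigma>)) t)"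
      "\<And>x t t'. P x t \<Longrightarrow> t \<le> t' \<Longrightarrow> P x t'"
  obtains c :: nat where "\<And>E n k z. \<lbrakk>1 \<le> k; k \<le> n; z < 2 ^ n; 1 \<le> phase E (level n);
      1 < (real n + 1)\<^sup>2 * hit_probability E (T k) n z\<rbrakk> \<Longrightarrow>
    \<exists>m::nat. complexity U (bits n z) \<le> enat m \<and>
      real m \<le> \<alpha> * real n - (1 - \<alpha>) * real n / 2 ^ phase E (level n) + 24 * real (level n) + real c"
proof -
  \<comment> \<open>The hit condition at stage \<open>t\<close>, cleared of denominators.\<close>
  define D :: "nat \<Rightarrow> nat \<Rightarrow> nat \<Rightarrow> bool" where "D a z t \<longleftrightarrow> z < 2 ^ pfst (psnd a) \<and>
      (\<Prod>i<pfst (psnd a). 2 ^ Suc (phase (bit (psnd (psnd (psnd a)))) (level i))) <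
      (pfst (psnd a) + 1) ^ 2 * (\<Sum>y<2 ^ pfst (psnd a).
        of_bool (P (prod_encode (pfst (psnd (psnd a)), string_encode (bits (pfst (psnd a)) y))) t) *
        (\<Prod>i<pfst (psnd a). if bit z i \<longleftrightarrow> bit y i
           then 2 ^ Suc (phase (bit (psnd (psnd (psnd a)))) (level i)) - 1 else 1))" for a z t
  have "decidable (\<lambda>p. D (pfst p) (pfst (psnd p)) (psnd (psnd p)))"
    unfolding D_def by (intro rec_intros decidable_compose2[OF P(1)])
  from complexity_enumerated[OF opt this] obtain c where
    c: "\<And>a b m z t. \<lbrakk>a < 2 ^ b; D a z t; finite (enumerated D a z); card (enumerated D a z) \<le> 2 ^ m\<rbrakk> \<Longrightarrow>
      complexity U (bits (pfst (psnd a)) z) \<le> enat (2 * b + pfst a + m + c)" by blast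
  show thesis
  \<comment> \<open>The advice costs \<open>46 + 16 * L\<close> bits, the cardinality bound adds
    \<open>8 * L + 8\<close>, and rounding the logarithm adds 1.\<close>
  proof (rule that[of "c + 55"])
    fix E n k z
    assume k: "1 \<le> k" "k \<le> n" and z: "z < 2 ^ n" and ph: "1 \<le> phase E (level n)"
      and hit: "1 < (real n + 1)\<^sup>2 * hit_probability E (T k) n z"
    define L where "L = level n"
    define \<nu> where "\<nu> = noise (flip_rate E) n"
    define e where "e = segment_number E (Suc L)"
    define V where "V = {y. y < 2 ^ n \<and> bits n y \<in> T k}"
    have phase_e: "phase (bit e) (level i) = phase E (level i)" if "i \<le> n" for i
      using level_mono[OF that] by (intro phase_cong) (auto simp: e_def bit_segment_number L_def)
    define Den where "Den = (\<Prod>i<n. 2 ^ Suc (phase E (level i)) :: nat)"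
    have Den: "0 < Den" "real Den = (\<Prod>i<n. 2 ^ Suc (phase E (level i)))"
      unfolding Den_def by (auto intro!: prod_pos)
    \<comment> \<open>The first field is 0: no low bits of \<open>z\<close> are sent, and the whole
      set \<open>A\<close> is enumerated.\<close>
    define a where "a = prod_encode (0, prod_encode (n, prod_encode (k, e)))"
    have D: "D a z t \<longleftrightarrow> z < 2 ^ n \<and> Den < (n + 1)\<^sup>2 *
        (\<Sum>y<2 ^ n. of_bool (P (prod_encode (k, string_encode (bits n y))) t) * noise_weight E n z y)" for z t
    proof -
      have "(\<Prod>i<n. 2 ^ Suc (phase (bit e) (level i))) = Den"
        unfolding Den_def by (intro prod.cong) (auto simp: phase_e)
      moreover have "(\<Prod>i<n. if bit z i \<longleftrightarrow> bit y i then 2 ^ Suc (phase (bit e) (level i)) - 1 else 1) = noise_weight E n z y" for y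
        unfolding noise_weight_def by (intro prod.cong) (auto simp: phase_e)
      moreover have "pfst (psnd a) = n" "pfst (psnd (psnd a)) = k" "psnd (psnd (psnd a)) = e"
        by (simp_all add: a_def)
      ultimately show ?thesis unfolding D_def by (simp only:)
    qed
    have real_D: "Den < (n + 1)\<^sup>2 * (\<Sum>y\<in>Y. noise_weight E n z y) \<longleftrightarrow>
        1 < (real n + 1)\<^sup>2 * (\<Sum>y\<in>Y. \<nu> z y)" for z Y
    proof -
      have "Den < (n + 1)\<^sup>2 * (\<Sum>y\<in>Y. noise_weight E n z y) \<longleftrightarrow>
          real Den < real ((n + 1)\<^sup>2 * (\<Sum>y\<in>Y. noise_weight E n z y))" by (simp only: of_nat_less_iff)
      also have "real ((n + 1)\<^sup>2 * (\<Sum>y\<in>Y. noise_weight E n z y)) =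
          (real n + 1)\<^sup>2 * (\<Sum>y\<in>Y. \<nu> z y) * real Den"
        by (simp add: noise_weight \<nu>_def Den(2) sum_distrib_right[symmetric] del: power_Suc prod.lessThan_Suc)
      also have "real Den < (real n + 1)\<^sup>2 * (\<Sum>y\<in>Y. \<nu> z y) * real Den \<longleftrightarrow>
          1 < (real n + 1)\<^sup>2 * (\<Sum>y\<in>Y. \<nu> z y)"
        using Den(1) mult_less_cancel_right_pos[of "real Den" 1] by simp
      finally show ?thesis .
    qed
    have sum_bool: "(\<Sum>y<2 ^ n. of_bool (Q y) * f y) = (\<Sum>y\<in>{y. y < 2 ^ n \<and> Q y}. f y)" for Q and f :: "nat \<Rightarrow> nat"
    proof -
      have "(\<Sum>y<2 ^ n. of_bool (Q y) * f y) = (\<Sum>y<2 ^ n. if Q y then f y else 0)"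
        by (intro sum.cong) auto
      also have "\<dots> = (\<Sum>y\<in>{y \<in> {..<2 ^ n}. Q y}. f y)" by (intro sum.inter_filter[symmetric]) simp
      finally show ?thesis by simp
    qed
    define Pt where "Pt t = {y. y < 2 ^ n \<and> P (prod_encode (k, string_encode (bits n y))) t}" for t
    have D': "D a z t \<longleftrightarrow> z < 2 ^ n \<and> 1 < (real n + 1)\<^sup>2 *
        (\<Sum>y\<in>Pt t. \<nu> z y)" for z t
      unfolding D sum_bool real_D Pt_def ..
    define A where "A = {z'. \<exists>t. D a z' t}"
    have A_sub: "A \<subseteq> {..<2 ^ n}" by (auto simp: A_def D)
    have A_hits: "1 \<le> (real n + 1)\<^sup>2 * (\<Sum>y\<in>V. \<nu> x y)" if x: "x \<in> A" for x
    proof -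
      obtain t where "D a x t" using x by (auto simp: A_def)
      then have "1 < (real n + 1)\<^sup>2 * (\<Sum>y\<in>Pt t. \<nu> x y)"
        unfolding D' by blast
      also have "\<dots> \<le> (real n + 1)\<^sup>2 * (\<Sum>y\<in>V. \<nu> x y)"
        by (intro mult_left_mono sum_mono2) (use P(2) noise_flip_nonneg in \<open>auto simp: V_def Pt_def \<nu>_def\<close>)
      finally show ?thesis by simp
    qed
    \<comment> \<open>At a stage where all strings of length \<open>n\<close> in \<open>T k\<close>
      have appeared, the approximation equals the true probability.\<close>
    obtain t where t: "D a z t"
    proof -
      have "\<forall>y<2 ^ n. \<exists>t. bits n y \<in> T k \<longrightarrow> P (prod_encode (k, string_encode (bits n y))) t"
        using P(2) by blast
      from uniform_fuel[OF _ this] obtain t where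
        t: "\<forall>y<2 ^ n. bits n y \<in> T k \<longrightarrow> P (prod_encode (k, string_encode (bits n y))) t"
        using P(3) by blast
      then have "Pt t = V"
        using P(2) by (auto simp: V_def Pt_def)
      then have "D a z t" unfolding D' using z hit by (simp add: hit_probability_def V_def \<nu>_def)
      then show thesis by (rule that)
    qed
    then have zA: "z \<in> A" by (auto simp: A_def)
    have fin: "finite A" using A_sub by (rule finite_subset) simp
    have V_card: "real (card V) \<le> 2 powr (\<alpha> * real n)"
      using order_trans[OF card_strong_test[OF T k(1), of n] powr_mono[of "\<alpha> * real n - real k" "\<alpha> * real n" 2]]
      by (simp add: V_def)
    define d :: real where "d = 1 / 2 ^ Suc (phase E L)"
    have d: "0 < d" "d \<le> 1 / 4" "2 * d = 1 / 2 ^ phase E L"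
      using ph power_increasing[of 2 "Suc (phase E L)" "2 :: real"] by (auto simp: d_def L_def field_simps)
    define u where "u = log 2 (real (card A))"
    have "u \<le> \<alpha> * real n - 2 * d * (1 - \<alpha>) * real n + 8 * log 2 (real n + 1)"
      unfolding u_def
      by (rule noisy_hits_card[OF A_sub _ _ V_card d(1,2) _ _ \<alpha> A_hits[unfolded \<nu>_def]])
        (use zA flip_rate_antimono flip_rate_bounds in \<open>auto simp: V_def d_def L_def simp del: power_Suc\<close>)
    moreover have "log 2 (real n + 1) \<le> real L + 1"
    proof -
      have "n + 1 \<le> 2 ^ Suc L" using power_level(2)[of n] k by (simp add: L_def)
      then have "real (n + 1) \<le> real (2 ^ Suc L)" by (simp only: of_nat_le_iff)
      then have "log 2 (real n + 1) \<le> log 2 (2 ^ Suc L)" by (subst log_le_cancel_iff) auto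
      also have "\<dots> = real (Suc L)" by (rule log_pow_cancel) auto
      finally show ?thesis by simp
    qed
    moreover have "2 * d * (1 - \<alpha>) * real n = (1 - \<alpha>) * real n / 2 ^ phase E L"
      unfolding d(3) by simp
    ultimately have u: "u \<le> \<alpha> * real n - (1 - \<alpha>) * real n / 2 ^ phase E L + 8 * real L + 8"
      by linarith
    have cA: "1 \<le> card A" using zA fin by (simp add: Suc_le_eq card_gt_0_iff) blast
    obtain m where card_A: "card A \<le> 2 ^ m" and m: "real m \<le> u + 1"
      using le_two_power_log[of "card A"] cA by (auto simp: u_def)
    have a_bound: "a < 2 ^ (23 + 8 * L)"
    proof -
      define M :: nat where "M = 2 ^ Suc L"
      have M: "1 \<le> M" by (simp add: M_def)
      have n: "n < M" using power_level(2)[of n] k by (simp add: L_def M_def)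
      have e: "e < M" unfolding e_def M_def by (rule segment_number_less)
      have "prod_encode (k, e) \<le> (k + e + 1)\<^sup>2" by (rule prod_encode_le)
      also have "\<dots> \<le> (2 * M)\<^sup>2" using n e k by (intro power_mono) auto
      finally have 1: "prod_encode (k, e) \<le> 4 * M ^ 2" by (simp add: power_mult_distrib)
      have MM: "M \<le> M ^ 2" using M by (simp add: power2_eq_square)
      have "prod_encode (n, prod_encode (k, e)) \<le> (n + prod_encode (k, e) + 1)\<^sup>2" by (rule prod_encode_le)
      also have "\<dots> \<le> (8 * M ^ 2)\<^sup>2" using n 1 MM by (intro power_mono) auto
      finally have 2: "prod_encode (n, prod_encode (k, e)) \<le> 64 * M ^ 4" by (simp add: power_mult_distrib flip: power_mult)
      have M4: "1 \<le> M ^ 4" using M by simp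
      have "a \<le> (0 + prod_encode (n, prod_encode (k, e)) + 1)\<^sup>2" unfolding a_def by (rule prod_encode_le)
      also have "\<dots> \<le> (128 * M ^ 4)\<^sup>2" using 2 M4 by (intro power_mono) auto
      also have "\<dots> = 2 ^ 14 * M ^ 8" by (simp add: power_mult_distrib flip: power_mult)
      also have "\<dots> = 2 ^ (14 + Suc L * 8)" unfolding M_def power_add power_mult ..
      also have "\<dots> < 2 ^ (23 + 8 * L)" by (rule power_strict_increasing) auto
      finally show ?thesis .
    qed
    have "enumerated D a z = A" by (auto simp: enumerated_def A_def a_def)
    then have "complexity U (bits n z) \<le> enat (2 * (23 + 8 * L) + 0 + m + c)"
      using c[OF a_bound t, of m] fin card_A by (simp add: a_def)
    moreover have "real (2 * (23 + 8 * L) + 0 + m + c) \<le>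
        \<alpha> * real n - (1 - \<alpha>) * real n / 2 ^ phase E (level n) + 24 * real (level n) + real (c + 55)"
      using u m by (simp add: L_def)
    ultimately show "\<exists>m::nat. complexity U (bits n z) \<le> enat m \<and>
        real m \<le> \<alpha> * real n - (1 - \<alpha>) * real n / 2 ^ phase E (level n) + 24 * real (level n) + real (c + 55)"
      by blast
  qed
qed

section \<open>The union bound for random perturbations\<close>

lemma sum_noise: "(\<Sum>y<2 ^ n. noise \<delta> n x y) = 1"
  using sum_noise_product[of \<delta> n x "\<lambda>_. 1"] by (simp cong: if_cong)

lemma noise_prefix_hit:
  assumes "l \<le> n"
  shows "(\<Sum>y<2 ^ n. noise (flip_rate E) n x y * of_bool (bits l y \<in> V)) = hit_probability E V l x"
proof -
  have "(\<Sum>y<2 ^ n. noise (flip_rate E) n x y * of_bool (bits l y \<in> V))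
      = (\<Sum>y<2 ^ l. noise (flip_rate E) l x y * of_bool (bits l y \<in> V))"
    using assms by (intro noise_marginal) (auto cong: bits_cong)
  also have "\<dots> = (\<Sum>y<2 ^ l. if bits l y \<in> V then noise (flip_rate E) l x y else 0)"
    by (intro sum.cong) auto
  also have "\<dots> = (\<Sum>y\<in>{y \<in> {..<2 ^ l}. bits l y \<in> V}. noise (flip_rate E) l x y)"
    by (intro sum.inter_filter[symmetric]) simp
  finally show ?thesis by (simp add: hit_probability_def)
qed

text \<open>Chernoff's bound: counting every flip in the block with weight 2 gives an expectation of
  at most \<open>2 powr K\<close>, so more than \<open>2 * K\<close> flips have probability at most
  \<open>2 powr (- K)\<close>, and \<open>r \<le> K\<close> by the schedule.\<close>

lemma noise_block_far:
  assumes r: "r * r * 2 ^ phase E r \<le> 2 ^ r" and n: "2 ^ Suc r \<le> n"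
  shows "(\<Sum>y<2 ^ n. noise (flip_rate E) n x y * of_bool (2 * 2 ^ r / 2 ^ phase E r <
    real (block_errors r (bit x) (bit y)))) \<le> 1 / 2 ^ r"
proof -
  define t :: "nat \<Rightarrow> real" where "t i = (if 2 ^ r \<le> i \<and> i < 2 ^ Suc r then 2 else 1)" for i
  let ?G = "\<lambda>y. \<Prod>i<n. if bit x i = bit y i then 1 else t i"
  define K where "K = 2 ^ r / (2::real) ^ phase E r"
  define B where "B y = {i. 2 ^ r \<le> i \<and> i < 2 ^ Suc r \<and> bit x i \<noteq> bit y i}" for y :: nat
  have fin: "finite (B y)" for y by (simp add: B_def)
  have t1: "t i = 1" if "\<not> (2 ^ r \<le> i \<and> i < 2 ^ Suc r)" for i using that by (simp add: t_def)
  have B: "?G y = 2 ^ card (B y)" for y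
  proof -
    have "?G y = (\<Prod>i\<in>B y. 2)"
      by (rule prod.mono_neutral_cong_right) (use n in \<open>auto simp: B_def t_def\<close>)
    then show ?thesis by simp
  qed
  have "(\<Sum>y<2 ^ n. noise (flip_rate E) n x y * of_bool (2 * K < real (card (B y))))
      \<le> (\<Sum>y<2 ^ n. noise (flip_rate E) n x y * (2 powr (- 2 * K) * ?G y))"
  proof (intro sum_mono mult_left_mono noise_flip_nonneg)
    fix y
    have "1 \<le> 2 powr (- 2 * K) * 2 ^ card (B y)" if "2 * K < real (card (B y))"
    proof -
      have "2 powr 0 \<le> (2::real) powr (- 2 * K + real (card (B y)))" using that by (intro powr_mono) auto
      also have "\<dots> = 2 powr (- 2 * K) * 2 ^ card (B y)" unfolding powr_add by (simp only: powr_realpow zero_less_numeral)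
      finally show ?thesis by simp
    qed
    then show "of_bool (2 * K < real (card (B y))) \<le> 2 powr (- 2 * K) * ?G y"
      unfolding B by auto
  qed
  also have "\<dots> = 2 powr (- 2 * K) * (\<Sum>y<2 ^ n. noise (flip_rate E) n x y * ?G y)"
    by (simp only: sum_distrib_left mult.left_commute)
  also have "(\<Sum>y<2 ^ n. noise (flip_rate E) n x y * ?G y)
      = (\<Prod>i<n. 1 - flip_rate E i + flip_rate E i * t i)"
    by (rule sum_noise_product)
  also have "(\<Prod>i<n. 1 - flip_rate E i + flip_rate E i * t i) = (\<Prod>i\<in>{2 ^ r..<2 ^ Suc r :: nat}. 1 + 1 / 2 ^ Suc (phase E r))"
  proof (rule prod.mono_neutral_cong_right)
    show "1 - flip_rate E i + flip_rate E i * t i = 1 + 1 / 2 ^ Suc (phase E r)" if "i \<in> {2 ^ r..<2 ^ Suc r}" for i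
      using that level_eq[of r i] by (simp add: t_def flip_rate_def)
  qed (use n in \<open>auto simp: t_def\<close>)
  also have "\<dots> = (1 + 1 / 2 ^ Suc (phase E r)) ^ (2 ^ r)" by simp
  also have "\<dots> \<le> (2 powr (2 / 2 ^ Suc (phase E r))) ^ (2 ^ r)"
    using one_plus_le_two_powr[of "1 / 2 ^ Suc (phase E r)"] by (intro power_mono) auto
  also have "\<dots> = 2 powr K" by (simp add: powr_power K_def)
  finally have "(\<Sum>y<2 ^ n. noise (flip_rate E) n x y * of_bool (2 * K < real (card (B y)))) \<le> 2 powr (- 2 * K) * 2 powr K"
    by simp
  also have "\<dots> = 2 powr (- K)" by (simp flip: powr_add)
  also have "\<dots> \<le> 2 powr (- real r)"
  proof -
    have "real (r * r * 2 ^ phase E r) \<le> real (2 ^ r)" using r by (simp only: of_nat_le_iff)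
    then have "real (r * r) \<le> K" by (simp add: K_def field_simps)
    moreover have "real r \<le> real (r * r)" by (simp only: of_nat_le_iff le_square)
    ultimately show ?thesis by (intro powr_mono) auto
  qed
  also have "\<dots> = 1 / 2 ^ r" by (simp add: powr_minus powr_realpow field_simps)
  finally show ?thesis by (simp add: K_def B_def)
qed

text \<open>Telescoping. This summability motivates the factor \<open>(n + 1)\<^sup>2\<close> in the
  hit condition, which costs only logarithmically many bits.\<close>

lemma sum_inverse_squares_le: "1 \<le> k \<Longrightarrow> (\<Sum>l<n. of_bool (k \<le> l) / (real l + 1)\<^sup>2) \<le> 1 / real k"
proof -
  assume k: "1 \<le> k"
  have "(\<Sum>l<n. of_bool (k \<le> l) / (real l + 1)\<^sup>2) \<le> 1 / real k - (if k \<le> n then 1 / real n else 1 / real k)"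
  proof (induction n)
    case (Suc n)
    consider "k \<le> n" | "k = Suc n" | "Suc n < k" by linarith
    then show ?case
    proof cases
      case 1
      then have n: "0 < real n" using k by simp
      have "1 / (real n + 1)\<^sup>2 \<le> 1 / (real n * (real n + 1))"
        using n by (intro divide_left_mono) (auto simp: power2_eq_square)
      also have "\<dots> = 1 / real n - 1 / (real n + 1)" using n by (simp add: field_simps)
      finally have "1 / (real n + 1)\<^sup>2 \<le> 1 / real n - 1 / (real n + 1)" .
      then show ?thesis using Suc 1 by (simp add: add.commute)
    qed (use Suc in auto)
  qed (use k in auto)
  also have "\<dots> \<le> 1 / real k" by simp
  finally show ?thesis .
qed

theorem dimension_less_than_one:
  assumes opt: "optimal U" and dim: "effective_dimension U X = ereal \<alpha>" and \<alpha>: "\<alpha> < 1"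
  shows "\<exists>Y. strongly_random \<alpha> Y \<and> besicovitch_distance X Y = 0"
proof -
  \<comment> \<open>The deficit \<open>(1 - \<alpha>) / 2 ^ Suc s\<close> is half of the saving per
    bit. A noticeable hit would bound the other half by \<open>24 * L + c\<close>, although it grows
    like the square of \<open>L\<close>.\<close>
  obtain E where E: "filterlim (phase E) at_top sequentially"
    "\<And>i. 1 \<le> phase E i \<Longrightarrow> i * i * 2 ^ phase E i \<le> 2 ^ i"
    "\<And>i n m. \<lbrakk>1 \<le> phase E i; 2 ^ i \<le> n; complexity U (initial_segment X n) \<le> enat m\<rbrakk> \<Longrightarrow>
      (\<alpha> - (1 - \<alpha>) / 2 ^ Suc (phase E i)) * real n \<le> real m"
    by (rule complexity_schedule[OF dim, of "\<lambda>s. (1 - \<alpha>) / 2 ^ Suc s" "\<lambda>s. s" "\<lambda>s. 0"]) (use \<alpha> that in auto)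
  obtain R0 where R0: "\<And>r. R0 \<le> r \<Longrightarrow> 1 \<le> phase E r"
    using E(1) unfolding filterlim_at_top eventually_sequentially by blast
  obtain T and P :: "nat \<Rightarrow> nat \<Rightarrow> nat \<Rightarrow> bool" where *: "\<forall>j. strong_test \<alpha> (T j)"
    "\<forall>V. strong_test \<alpha> V \<longrightarrow> (\<exists>j. \<forall>k\<ge>1. V k = T j k)"
    "\<forall>j. decidable (\<lambda>p. P j (pfst p) (psnd p))"
    "\<forall>j k \<sigma>. \<sigma> \<in> T j k \<longleftrightarrow> (\<exists>t. P j (prod_encode (k, string_encode \<sigma>)) t)"
    "\<forall>j x t t'. P j x t \<longrightarrow> t \<le> t' \<longrightarrow> P j x t'"
    using strong_tests_enumeration[of \<alpha>] by blast
  note T = *(1,2)[rule_format] and P = *(3-5)[rule_format]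
  define x where "x n = segment_number X n" for n
  have "\<exists>N. \<forall>n k. N \<le> n \<longrightarrow> 1 \<le> k \<longrightarrow> k \<le> n \<longrightarrow> hit_probability E (T j k) n (x n) \<le> 1 / (real n + 1)\<^sup>2" for j
  proof -
    obtain c :: nat where c: "\<And>E n k z. \<lbrakk>1 \<le> k; k \<le> n; z < 2 ^ n; 1 \<le> phase E (level n);
      1 < (real n + 1)\<^sup>2 * hit_probability E (T j k) n z\<rbrakk> \<Longrightarrow>
      \<exists>m::nat. complexity U (bits n z) \<le> enat m \<and>
      real m \<le> \<alpha> * real n - (1 - \<alpha>) * real n / 2 ^ phase E (level n) + 24 * real (level n) + real c"
    proof (rule noisy_hits_compressible[OF opt T(1)[of j] less_imp_le[OF \<alpha>] P(1)[of j]])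
      show "\<sigma> \<in> T j k \<longleftrightarrow> (\<exists>t. P j (prod_encode (k, string_encode \<sigma>)) t)" for k \<sigma> by (rule P(2))
      show "P j x t'" if "P j x t" "t \<le> t'" for x t t' using that by (rule P(3))
    qed (rule that)
    have "\<forall>\<^sub>F n in sequentially. max R0 (Suc (nat \<lceil>2 * (24 + real c) / (1 - \<alpha>)\<rceil>)) \<le> level n"
      using filterlim_level unfolding filterlim_at_top by blast
    then obtain N where N: "\<And>n. N \<le> n \<Longrightarrow> max R0 (Suc (nat \<lceil>2 * (24 + real c) / (1 - \<alpha>)\<rceil>)) \<le> level n"
      unfolding eventually_sequentially by blast
    have "hit_probability E (T j k) n (x n) \<le> 1 / (real n + 1)\<^sup>2" if n: "N \<le> n" and k: "1 \<le> k" "k \<le> n" for n k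
    proof (rule ccontr)
      assume "\<not> ?thesis"
      then have hit: "1 < (real n + 1)\<^sup>2 * hit_probability E (T j k) n (x n)"
        by (simp add: field_simps)
      define L s where "L = level n" and "s = phase E L"
      have L: "R0 \<le> L" "nat \<lceil>2 * (24 + real c) / (1 - \<alpha>)\<rceil> < L" using N[OF n] by (auto simp: L_def)
      have s: "1 \<le> s" using R0[OF L(1)] by (simp add: s_def)
      have nL: "2 ^ L \<le> n" using power_level(1)[of n] k by (simp add: L_def)
      obtain m :: nat where m: "complexity U (bits n (x n)) \<le> enat m"
        "real m \<le> \<alpha> * real n - (1 - \<alpha>) * real n / 2 ^ s + 24 * real L + real c"
        using c[OF k segment_number_less s[unfolded s_def L_def] hit[unfolded x_def]] by (auto simp: L_def s_def x_def)
      have q: "L * L * 2 ^ s \<le> 2 ^ L" "(\<alpha> - (1 - \<alpha>) / 2 ^ Suc s) * real n \<le> real m"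
        using E(2,3)[OF s[unfolded s_def]] m(1) nL by (auto simp: s_def x_def bits_segment_number)
      have "(1 - \<alpha>) * real n / 2 ^ Suc s \<le> 24 * real L + real c"
        using q(2) m(2) by (simp add: field_simps)
      moreover have "(1 - \<alpha>) / 2 * (real L * real L) \<le> (1 - \<alpha>) * real n / 2 ^ Suc s"
      proof -
        have "real (L * L * 2 ^ s) \<le> real n" using order_trans[OF q(1) nL] by (simp only: of_nat_le_iff)
        then have "real L * real L \<le> real n / 2 ^ s" by (simp add: field_simps)
        then have "(1 - \<alpha>) / 2 * (real L * real L) \<le> (1 - \<alpha>) / 2 * (real n / 2 ^ s)"
          using \<alpha> by (intro mult_left_mono) auto
        then show ?thesis by simp
      qed
      ultimately have *: "(1 - \<alpha>) / 2 * (real L * real L) \<le> 24 * real L + real c" by linarith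
      have L1: "1 \<le> real L" using L(2) by linarith
      then have "real c * 1 \<le> real c * real L" by (intro mult_left_mono) auto
      with * have "(1 - \<alpha>) / 2 * real L * real L \<le> (24 + real c) * real L" by (simp add: algebra_simps)
      then have "(1 - \<alpha>) / 2 * real L \<le> 24 + real c" using L1 by simp
      then have "real L \<le> 2 * (24 + real c) / (1 - \<alpha>)" using \<alpha> by (simp add: field_simps)
      also have "\<dots> \<le> real (nat \<lceil>2 * (24 + real c) / (1 - \<alpha>)\<rceil>)" by (rule real_nat_ceiling_ge)
      finally show False using L(2) by linarith
    qed
    then show ?thesis by blast
  qed
  then obtain N where N: "\<And>j n k. N j \<le> n \<Longrightarrow> 1 \<le> k \<Longrightarrow> k \<le> n \<Longrightarrow>
      hit_probability E (T j k) n (x n) \<le> 1 / (real n + 1)\<^sup>2" by metis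
  \<comment> \<open>\<open>N j\<close> starts the probability bound, and \<open>2 ^ (j + 3)\<close>
    makes the failure probabilities of all tests sum to at most 1/4.\<close>
  define k where "k j = max (N j) (2 ^ (j + 3))" for j
  have k1: "1 \<le> k j" for j by (simp add: k_def le_max_iff_disj)
  have hit: "hit_probability E (T j (k j)) n (x n) \<le> of_bool (k j \<le> n) / (real n + 1)\<^sup>2" for j n
  proof (cases "k j \<le> n")
    case True then show ?thesis using N[of j n "k j"] k1[of j] by (simp add: k_def)
  next
    case False
    have "real (card {y. y < 2 ^ n \<and> bits n y \<in> T j (k j)}) \<le> 2 powr (\<alpha> * real n - real (k j))"
      by (rule card_strong_test[OF T(1) k1])
    \<comment> \<open>A component has fewer than one string of each length below its index, so short
      prefixes are never hit.\<close>
    also have "\<dots> < 2 powr 0"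
    proof (rule powr_less_mono)
      have "\<alpha> * real n \<le> 1 * real n" using \<alpha> by (intro mult_right_mono) auto
      then show "\<alpha> * real n - real (k j) < 0" using False by simp
    qed simp
    finally have "card {y. y < 2 ^ n \<and> bits n y \<in> T j (k j)} = 0" by simp
    then have "{y. y < 2 ^ n \<and> bits n y \<in> T j (k j)} = {}" by (subst (asm) card_0_eq) auto
    then show ?thesis using False unfolding hit_probability_def by (simp only: sum.empty) simp
  qed
  define R where "R = max R0 3"
  define far where "far r y \<longleftrightarrow> 2 * 2 ^ r / 2 ^ phase E r <
    real (block_errors r X (bit y))" for r and y :: nat
  have "\<exists>y<2 ^ 2 ^ I. (\<forall>r. R \<le> r \<longrightarrow> r < I \<longrightarrow> \<not> far r y) \<and> (\<forall>j<I. \<forall>l<2 ^ I. bits l y \<notin> T j (k j))" for I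
  proof (rule ccontr)
    \<comment> \<open>All conditions are decided by \<open>2 ^ I\<close> bits. Bad blocks and hits
      contribute at most 1/4 each, the blocks because \<open>R\<close> is at least 3.\<close>
    define n :: nat where "n = 2 ^ I"
    define \<mu> where "\<mu> y = noise (flip_rate E) n (x n) y" for y
    let ?F = "\<lambda>y. \<Sum>r\<in>{R..<I}. \<mu> y * of_bool (far r y)"
    let ?H = "\<lambda>y. \<Sum>j<I. \<Sum>l<n. \<mu> y * of_bool (bits l y \<in> T j (k j))"
    have nn: "0 \<le> \<mu> y" for y by (simp add: \<mu>_def noise_flip_nonneg)
    assume "\<not> ?thesis"
    then have bad: "(\<exists>r\<in>{R..<I}. far r y) \<or> (\<exists>j<I. \<exists>l<n. bits l y \<in> T j (k j))" if "y < 2 ^ n" for y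
      using that by (force simp: n_def)
    have "1 = (\<Sum>y<2 ^ n. \<mu> y)" by (simp add: \<mu>_def sum_noise)
    also have "\<dots> \<le> (\<Sum>y<2 ^ n. ?F y + ?H y)"
    proof (rule sum_mono)
      fix y :: nat assume "y \<in> {..<2 ^ n}"
      with bad consider r where "r \<in> {R..<I}" "far r y" | j l where "j < I" "l < n" "bits l y \<in> T j (k j)" by blast
      then show "\<mu> y \<le> ?F y + ?H y"
      proof cases
        case 1
        have "\<mu> y \<le> ?F y"
          using member_le_sum[of r "{R..<I}" "\<lambda>r. \<mu> y * of_bool (far r y)"] 1 nn by simp
        then show ?thesis using nn by (simp add: add_increasing2 sum_nonneg)
      next
        case 2
        have "\<mu> y \<le> (\<Sum>l<n. \<mu> y * of_bool (bits l y \<in> T j (k j)))"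
          using member_le_sum[of l "{..<n}" "\<lambda>l. \<mu> y * of_bool (bits l y \<in> T j (k j))"] 2 nn by simp
        also have "\<dots> \<le> ?H y"
          using member_le_sum[of j "{..<I}" "\<lambda>j. \<Sum>l<n. \<mu> y * of_bool (bits l y \<in> T j (k j))"] 2 nn by (simp add: sum_nonneg)
        finally show ?thesis using nn by (simp add: add_increasing sum_nonneg)
      qed
    qed
    also have "\<dots> = (\<Sum>r\<in>{R..<I}. \<Sum>y<2 ^ n. \<mu> y * of_bool (far r y)) +
        (\<Sum>j<I. \<Sum>l<n. \<Sum>y<2 ^ n. \<mu> y * of_bool (bits l y \<in> T j (k j)))"
      unfolding sum.distrib by (subst (1 2 3) sum.swap) (rule refl)
    also have "\<dots> \<le> (\<Sum>r\<in>{R..<I}. 1 / 2 ^ r) + (\<Sum>j<I. 1 / 2 ^ (j + 3))"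
    proof (intro add_mono sum_mono)
      fix r assume r: "r \<in> {R..<I}"
      then have ph: "1 \<le> phase E r" using R0 by (simp add: R_def)
      have n: "2 ^ Suc r \<le> n" unfolding n_def using r by (intro power_increasing) auto
      have far: "far r y \<longleftrightarrow> 2 * 2 ^ r / 2 ^ phase E r <
          real (block_errors r (bit (x n)) (bit y))" for y
      proof -
        have "{i. 2 ^ r \<le> i \<and> i < 2 ^ Suc r \<and> X i \<noteq> bit y i} = {i. 2 ^ r \<le> i \<and> i < 2 ^ Suc r \<and> bit (x n) i \<noteq> bit y i}"
          using n by (auto simp: x_def bit_segment_number)
        then show ?thesis by (simp add: far_def)
      qed
      show "(\<Sum>y<2 ^ n. \<mu> y * of_bool (far r y)) \<le> 1 / 2 ^ r"
        unfolding far \<mu>_def by (intro noise_block_far n E(2) ph)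
    next
      fix j assume "j \<in> {..<I}"
      have "(\<Sum>l<n. \<Sum>y<2 ^ n. \<mu> y * of_bool (bits l y \<in> T j (k j))) \<le> (\<Sum>l<n. of_bool (k j \<le> l) / (real l + 1)\<^sup>2)"
      proof (rule sum_mono)
        fix l assume l: "l \<in> {..<n}"
        have "(\<Sum>y<2 ^ n. \<mu> y * of_bool (bits l y \<in> T j (k j))) = hit_probability E (T j (k j)) l (x n)"
          unfolding \<mu>_def using l by (intro noise_prefix_hit) simp
        also have "\<dots> = hit_probability E (T j (k j)) l (x l)"
          unfolding hit_probability_def using l
          by (intro sum.cong noise_cong refl) (auto simp: x_def bit_segment_number)
        finally show "(\<Sum>y<2 ^ n. \<mu> y * of_bool (bits l y \<in> T j (k j))) \<le> of_bool (k j \<le> l) / (real l + 1)\<^sup>2"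
          using hit by simp
      qed
      also have "\<dots> \<le> 1 / real (k j)" by (rule sum_inverse_squares_le[OF k1])
      also have "\<dots> \<le> 1 / 2 ^ (j + 3)"
      proof (rule divide_left_mono)
        have "real (2 ^ (j + 3)) \<le> real (k j)" unfolding of_nat_le_iff by (simp add: k_def)
        then show "2 ^ (j + 3) \<le> real (k j)" by simp
      qed (use k1[of j] in auto)
      finally show "(\<Sum>l<n. \<Sum>y<2 ^ n. \<mu> y * of_bool (bits l y \<in> T j (k j))) \<le> 1 / 2 ^ (j + 3)" .
    qed
    also have "\<dots> \<le> 1 / 4 + 1 / 4"
    proof (rule add_mono)
      have geo: "(\<Sum>j<I. 1 / 2 ^ (j + 3)) \<le> 1 / (4::real)" for I :: nat
      proof -
        have "(\<Sum>j<I. 1 / 2 ^ (j + 3)) = 1 / (4::real) - 1 / 2 ^ (I + 2)" by (induction I) (auto simp: power_add field_simps)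
        then show ?thesis by simp
      qed
      then show "(\<Sum>j<I. 1 / 2 ^ (j + 3)) \<le> 1 / (4::real)" .
      have "(\<Sum>r\<in>{R..<I}. 1 / 2 ^ r) \<le> (\<Sum>r\<in>{3..<I + 3}. 1 / (2::real) ^ r)"
        by (rule sum_mono2) (auto simp: R_def)
      also have "\<dots> = (\<Sum>j<I. 1 / 2 ^ (j + 3))"
        using sum.shift_bounds_nat_ivl[of "\<lambda>r. 1 / (2::real) ^ r" 0 3 I] by (simp add: lessThan_atLeast0 add.commute)
      finally show "(\<Sum>r\<in>{R..<I}. 1 / 2 ^ r) \<le> 1 / (4::real)" using geo[of I] by linarith
    qed
    finally show False by simp
  qed
  then obtain y where y: "\<And>I r. R \<le> r \<Longrightarrow> r < I \<Longrightarrow> \<not> far r (y I)"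
    "\<And>I j l. j < I \<Longrightarrow> l < 2 ^ I \<Longrightarrow> bits l (y I) \<notin> T j (k j)" by metis
  obtain Y where Y: "\<And>n m. \<exists>i\<ge>m. \<forall>b<n. bit (y i) b = Y b" using limit_sequence by blast
  have "strongly_random \<alpha> Y" unfolding strongly_random_def
  proof (intro allI impI)
    fix V assume "strong_test \<alpha> V"
    then obtain j where j: "\<forall>k\<ge>1. V k = T j k" using T(2) by blast
    have "initial_segment Y l \<notin> T j (k j)" for l
    proof -
      \<comment> \<open>\<open>Y\<close> shares its first \<open>l\<close> bits with
        \<open>y I\<close> for arbitrarily large \<open>I\<close>, so \<open>j\<close> may be taken
        among the tests treated there.\<close>
      obtain I where I: "max (Suc j) l \<le> I" "\<forall>b<l. bit (y I) b = Y b" using Y by blast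
      have "l < 2 ^ I" using I(1) less_exp[of I] by linarith
      then have "bits l (y I) \<notin> T j (k j)" using y(2)[of j I l] I(1) by simp
      moreover have "bits l (y I) = initial_segment Y l" using I(2) by (simp add: bits_def initial_segment_def)
      ultimately show ?thesis by simp
    qed
    then show "\<exists>k\<ge>1. \<forall>n. initial_segment Y n \<notin> V k" using j k1 by (intro exI[of _ "k j"]) auto
  qed
  moreover have "besicovitch_distance X Y = 0"
  proof (rule besicovitch_distance_eq_0[OF E(1)])
    fix r assume r: "R \<le> r"
    obtain I where I: "Suc r \<le> I" "\<forall>b<2 ^ Suc r. bit (y I) b = Y b" using Y by blast
    have "{i. 2 ^ r \<le> i \<and> i < 2 ^ Suc r \<and> X i \<noteq> Y i} = {i. 2 ^ r \<le> i \<and> i < 2 ^ Suc r \<and> X i \<noteq> bit (y I) i}"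
      using I(2) by auto
    then show "real (block_errors r X Y) \<le> 2 * 2 ^ r / 2 ^ phase E r"
      using y(1)[OF r, of I] I(1) by (simp add: far_def)
  qed
  ultimately show ?thesis by blast
qed

section \<open>Dimension one\<close>

lemma inj_on_append: "inj_on (\<lambda>(u, v). u + 2 ^ a * v) ({..<2 ^ a} \<times> (V :: nat set))"
proof (rule inj_onI)
  fix p q :: "nat \<times> nat"
  assume "p \<in> {..<2 ^ a} \<times> V" "q \<in> {..<2 ^ a} \<times> V" "(\<lambda>(u, v). u + 2 ^ a * v) p = (\<lambda>(u, v). u + 2 ^ a * v) q"
  then obtain u v u' v' where *: "p = (u, v)" "q = (u', v')" "u < 2 ^ a" "u' < 2 ^ a" "u + 2 ^ a * v = u' + 2 ^ a * v'"
    by auto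
  then have "(u + 2 ^ a * v) mod 2 ^ a = (u' + 2 ^ a * v') mod 2 ^ a" by simp
  then have "u = u'" using *(3,4) by simp
  then show "p = q" using * by simp
qed

lemma less_power_add_iff:
  "Z < 2 ^ (a + b) \<longleftrightarrow> (\<exists>u v. u < 2 ^ a \<and> v < 2 ^ b \<and> Z = u + 2 ^ a * v)" for Z :: nat
proof
  assume "Z < 2 ^ (a + b)"
  then have "Z div 2 ^ a < 2 ^ b" by (simp add: power_add less_mult_imp_div_less mult.commute)
  then show "\<exists>u v. u < 2 ^ a \<and> v < 2 ^ b \<and> Z = u + 2 ^ a * v"
    by (intro exI[of _ "Z mod 2 ^ a"] exI[of _ "Z div 2 ^ a"]) simp
next
  assume "\<exists>u v. u < 2 ^ a \<and> v < 2 ^ b \<and> Z = u + 2 ^ a * v"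
  then obtain u v where uv: "u < 2 ^ a" "v < 2 ^ b" "Z = u + 2 ^ a * v" by blast
  have "Z < 2 ^ a * (v + 1)" using uv by simp
  also have "\<dots> \<le> 2 ^ a * 2 ^ b" using uv by (intro mult_left_mono) auto
  finally show "Z < 2 ^ (a + b)" by (simp add: power_add)
qed

lemma four_power: "(4 :: real) ^ n = 2 ^ n * 2 ^ n"
proof -
  have "(4 :: real) ^ n = (2 * 2) ^ n" by simp
  then show ?thesis unfolding power_mult_distrib .
qed

text \<open>Every \<open>x\<close> in \<open>B\<close> keeps, for a fraction \<open>\<theta>'\<close> of the tails \<open>Z\<close>, a whole Hamming ball inside \<open>Q\<close>, although the
  density of \<open>Q\<close> is only \<open>\<theta>\<close>. Averaging over \<open>Z\<close> the estimate for distant sets bounds \<open>B\<close>.\<close>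

lemma block_extension:
  fixes Q :: "nat \<Rightarrow> nat \<Rightarrow> bool" and d \<theta> \<theta>' :: real
  assumes count: "real (\<Sum>Z<2 ^ m. card {y. y < 2 ^ n \<and> Q y Z}) \<le> \<theta> * 2 ^ (n + m)"
    and d: "0 < d" "d \<le> 1"
    and B: "B = {x. x < 2 ^ n \<and> \<theta>' * 2 ^ m < real (card {Z. Z < 2 ^ m \<and>
      (\<forall>y<2 ^ n. real (differences n x y) \<le> d * real n \<longrightarrow> Q y Z)})}"
  shows "real (card B) * (\<theta>' - \<theta>) \<le> 2 ^ n * 2 powr (- (d\<^sup>2 * real n / 2))"
proof -
  define \<eta> where "\<eta> = 2 powr (- (d\<^sup>2 * real n / 2))"
  \<comment> \<open>For a fixed tail, \<open>As\<close> is the complement of \<open>Qs\<close> and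
    \<open>Is\<close> its interior of radius \<open>d * n\<close>, so \<open>Is\<close> and
    \<open>As\<close> are distant sets.\<close>
  define Qs where "Qs Z = {y. y < 2 ^ n \<and> Q y Z}" for Z
  define As where "As Z = {y. y < 2 ^ n \<and> \<not> Q y Z}" for Z
  define Is where "Is Z = {x. x < 2 ^ n \<and> (\<forall>y<2 ^ n. real (differences n x y) \<le> d * real n \<longrightarrow> Q y Z)}" for Z
  have fin: "finite (Qs Z)" "finite (As Z)" "finite (Is Z)" for Z by (auto simp: Qs_def As_def Is_def)
  have finB: "finite B" by (simp add: B)
  have IA: "real (card (Is Z)) * real (card (As Z)) \<le> 4 ^ n * \<eta>" for Z
    unfolding \<eta>_def
    by (rule card_mult_card_distant_power2[OF _ _ d]) (force simp: Is_def As_def not_le intro: less_imp_le)+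
  have QA: "real (card (As Z)) = 2 ^ n - real (card (Qs Z))" for Z
  proof -
    have "{..<2 ^ n} = As Z \<union> Qs Z" "As Z \<inter> Qs Z = {}" by (auto simp: As_def Qs_def)
    then have "card {..<2 ^ n :: nat} = card (As Z) + card (Qs Z)" using fin by (simp add: card_Un_disjoint)
    then have "real (2 ^ n) = real (card (As Z)) + real (card (Qs Z))" by (simp flip: of_nat_add)
    then show ?thesis by simp
  qed
  have one: "2 ^ n * (\<theta>' * 2 ^ m) - \<theta> * 2 ^ (n + m) \<le> (\<Sum>Z<2 ^ m. of_bool (x \<in> Is Z) * real (card (As Z)))"
    if "x \<in> B" for x
  proof -
    have x: "x < 2 ^ n" using that by (simp add: B)
    have "\<theta>' * 2 ^ m \<le> real (card {Z. Z < 2 ^ m \<and> x \<in> Is Z})"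
      using that by (simp add: B Is_def x less_imp_le)
    also have "\<dots> = (\<Sum>Z<2 ^ m. of_bool (x \<in> Is Z))"
    proof -
      have "{Z. Z < 2 ^ m \<and> x \<in> Is Z} = {Z \<in> {..<2 ^ m}. x \<in> Is Z}" by auto
      then show ?thesis by (simp add: of_bool_def sum.inter_filter[symmetric])
    qed
    finally have "2 ^ n * (\<theta>' * 2 ^ m) \<le> 2 ^ n * (\<Sum>Z<2 ^ m. of_bool (x \<in> Is Z))"
      by (intro mult_left_mono) auto
    \<comment> \<open>Holds term by term: equality if \<open>x\<close> is in the interior, and
      otherwise the left side is not positive.\<close>
    moreover have "2 ^ n * (\<Sum>Z<2 ^ m. of_bool (x \<in> Is Z)) - (\<Sum>Z<2 ^ m. real (card (Qs Z))) \<le>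
        (\<Sum>Z<2 ^ m. of_bool (x \<in> Is Z) * real (card (As Z)))"
      unfolding sum_distrib_left sum_subtractf[symmetric] by (intro sum_mono) (auto simp: QA)
    moreover have "(\<Sum>Z<2 ^ m. real (card (Qs Z))) \<le> \<theta> * 2 ^ (n + m)" using count by (simp add: Qs_def)
    ultimately show ?thesis by linarith
  qed
  have "real (card B) * (2 ^ n * (\<theta>' * 2 ^ m) - \<theta> * 2 ^ (n + m))
      \<le> (\<Sum>x\<in>B. \<Sum>Z<2 ^ m. of_bool (x \<in> Is Z) * real (card (As Z)))"
    using sum_mono[of B "\<lambda>_. 2 ^ n * (\<theta>' * 2 ^ m) - \<theta> * 2 ^ (n + m)", OF one] by simp
  also have "\<dots> = (\<Sum>Z<2 ^ m. \<Sum>x\<in>B. of_bool (x \<in> Is Z) * real (card (As Z)))" by (rule sum.swap)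
  also have "\<dots> \<le> (\<Sum>Z<2 ^ m. real (card (Is Z)) * real (card (As Z)))"
  proof (rule sum_mono)
    fix Z
    have "(\<Sum>x\<in>B. of_bool (x \<in> Is Z)) = real (card {x \<in> B. x \<in> Is Z})"
      using finB by (simp add: of_bool_def sum.inter_filter[symmetric])
    also have "\<dots> \<le> real (card (Is Z))" using fin by (intro of_nat_mono card_mono) auto
    finally show "(\<Sum>x\<in>B. of_bool (x \<in> Is Z) * real (card (As Z))) \<le> real (card (Is Z)) * real (card (As Z))"
      unfolding sum_distrib_right[symmetric] by (rule mult_right_mono) simp
  qed
  also have "\<dots> \<le> (\<Sum>Z<(2::nat) ^ m. 4 ^ n * \<eta>)" by (intro sum_mono IA)
  also have "\<dots> = (2 ^ n * 2 ^ m) * (2 ^ n * \<eta>)"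
    by (simp add: four_power)
  finally have "(2 ^ n * 2 ^ m) * (real (card B) * (\<theta>' - \<theta>)) \<le> (2 ^ n * 2 ^ m) * (2 ^ n * \<eta>)"
    by (simp add: power_add algebra_simps)
  then show ?thesis unfolding \<eta>_def[symmetric] by (subst (asm) mult_le_cancel_left_pos) auto
qed

section \<open>Blockwise tolerance and forced tails\<close>

definition block_differences :: "nat \<Rightarrow> nat \<Rightarrow> nat \<Rightarrow> nat" where
  "block_differences r x y = (\<Sum>b<2 ^ r. of_bool (bit x (2 ^ r + b) \<noteq> bit y (2 ^ r + b)))"

text \<open>Free of division, hence decidable by the closure rules. Position 0 lies in no block and
  may differ.\<close>

definition close :: "(nat \<Rightarrow> bool) \<Rightarrow> nat \<Rightarrow> nat \<Rightarrow> nat \<Rightarrow> bool" where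
  "close E i x y \<longleftrightarrow> (\<forall>r<i. block_differences r x y * 2 ^ phase E r \<le> 2 ^ r)"

lemma block_differences_cong:
  assumes "\<And>b. 2 ^ r \<le> b \<Longrightarrow> b < 2 ^ Suc r \<Longrightarrow> bit x b = bit x' b"
    "\<And>b. 2 ^ r \<le> b \<Longrightarrow> b < 2 ^ Suc r \<Longrightarrow> bit y b = bit y' b"
  shows "block_differences r x y = block_differences r x' y'"
  unfolding block_differences_def
  by (intro sum.cong refl arg_cong[where f = of_bool] arg_cong2[where f = "\<lambda>p q. p \<noteq> q"] assms) auto

lemma block_differences_append:
  assumes "x < 2 ^ 2 ^ r" "y < 2 ^ 2 ^ r"
  shows "block_differences r (x + 2 ^ 2 ^ r * x') (y + 2 ^ 2 ^ r * y') = differences (2 ^ r) x' y'"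
proof -
  have "block_differences r (x + 2 ^ 2 ^ r * x') (y + 2 ^ 2 ^ r * y') = (\<Sum>b<2 ^ r. of_bool (bit x' b \<noteq> bit y' b))"
    unfolding block_differences_def
    by (intro sum.cong) (auto simp: bit_append[OF assms(1)] bit_append[OF assms(2)])
  also have "\<dots> = card {b \<in> {..<2 ^ r}. bit x' b \<noteq> bit y' b}"
    by (simp add: of_bool_def sum.inter_filter[symmetric])
  finally show ?thesis by (simp add: differences_def)
qed

lemma block_differences_card:
  "block_differences r x y = block_errors r (bit x) (bit y)"
proof -
  let ?L = "{i. 2 ^ r \<le> i \<and> i < 2 ^ Suc r \<and> bit x i \<noteq> bit y i}" and ?R = "{b \<in> {..<2 ^ r}. bit x (2 ^ r + b) \<noteq> bit y (2 ^ r + b)}"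
  have "block_differences r x y = card ?R"
    unfolding block_differences_def by (simp add: of_bool_def sum.inter_filter[symmetric])
  also have "\<dots> = card ((+) (2 ^ r) ` ?R)"
    by (rule card_image[symmetric]) (simp add: inj_on_def)
  also have "(+) (2 ^ r) ` ?R =
      ?L"
  proof (intro equalityI subsetI)
    fix i assume "i \<in> ?L"
    then show "i \<in> (+) (2 ^ r) ` ?R"
      by (intro image_eqI[of _ _ "i - 2 ^ r"]) auto
  qed auto
  finally show ?thesis .
qed

lemma close_refl: "close E i x x"
  by (simp add: close_def block_differences_def)

lemma close_Suc_append:
  assumes "x < 2 ^ 2 ^ i" "y < 2 ^ 2 ^ i"
  shows "close E (Suc i) (x + 2 ^ 2 ^ i * x') (y + 2 ^ 2 ^ i * y') \<longleftrightarrow>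
    close E i x y \<and> differences (2 ^ i) x' y' * 2 ^ phase E i \<le> 2 ^ i"
proof -
  have "block_differences r (x + 2 ^ 2 ^ i * x') (y + 2 ^ 2 ^ i * y') = block_differences r x y" if "r < i" for r
  proof (rule block_differences_cong)
    fix b :: nat assume "b < 2 ^ Suc r"
    also have "(2::nat) ^ Suc r \<le> 2 ^ i" using that by (intro power_increasing) auto
    finally have "b < 2 ^ i" .
    then show "bit (x + 2 ^ 2 ^ i * x') b = bit x b" "bit (y + 2 ^ 2 ^ i * y') b = bit y b"
      by (simp_all add: bit_append[OF assms(1)] bit_append[OF assms(2)])
  qed
  then show ?thesis
    unfolding close_def less_Suc_eq by (auto simp: block_differences_append[OF assms])
qed

lemma close_cong: "(\<And>r. r < i \<Longrightarrow> E r = E' r) \<Longrightarrow> close E i x y = close E' i x y"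
  unfolding close_def using phase_cong[of _ E E'] by (metis le_less_trans)

lemma recursive_block_differences [rec_intros]:
  assumes "recursive f" "recursive g" "recursive h"
  shows "recursive (\<lambda>x. block_differences (f x) (g x) (h x))"
  by (rule recursive_compose3[OF _ assms]) (unfold block_differences_def, intro rec_intros)

text \<open>The tests are activated one after the other, the next one at each level of \<open>E\<close>. The component
  of the test is chosen so late that its measure is negligible in every cylinder of that level.\<close>

definition component :: "nat \<Rightarrow> nat" where
  "component r = 2 ^ r + r + 3"

text \<open>At a jump the phase is at least 1, so \<open>phase E r - 1\<close> is the index of the
  newly activated test. \<open>M\<close> bounds the prefixes and \<open>t\<close> the
  stages.\<close>

definition hit :: "(nat \<Rightarrow> nat \<Rightarrow> nat \<Rightarrow> bool) \<Rightarrow> (nat \<Rightarrow> bool) \<Rightarrow> nat \<Rightarrow> nat \<Rightarrow> nat \<Rightarrow> nat \<Rightarrow> bool" where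
  "hit P E i M t w \<longleftrightarrow> (\<exists>r<Suc i. E r \<and> (\<exists>l<Suc M.
     P (phase E r - 1) (prod_encode (component r, string_encode (bits l w))) t))"

text \<open>The tail \<open>Z\<close> forces a hit if no modification of \<open>x\<close> within the tolerance, followed by \<open>Z\<close>,
  escapes the tests that are active at level \<open>i\<close>.\<close>

definition forced :: "(nat \<Rightarrow> nat \<Rightarrow> nat \<Rightarrow> bool) \<Rightarrow> (nat \<Rightarrow> bool) \<Rightarrow> nat \<Rightarrow> nat \<Rightarrow> nat \<Rightarrow> nat \<Rightarrow> nat \<Rightarrow> nat \<Rightarrow> bool" where
  "forced P E i i' m t x Z \<longleftrightarrow> (\<forall>y<2 ^ 2 ^ i'. close E i' x y \<longrightarrow> hit P E i (2 ^ i' + m) t (y + 2 ^ 2 ^ i' * Z))"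

text \<open>The measure of forcing tails, as a numerator over \<open>2 ^ m\<close>. The separate
  indices \<open>i\<close> for tests and \<open>i'\<close> for blocks split an induction step into a
  new block and then a new test.\<close>

definition forced_count :: "(nat \<Rightarrow> nat \<Rightarrow> nat \<Rightarrow> bool) \<Rightarrow> (nat \<Rightarrow> bool) \<Rightarrow> nat \<Rightarrow> nat \<Rightarrow> nat \<Rightarrow> nat \<Rightarrow> nat \<Rightarrow> nat" where
  "forced_count P E i i' m t x = card {Z. Z < 2 ^ m \<and> forced P E i i' m t x Z}"

lemma hit_mono:
  assumes "\<And>j x t t'. P j x t \<Longrightarrow> t \<le> t' \<Longrightarrow> P j x t'" "t \<le> t'" "M \<le> M'" "hit P E i M t w"
    "\<And>b. b < M \<Longrightarrow> bit w b = bit w' b"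
  shows "hit P E i M' t' w'"
proof -
  obtain r l where "r < Suc i" "E r" "l < Suc M" "P (phase E r - 1) (prod_encode (component r, string_encode (bits l w))) t"
    using assms(4) by (auto simp: hit_def)
  moreover have "bits l w = bits l w'" using assms(5) \<open>l < Suc M\<close> by (intro bits_cong) auto
  ultimately show ?thesis unfolding hit_def using assms(1)[OF _ assms(2)] assms(3) by (metis le_less_trans less_Suc_eq_le order_trans)
qed

text \<open>A forcing tail keeps forcing when extended and at later stages, so the measure is
  approximated from below.\<close>

lemma forced_count_mono:
  assumes P: "\<And>j x t t'. P j x t \<Longrightarrow> t \<le> t' \<Longrightarrow> P j x t'" and "t \<le> t'" "m \<le> m'"
  shows "forced_count P E i i' m t x * 2 ^ (m' - m) \<le> forced_count P E i i' m' t' x"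
proof -
  let ?S = "{Z. Z < 2 ^ m \<and> forced P E i i' m t x Z}"
  let ?f = "\<lambda>(Z, u). Z + 2 ^ m * u :: nat"
  have inj: "inj_on ?f (?S \<times> {..<2 ^ (m' - m)})"
    by (rule inj_on_subset[OF inj_on_append[of m UNIV]]) auto
  have "?f ` (?S \<times> {..<2 ^ (m' - m)}) \<subseteq> {Z. Z < 2 ^ m' \<and> forced P E i i' m' t' x Z}"
  proof (rule image_subsetI)
    fix p :: "nat \<times> nat" assume "p \<in> ?S \<times> {..<2 ^ (m' - m)}"
    then obtain Z u where p: "p = (Z, u)" and Z: "Z < 2 ^ m" "forced P E i i' m t x Z" and u: "u < 2 ^ (m' - m)"
      by auto
    have "Z + 2 ^ m * u < 2 ^ (m + (m' - m))" unfolding less_power_add_iff using Z u by blast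
    then have "Z + 2 ^ m * u < 2 ^ m'" using assms(3) by simp
    moreover have "forced P E i i' m' t' x (Z + 2 ^ m * u)"
      unfolding forced_def
    proof (intro allI impI)
      fix y :: nat assume y: "y < 2 ^ 2 ^ i'" "close E i' x y"
      show "hit P E i (2 ^ i' + m') t' (y + 2 ^ 2 ^ i' * (Z + 2 ^ m * u))"
      proof (rule hit_mono[OF P assms(2)])
        show "hit P E i (2 ^ i' + m) t (y + 2 ^ 2 ^ i' * Z)" using Z(2) y by (simp add: forced_def)
        fix b assume b: "b < 2 ^ i' + m"
        show "bit (y + 2 ^ 2 ^ i' * Z) b = bit (y + 2 ^ 2 ^ i' * (Z + 2 ^ m * u)) b"
          unfolding bit_append[OF y(1)] bit_append[OF Z(1)] using b by auto
      qed (use assms(3) in auto)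
    qed
    ultimately show "?f p \<in> {Z. Z < 2 ^ m' \<and> forced P E i i' m' t' x Z}" by (simp add: p)
  qed
  then have "card (?f ` (?S \<times> {..<2 ^ (m' - m)})) \<le> forced_count P E i i' m' t' x"
    unfolding forced_count_def by (intro card_mono) auto
  then show ?thesis by (simp add: card_image[OF inj] card_cartesian_product forced_count_def)
qed

text \<open>Starts at 0 and stays below 1/2. Its increment \<open>1 / 2 ^ (i + 2)\<close> covers
  \<open>1 / 2 ^ (i + 3)\<close> for the new block and \<open>1 / 2 ^ (i + 4)\<close> for the new
  test.\<close>

definition threshold :: "nat \<Rightarrow> real" where
  "threshold i = 1 / 2 - 1 / 2 ^ Suc i"

text \<open>The first \<open>2 ^ i\<close> bits of the old tail act as the modified next block and
  the rest as the new tail. Then \<open>forced\<close> after the extension asks for a whole Hamming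
  ball, as in \<open>block_extension\<close>.\<close>

lemma forced_count_extension:
  assumes x: "x < 2 ^ 2 ^ i"
    and le: "real (forced_count P E i i (2 ^ i + m) t x) \<le> \<theta> * 2 ^ (2 ^ i + m)"
    and B: "B = {x'. x' < 2 ^ 2 ^ i \<and> \<theta>' * 2 ^ m < real (forced_count P E i (Suc i) m t (x + 2 ^ 2 ^ i * x'))}"
  shows "real (card B) * (\<theta>' - \<theta>) \<le> 2 ^ 2 ^ i * 2 powr (- (2 ^ i / (2 * 4 ^ phase E i)))"
proof -
  define n :: nat where "n = 2 ^ i"
  define s where "s = phase E i"
  define d :: real where "d = 1 / 2 ^ s"
  define Q where "Q y' Z \<longleftrightarrow> (\<forall>y<2 ^ n. close E i x y \<longrightarrow> hit P E i (n + (n + m)) t (y + 2 ^ n * (y' + 2 ^ n * Z)))" for y' Z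
  have n2: "2 ^ Suc i = n + n" by (simp add: n_def)
  have "{W. W < 2 ^ (n + m) \<and> forced P E i i (n + m) t x W} =
      (\<lambda>(u, v). u + 2 ^ n * v) ` (SIGMA u:{..<2 ^ n}. {v. v < 2 ^ m \<and> Q u v})"
    unfolding less_power_add_iff forced_def Q_def by (auto simp: n_def)
  also have "card \<dots> = card (SIGMA u:{..<2 ^ n :: nat}. {v. v < 2 ^ m \<and> Q u v})"
    by (intro card_image inj_on_subset[OF inj_on_append[of n UNIV]]) auto
  also have "\<dots> = card ((\<lambda>(u, v). (v, u)) ` (SIGMA u:{..<2 ^ n :: nat}. {v. v < 2 ^ m \<and> Q u v}))"
    by (rule card_image[symmetric]) (auto simp: inj_on_def)
  also have "(\<lambda>(u, v). (v, u)) ` (SIGMA u:{..<2 ^ n :: nat}. {v. v < 2 ^ m \<and> Q u v}) =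
      (SIGMA v:{..<2 ^ m}. {u. u < 2 ^ n \<and> Q u v})" by auto
  also have "card \<dots> = (\<Sum>v<2 ^ m. card {u. u < 2 ^ n \<and> Q u v})" by simp
  finally have count: "forced_count P E i i (n + m) t x = (\<Sum>v<2 ^ m. card {u. u < 2 ^ n \<and> Q u v})"
    by (simp add: forced_count_def)
  have tol: "differences n x' y' * 2 ^ s \<le> n \<longleftrightarrow> real (differences n x' y') \<le> d * real n" for x' y'
  proof -
    have "differences n x' y' * 2 ^ s \<le> n \<longleftrightarrow> real (differences n x' y' * 2 ^ s) \<le> real n" by (simp only: of_nat_le_iff)
    then show ?thesis by (simp add: d_def field_simps)
  qed
  have forced: "forced P E i (Suc i) m t (x + 2 ^ n * x') Z \<longleftrightarrow>
      (\<forall>y'<2 ^ n. real (differences n x' y') \<le> d * real n \<longrightarrow> Q y' Z)" for x' Z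
  proof -
    have "forced P E i (Suc i) m t (x + 2 ^ n * x') Z \<longleftrightarrow> (\<forall>y<2 ^ n. \<forall>y'<2 ^ n.
        close E (Suc i) (x + 2 ^ n * x') (y + 2 ^ n * y') \<longrightarrow>
        hit P E i (n + n + m) t (y + 2 ^ n * y' + 2 ^ (n + n) * Z))"
      unfolding forced_def n2 less_power_add_iff by auto
    also have "\<dots> \<longleftrightarrow> (\<forall>y<2 ^ n. \<forall>y'<2 ^ n. close E i x y \<and> real (differences n x' y') \<le> d * real n \<longrightarrow>
        hit P E i (n + (n + m)) t (y + 2 ^ n * (y' + 2 ^ n * Z)))"
      using close_Suc_append[OF x] tol by (simp add: n_def[symmetric] s_def[symmetric] power_add algebra_simps)
    also have "\<dots> \<longleftrightarrow> (\<forall>y'<2 ^ n. real (differences n x' y') \<le> d * real n \<longrightarrow> Q y' Z)"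
      unfolding Q_def by blast
    finally show ?thesis .
  qed
  have "real (card B) * (\<theta>' - \<theta>) \<le> 2 ^ n * 2 powr (- (d\<^sup>2 * real n / 2))"
  proof (rule block_extension[where Q = Q and m = m])
    show "real (\<Sum>Z<2 ^ m. card {y. y < 2 ^ n \<and> Q y Z}) \<le> \<theta> * 2 ^ (n + m)"
      using le by (simp only: count[symmetric] n_def[symmetric])
    show "B = {x. x < 2 ^ n \<and> \<theta>' * 2 ^ m < real (card {Z. Z < 2 ^ m \<and>
      (\<forall>y<2 ^ n. real (differences n x y) \<le> d * real n \<longrightarrow> Q y Z)})}"
      unfolding B forced_count_def n_def[symmetric] forced ..
  qed (auto simp: d_def)
  also have "d\<^sup>2 * real n / 2 = 2 ^ i / (2 * 4 ^ s)"
    by (simp add: d_def n_def power2_eq_square four_power)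
  finally show ?thesis by (simp add: n_def s_def)
qed

lemma phase_pos: "E r \<Longrightarrow> 1 \<le> phase E r"
  unfolding phase_def using member_le_sum[of r "{..<Suc r}" "\<lambda>r. of_bool (E r) :: nat"] by simp

text \<open>Only the first \<open>i + 1\<close> jump bits and the first \<open>phase E i\<close>
  tests matter, so finite advice suffices.\<close>

lemma forced_cong:
  assumes E: "\<And>r. r \<le> i \<Longrightarrow> E r = E' r" and i': "i' \<le> Suc i"
    and P: "\<And>j x t. j < phase E i \<Longrightarrow> P j x t = P' j x t"
  shows "forced P E i i' m t x Z = forced P' E' i i' m t x Z"
proof -
  have ph: "phase E r = phase E' r" if "r \<le> i" for r using E that by (intro phase_cong) auto
  have "hit P E i M t w = hit P' E' i M t w" for M w
  proof -
    have "P (phase E r - 1) y t = P' (phase E' r - 1) y t" if "r \<le> i" "E r" for r y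
    proof -
      have "phase E r - 1 < phase E i" using phase_pos[of E r] phase_mono[of r i E] that by linarith
      then show ?thesis using P ph[OF that(1)] by simp
    qed
    then show ?thesis unfolding hit_def less_Suc_eq_le
      by (intro ex_cong1 conj_cong refl) (simp_all add: E)
  qed
  moreover have "close E i' x y = close E' i' x y" for y
    using i' E by (intro close_cong) auto
  ultimately show ?thesis by (simp add: forced_def)
qed

lemma log_card_le:
  assumes "0 < c" "c \<le> 2 powr u"
  shows "log 2 c \<le> u"
proof -
  have "log 2 c \<le> log 2 (2 powr u)" using assms by (subst log_le_cancel_iff) auto
  then show ?thesis by simp
qed

text \<open>The first half of \<open>z\<close> is sent verbatim as its \<open>2 ^ i\<close> low
  bits, and the second half by its rank in the small set that makes the forced measure jump.\<close>

lemma forced_compressible: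
  assumes opt: "optimal U"
    and P: "\<And>j. decidable (\<lambda>p. P j (pfst p) (psnd p))" "\<forall>j x t t'. P j x t \<longrightarrow> t \<le> t' \<longrightarrow> P j x t'"
  obtains c :: "nat \<Rightarrow> nat" where "\<And>E i z m t. \<lbrakk>z < 2 ^ 2 ^ Suc i;
      \<And>m t. real (forced_count P E i i m t (z mod 2 ^ 2 ^ i)) \<le> threshold i * 2 ^ m;
      (threshold i + 1 / 2 ^ (i + 3)) * 2 ^ m < real (forced_count P E i (Suc i) m t z)\<rbrakk> \<Longrightarrow>
    \<exists>m::nat. complexity U (bits (2 ^ Suc i) z) \<le> enat m \<and>
      real m \<le> 2 ^ Suc i - 2 ^ i / (2 * 4 ^ phase E i) + 9 * real i + real (c (phase E i))"
proof -
  \<comment> \<open>Cutting off at a fixed \<open>J\<close> leaves finitely many procedures, which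
    combine into one by induction on \<open>J\<close> without uniformity.\<close>
  define P' where "P' J j x t \<longleftrightarrow> j < J \<and> P j x t" for J j x t
  have P': "decidable (\<lambda>x. P' J (f x) (g x) (h x))" if fgh: "recursive f" "recursive g" "recursive h" for f g h J
  proof -
    have "decidable (\<lambda>x. f x < J \<and> P (f x) (g x) (h x))" for J
    proof (induction J)
      case 0
      then show ?case using decidable_const[of False] by simp
    next
      case (Suc J)
      have "decidable (\<lambda>x. (f x < J \<and> P (f x) (g x) (h x)) \<or> (f x = J \<and> P J (g x) (h x)))"
        by (intro rec_intros Suc fgh decidable_compose2[OF P(1)])
      also have "(\<lambda>x. (f x < J \<and> P (f x) (g x) (h x)) \<or> (f x = J \<and> P J (g x) (h x)))
          = (\<lambda>x. f x < Suc J \<and> P (f x) (g x) (h x))" by (auto simp: less_Suc_eq)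
      finally show ?case .
    qed
    then show ?thesis by (simp add: P'_def)
  qed
  \<comment> \<open>\<open>threshold i + 1 / 2 ^ (i + 3)\<close> equals
    \<open>(2 ^ (i + 2) - 3) / 2 ^ (i + 3)\<close>; \<open>t\<close> is both the stage and the tail
    length.\<close>
  define D' :: "nat \<Rightarrow> nat \<Rightarrow> nat \<Rightarrow> nat \<Rightarrow> bool" where "D' J a z t \<longleftrightarrow> z < 2 ^ 2 ^ Suc (level (pfst a)) \<and>
      (2 ^ (level (pfst a) + 2) - 3 :: nat) * 2 ^ t < 2 ^ (level (pfst a) + 3) * (\<Sum>Z<2 ^ t.
        of_bool (forced (P' J) (bit (psnd (psnd a))) (level (pfst a)) (Suc (level (pfst a))) t t z Z))" for J a z t
  have "\<exists>c. \<forall>a b m z t. a < 2 ^ b \<longrightarrow> D' J a z t \<longrightarrow> finite (enumerated (D' J) a z) \<longrightarrow>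
      card (enumerated (D' J) a z) \<le> 2 ^ m \<longrightarrow> complexity U (bits (pfst (psnd a)) z) \<le> enat (2 * b + pfst a + m + c)" for J
  proof -
    have "decidable (\<lambda>p. D' J (pfst p) (pfst (psnd p)) (psnd (psnd p)))"
      unfolding D'_def forced_def close_def hit_def component_def by (intro rec_intros P')
    from complexity_enumerated[OF opt this] show ?thesis by metis
  qed
  then obtain c where c: "\<And>J a b m z t. \<lbrakk>a < 2 ^ b; D' J a z t; finite (enumerated (D' J) a z);
      card (enumerated (D' J) a z) \<le> 2 ^ m\<rbrakk> \<Longrightarrow> complexity U (bits (pfst (psnd a)) z) \<le> enat (2 * b + pfst a + m + c J)"
    by metis
  show thesis
  \<comment> \<open>26 bits come from the advice \<open>2 * (13 + 4 * i)\<close>, 3 from the factor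
    \<open>2 ^ (i + 3)\<close>, and 1 from rounding.\<close>
  proof (rule that[of "\<lambda>J. c J + 30"])
    fix E i z m t
    define J where "J = phase E i"
    define D where "D = D' J"
    assume z: "z < 2 ^ 2 ^ Suc i" and low: "\<And>m t. real (forced_count P E i i m t (z mod 2 ^ 2 ^ i)) \<le> threshold i * 2 ^ m"
      and high: "(threshold i + 1 / 2 ^ (i + 3)) * 2 ^ m < real (forced_count P E i (Suc i) m t z)"
    define \<theta> \<theta>' where "\<theta> = threshold i" and "\<theta>' = threshold i + 1 / 2 ^ (i + 3)"
    define n :: nat where "n = 2 ^ i"
    define e where "e = segment_number E (Suc i)"
    \<comment> \<open>\<open>n = 2 ^ i\<close> is the number of low bits sent and also transmits
      \<open>i\<close>, as its level.\<close>
    define a where "a = prod_encode (n, prod_encode (2 ^ Suc i, e))"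
    have pa: "level (pfst a) = i" "psnd (psnd a) = e"
      by (simp_all add: a_def n_def level_eq)
    have forced: "forced (P' J) (bit e) i (Suc i) t t z Z = forced P E i (Suc i) t t z Z" for t z Z
      by (rule forced_cong[symmetric]) (auto simp: e_def bit_segment_number P'_def J_def)
    have \<theta>': "\<theta>' = (2 ^ (i + 2) - 3) / 2 ^ (i + 3)"
      by (simp add: \<theta>'_def threshold_def power_add field_simps)
    have D: "D a z t \<longleftrightarrow> z < 2 ^ 2 ^ Suc i \<and> \<theta>' * 2 ^ t < real (forced_count P E i (Suc i) t t z)" for z t
    proof -
      have "(\<Sum>Z<2 ^ t. of_bool (forced P E i (Suc i) t t z Z)) = card {Z \<in> {..<2 ^ t}. forced P E i (Suc i) t t z Z}"
        by (simp add: of_bool_def sum.inter_filter[symmetric])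
      then have cnt: "(\<Sum>Z<2 ^ t. of_bool (forced P E i (Suc i) t t z Z)) = forced_count P E i (Suc i) t t z"
        by (simp add: forced_count_def)
      have "(3::nat) \<le> 2 ^ (i + 2)" by (rule order_trans[OF _ power_increasing[of 2 "i + 2"]]) auto
      then have "real (2 ^ (i + 2) - 3) = 2 ^ (i + 2) - 3" by (simp add: of_nat_diff)
      then have r: "real ((2 ^ (i + 2) - 3) * 2 ^ t) = (2 ^ (i + 2) - 3) * 2 ^ t" by simp
      have "(2 ^ (i + 2) - 3) * 2 ^ t < 2 ^ (i + 3) * forced_count P E i (Suc i) t t z \<longleftrightarrow>
          real ((2 ^ (i + 2) - 3) * 2 ^ t) < real (2 ^ (i + 3) * forced_count P E i (Suc i) t t z)"
        by (simp only: of_nat_less_iff)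
      also have "\<dots> \<longleftrightarrow> \<theta>' * 2 ^ t < real (forced_count P E i (Suc i) t t z)"
        unfolding r \<theta>' by (simp add: field_simps)
      finally show ?thesis unfolding D_def D'_def pa forced cnt by (simp only:)
    qed
    have count_mono: "\<theta>' * 2 ^ m' < real (forced_count P E i (Suc i) m' t' z)"
      if "\<theta>' * 2 ^ m < real (forced_count P E i (Suc i) m t z)" "m \<le> m'" "t \<le> t'" for m m' t t' z
    proof -
      have "\<theta>' * 2 ^ m * 2 ^ (m' - m) < real (forced_count P E i (Suc i) m t z) * 2 ^ (m' - m)"
        using that(1) by simp
      also have "\<dots> = real (forced_count P E i (Suc i) m t z * 2 ^ (m' - m))" by simp
      also have "\<dots> \<le> real (forced_count P E i (Suc i) m' t' z)"
        unfolding of_nat_le_iff by (rule forced_count_mono[OF P(2)[rule_format] that(3,2)])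
      also have "\<theta>' * 2 ^ m * 2 ^ (m' - m) = \<theta>' * 2 ^ m'" using that(2) by (simp add: mult.assoc flip: power_add)
      finally show ?thesis .
    qed
    have D_mono: "D a z t \<Longrightarrow> t \<le> t' \<Longrightarrow> D a z t'" for z t t' unfolding D using count_mono by blast
    have Dz: "D a z (max m t)" unfolding D using z high count_mono[of m t z "max m t" "max m t"] by (simp add: \<theta>'_def)
    \<comment> \<open>The isoperimetric bound concerns a single stage, so all elements have to be
      seen at one stage \<open>T\<close>.\<close>
    obtain T where T: "\<And>z' t. D a z' t \<Longrightarrow> D a z' T"
    proof -
      have "\<forall>z'<2 ^ 2 ^ Suc i. \<exists>t. (\<exists>t. D a z' t) \<longrightarrow> D a z' t" by blast
      from uniform_fuel[OF _ this] obtain T where "\<forall>z'<2 ^ 2 ^ Suc i. (\<exists>t. D a z' t) \<longrightarrow> D a z' T"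
        using D_mono by blast
      moreover have "z' < 2 ^ 2 ^ Suc i" if "D a z' t" for z' t using that by (simp add: D)
      ultimately show thesis using that by blast
    qed
    define x where "x = z mod 2 ^ n"
    have x: "x < 2 ^ 2 ^ i" by (simp add: x_def n_def)
    define B where "B = {x'. x' < 2 ^ 2 ^ i \<and> \<theta>' * 2 ^ T < real (forced_count P E i (Suc i) T T (x + 2 ^ 2 ^ i * x'))}"
    define S where "S = {z'. z' mod 2 ^ n = z mod 2 ^ n \<and> (\<exists>t. D a z' t)}"
    have "S \<subseteq> (\<lambda>x'. x + 2 ^ 2 ^ i * x') ` B"
    proof
      fix z' assume "z' \<in> S"
      then have z': "z' mod 2 ^ n = x" "D a z' T" using T by (auto simp: S_def x_def)
      have eq: "z' = x + 2 ^ 2 ^ i * (z' div 2 ^ n)"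
        unfolding z'(1)[symmetric] n_def by (rule mod_mult_div_eq[symmetric])
      have "2 ^ Suc i = n + n" by (simp add: n_def)
      then have "z' < 2 ^ n * 2 ^ n" using z'(2) unfolding D by (simp add: power_add)
      then have "z' div 2 ^ n < 2 ^ 2 ^ i" by (simp add: less_mult_imp_div_less n_def)
      moreover have "\<theta>' * 2 ^ T < real (forced_count P E i (Suc i) T T (x + 2 ^ 2 ^ i * (z' div 2 ^ n)))"
        using z'(2) unfolding D eq[symmetric] by blast
      ultimately show "z' \<in> (\<lambda>x'. x + 2 ^ 2 ^ i * x') ` B" using eq by (auto simp: B_def)
    qed
    moreover have finB: "finite B" by (simp add: B_def)
    ultimately have S: "finite S" "card S \<le> card B"
      using finite_surj[of B S] surj_card_le[of B S] by auto
    have "z \<in> S" using Dz by (auto simp: S_def)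
    then have S1: "0 < card S" using S(1) by (auto simp: card_gt_0_iff)
    have "real (card B) * (\<theta>' - \<theta>) \<le> 2 ^ 2 ^ i * 2 powr (- (2 ^ i / (2 * 4 ^ J)))"
      unfolding J_def by (rule forced_count_extension[OF x _ B_def]) (use low in \<open>simp add: \<theta>_def x_def n_def\<close>)
    then have "real (card B) \<le> 2 ^ (i + 3) * (2 ^ 2 ^ i * 2 powr (- (2 ^ i / (2 * 4 ^ J))))"
      by (simp add: \<theta>_def \<theta>'_def field_simps)
    also have "\<dots> = 2 powr (real (i + 3)) * (2 powr (real (2 ^ i)) * 2 powr (- (2 ^ i / (2 * 4 ^ J))))"
      by (simp only: powr_realpow zero_less_numeral)
    also have "\<dots> = 2 powr (real i + 3 + 2 ^ i - 2 ^ i / (2 * 4 ^ J))"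
      by (simp add: algebra_simps flip: powr_add)
    finally have card_B: "real (card B) \<le> 2 powr (real i + 3 + 2 ^ i - 2 ^ i / (2 * 4 ^ J))" .
    define u where "u = log 2 (real (card S))"
    have u: "u \<le> real i + 3 + 2 ^ i - 2 ^ i / (2 * 4 ^ J)"
      unfolding u_def using S S1 card_B by (intro log_card_le) auto
    obtain h where card_S: "card S \<le> 2 ^ h" and h: "real h \<le> u + 1"
      using le_two_power_log[OF S1] by (auto simp: u_def)
    have a_bound: "a < 2 ^ (13 + 4 * i)"
    proof -
      have n1: "1 \<le> n" by (simp add: n_def)
      have nn: "n \<le> n ^ 2" using n1 by (simp add: power2_eq_square)
      have e: "e < 2 * n" using segment_number_less[of E "Suc i"] by (simp add: e_def n_def)
      have "prod_encode (2 ^ Suc i, e) \<le> (2 ^ Suc i + e + 1)\<^sup>2" by (rule prod_encode_le)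
      also have "\<dots> \<le> (4 * n)\<^sup>2" using e by (intro power_mono) (auto simp: n_def)
      finally have 1: "prod_encode (2 ^ Suc i, e) \<le> 16 * n ^ 2" by (simp add: power_mult_distrib)
      have "a \<le> (n + prod_encode (2 ^ Suc i, e) + 1)\<^sup>2" unfolding a_def by (rule prod_encode_le)
      also have "\<dots> \<le> (32 * n ^ 2)\<^sup>2" using 1 nn n1 by (intro power_mono) auto
      also have "\<dots> = 2 ^ 10 * n ^ 4" by (simp add: power_mult_distrib flip: power_mult)
      also have "\<dots> = 2 ^ (10 + i * 4)" unfolding n_def power_add power_mult ..
      also have "\<dots> < 2 ^ (13 + 4 * i)" by (rule power_strict_increasing) auto
      finally show ?thesis .
    qed
    have "enumerated D a z = S" by (simp add: enumerated_def S_def a_def)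
    then have "complexity U (bits (2 ^ Suc i) z) \<le> enat (2 * (13 + 4 * i) + n + h + c J)"
      using c[OF a_bound Dz[unfolded D_def], of h] S(1) card_S by (simp add: a_def D_def)
    moreover have "real (2 * (13 + 4 * i) + n + h + c J) \<le> 2 ^ Suc i - 2 ^ i / (2 * 4 ^ J) + 9 * real i + real (c J + 30)"
      using u h by (simp add: n_def)
    ultimately show "\<exists>m::nat. complexity U (bits (2 ^ Suc i) z) \<le> enat m \<and>
      real m \<le> 2 ^ Suc i - 2 ^ i / (2 * 4 ^ phase E i) + 9 * real i + real (c (phase E i) + 30)"
      unfolding J_def by blast
  qed
qed

text \<open>A tail forced only through the new test extends some modification \<open>y\<close> to a
  string hit by it. The new component has index \<open>N + i + 4\<close>, where \<open>N\<close> is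
  the length of \<open>y\<close>, and this pays for all \<open>2 ^ N\<close> choices of
  \<open>y\<close>.\<close>

lemma forced_count_activation:
  assumes T: "\<And>j. strong_test 1 (T j)"
    and P: "\<And>j k \<sigma>. \<sigma> \<in> T j k \<longleftrightarrow> (\<exists>t. P j (prod_encode (k, string_encode \<sigma>)) t)"
  shows "real (forced_count P E (Suc i) (Suc i) m t x) \<le> real (forced_count P E i (Suc i) m t x) + 2 ^ m / 2 ^ (i + 4)"
proof -
  let ?S = "\<lambda>j. {Z. Z < 2 ^ m \<and> forced P E j (Suc i) m t x Z}"
  define N :: nat where "N = 2 ^ Suc i"
  define k where "k = component (Suc i)"
  define j where "j = phase E (Suc i) - 1"
  define W where "W = {w. w < 2 ^ (N + m) \<and> (\<exists>l<Suc (N + m). bits l w \<in> T j k)}"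
  have fin: "finite W" by (simp add: W_def)
  have "?S (Suc i) \<subseteq>
      ?S i \<union> (\<lambda>w. w div 2 ^ N) ` W"
  proof
    fix Z assume "Z \<in> ?S (Suc i)"
    then have Z: "Z < 2 ^ m" "forced P E (Suc i) (Suc i) m t x Z" by auto
    show "Z \<in> ?S i \<union> (\<lambda>w. w div 2 ^ N) ` W"
    proof (cases "forced P E i (Suc i) m t x Z")
      case False
      then obtain y where y: "y < 2 ^ N" "close E (Suc i) x y" "\<not> hit P E i (N + m) t (y + 2 ^ N * Z)"
        by (auto simp: forced_def N_def)
      then have "hit P E (Suc i) (N + m) t (y + 2 ^ N * Z)" using Z(2) by (auto simp: forced_def N_def)
      then obtain l where l: "l < Suc (N + m)" "P j (prod_encode (k, string_encode (bits l (y + 2 ^ N * Z)))) t"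
        using y(3) unfolding hit_def j_def k_def by (metis less_Suc_eq)
      have "y + 2 ^ N * Z < 2 ^ (N + m)" unfolding less_power_add_iff using y(1) Z(1) by blast
      moreover have "bits l (y + 2 ^ N * Z) \<in> T j k" using l(2) P by blast
      ultimately have "y + 2 ^ N * Z \<in> W" using l(1) by (auto simp: W_def)
      moreover have "(y + 2 ^ N * Z) div 2 ^ N = Z" using y(1) by simp
      ultimately show ?thesis by (intro UnI2 image_eqI[of _ _ "y + 2 ^ N * Z"]) auto
    qed (use Z(1) in simp)
  qed
  then have "forced_count P E (Suc i) (Suc i) m t x \<le>
      card (?S i \<union> (\<lambda>w. w div 2 ^ N) ` W)"
    unfolding forced_count_def by (rule card_mono[rotated]) (simp add: fin)
  also have "\<dots> \<le> forced_count P E i (Suc i) m t x + card ((\<lambda>w. w div 2 ^ N) ` W)"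
    unfolding forced_count_def by (rule card_Un_le)
  also have "card ((\<lambda>w. w div 2 ^ N) ` W) \<le> card W" by (rule card_image_le[OF fin])
  finally have "real (forced_count P E (Suc i) (Suc i) m t x) \<le> real (forced_count P E i (Suc i) m t x) + real (card W)"
    by linarith
  also have "real (card W) \<le> 2 ^ (N + m) / 2 ^ k"
    unfolding W_def by (rule card_strong_test_open[OF T]) (simp add: k_def component_def)
  also have "(2::real) ^ (N + m) / 2 ^ k = 2 ^ m / 2 ^ (i + 4)"
  proof -
    have "k = N + (i + 4)" by (simp add: k_def component_def N_def)
    then show ?thesis by (simp only: power_add) simp
  qed
  finally show ?thesis by simp
qed

text \<open>A tail would be forced vacuously if no \<open>y\<close> were close to \<open>x\<close>;
  the truncation of \<open>x\<close> is close.\<close>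

lemma forced_count_no_tests:
  assumes "phase E i = 0" shows "forced_count P E i i' m t x = 0"
proof -
  have "\<not> E r" if "r < Suc i" for r
    using phase_pos[of E r] phase_mono[of r i E] assms that by auto
  then have "\<not> hit P E i M t w" for M w by (auto simp: hit_def)
  moreover have "\<exists>y<2 ^ 2 ^ i'. close E i' x y"
  proof (intro exI conjI)
    show "x mod 2 ^ 2 ^ i' < 2 ^ 2 ^ i'" by simp
    have "block_differences r x x = block_differences r x (x mod 2 ^ 2 ^ i')" if "r < i'" for r
    proof (rule block_differences_cong)
      fix b :: nat assume "b < 2 ^ Suc r"
      also have "(2::nat) ^ Suc r \<le> 2 ^ i'" using that by (intro power_increasing) auto
      finally show "bit x b = bit (x mod 2 ^ 2 ^ i') b" by (simp add: bit_take_bit_iff flip: take_bit_eq_mod)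
    qed simp
    then show "close E i' x (x mod 2 ^ 2 ^ i')" using close_refl[of E i' x] by (simp add: close_def)
  qed
  ultimately have "\<not> forced P E i i' m t x Z" for Z unfolding forced_def by blast
  then show ?thesis by (simp add: forced_count_def)
qed

lemma segment_number_mod: "m \<le> n \<Longrightarrow> segment_number X n mod 2 ^ m = segment_number X m"
  by (rule bit_eqI) (auto simp: bit_segment_number bit_take_bit_iff simp flip: take_bit_eq_mod)

text \<open>The phase grows in steps of at most one, so every test gets activated.\<close>

lemma phase_attained:
  assumes "filterlim (phase E) at_top sequentially"
  obtains r where "E r" "phase E r = Suc j"
proof -
  have ex: "\<exists>r. Suc j \<le> phase E r"
    using assms unfolding filterlim_at_top eventually_sequentially by blast
  define r where "r = (LEAST r. Suc j \<le> phase E r)"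
  have r: "Suc j \<le> phase E r" unfolding r_def using ex by (rule LeastI_ex)
  have prev: "phase E q \<le> j" if "q < r" for q using not_less_Least[OF that[unfolded r_def]] by simp
  show thesis
  proof (cases r)
    case 0
    then have "phase E r = of_bool (E r)" by (simp add: phase_def)
    then show thesis using r that[of r] by (cases "E r") auto
  next
    case (Suc q)
    then have "phase E r = phase E q + of_bool (E r)" by (simp add: phase_def)
    then show thesis using r prev[of q] Suc that[of r] by (cases "E r") auto
  qed
qed

theorem dimension_one:
  assumes opt: "optimal U" and dim: "effective_dimension U X = ereal 1"
  shows "\<exists>Y. strongly_random 1 Y \<and> besicovitch_distance X Y = 0"
proof -
  obtain T and P :: "nat \<Rightarrow> nat \<Rightarrow> nat \<Rightarrow> bool" where *: "\<forall>j. strong_test 1 (T j)"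
    "\<forall>V. strong_test 1 V \<longrightarrow> (\<exists>j. \<forall>k\<ge>1. V k = T j k)"
    "\<forall>j. decidable (\<lambda>p. P j (pfst p) (psnd p))"
    "\<forall>j k \<sigma>. \<sigma> \<in> T j k \<longleftrightarrow> (\<exists>t. P j (prod_encode (k, string_encode \<sigma>)) t)"
    "\<forall>j x t t'. P j x t \<longrightarrow> t \<le> t' \<longrightarrow> P j x t'"
    using strong_tests_enumeration[of 1] by blast
  note T = *(1,2)[rule_format] and P = *(3-5)[rule_format]
  obtain c :: "nat \<Rightarrow> nat" where c: "\<And>E i z m t. \<lbrakk>z < 2 ^ 2 ^ Suc i;
      \<And>m t. real (forced_count P E i i m t (z mod 2 ^ 2 ^ i)) \<le> threshold i * 2 ^ m;
      (threshold i + 1 / 2 ^ (i + 3)) * 2 ^ m < real (forced_count P E i (Suc i) m t z)\<rbrakk> \<Longrightarrow>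
      \<exists>m::nat. complexity U (bits (2 ^ Suc i) z) \<le> enat m \<and>
      real m \<le> 2 ^ Suc i - 2 ^ i / (2 * 4 ^ phase E i) + 9 * real i + real (c (phase E i))"
    by (rule forced_compressible[OF opt P(1) *(5)]) (erule that)
  \<comment> \<open>With \<open>K = 2 ^ i / (8 * 4 ^ s)\<close> the saving is \<open>4 * K\<close>,
    and the deficit allowed at length \<open>2 ^ Suc i\<close> is \<open>K\<close>. Since
    \<open>i * i \<le> K\<close> and \<open>40 + c s \<le> i\<close>, the remaining
    \<open>3 * K\<close> exceeds \<open>9 * i + c s\<close>.\<close>
  obtain E where E: "filterlim (phase E) at_top sequentially"
    "\<And>i. 1 \<le> phase E i \<Longrightarrow> i * i * 2 ^ (2 * phase E i + 3) \<le> 2 ^ i"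
    "\<And>i. 1 \<le> phase E i \<Longrightarrow> 40 + c (phase E i) \<le> i"
    "\<And>i n m. \<lbrakk>1 \<le> phase E i; 2 ^ i \<le> n; complexity U (initial_segment X n) \<le> enat m\<rbrakk> \<Longrightarrow>
      (1 - 1 / (16 * 4 ^ phase E i)) * real n \<le> real m"
    by (rule complexity_schedule[OF dim, of "\<lambda>s. 1 / (16 * 4 ^ s)" "\<lambda>s. 2 * s + 3" "\<lambda>s. 40 + c s"]) (use that in auto)
  define x where "x i = segment_number X (2 ^ i)" for i
  have x_less: "x i < 2 ^ 2 ^ i" for i by (simp add: x_def segment_number_less)
  have inv: "real (forced_count P E i i m t (x i)) \<le> threshold i * 2 ^ m" for i m t
  proof (induction i arbitrary: m t)
    case 0
    \<comment> \<open>A positive phase at level 0 would require \<open>40 \<le> 0\<close>.\<close>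
    have "phase E 0 = 0"
      using E(3)[of 0] by linarith
    then show ?case by (simp add: forced_count_no_tests threshold_def)
  next
    case (Suc i)
    define s where "s = phase E i"
    have ext: "real (forced_count P E i (Suc i) m t (x (Suc i))) \<le> (threshold i + 1 / 2 ^ (i + 3)) * 2 ^ m" for m t
    proof (rule ccontr)
      assume "\<not> ?thesis"
      then have high: "(threshold i + 1 / 2 ^ (i + 3)) * 2 ^ m < real (forced_count P E i (Suc i) m t (x (Suc i)))"
        by simp
      have th: "0 \<le> threshold i" by (simp add: threshold_def)
      have s: "1 \<le> s"
      proof (rule ccontr)
        assume "\<not> 1 \<le> s"
        then have "forced_count P E i (Suc i) m t (x (Suc i)) = 0" by (intro forced_count_no_tests) (simp add: s_def)
        moreover have "0 \<le> (threshold i + 1 / 2 ^ (i + 3)) * 2 ^ m" using th by simp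
        ultimately show False using high by simp
      qed
      note q = E(2-4)[OF s[unfolded s_def], folded s_def]
      have "x (Suc i) mod 2 ^ 2 ^ i = x i" unfolding x_def by (rule segment_number_mod) simp
      then have "\<exists>h::nat. complexity U (bits (2 ^ Suc i) (x (Suc i))) \<le> enat h \<and>
          real h \<le> 2 ^ Suc i - 2 ^ i / (2 * 4 ^ s) + 9 * real i + real (c s)"
        unfolding s_def using Suc.IH by (intro c[OF x_less _ high]) simp
      then obtain h :: nat where h: "complexity U (initial_segment X (2 ^ Suc i)) \<le> enat h"
        "real h \<le> 2 ^ Suc i - 2 ^ i / (2 * 4 ^ s) + 9 * real i + real (c s)"
        by (auto simp: x_def bits_segment_number)
      define K where "K = 2 ^ i / (8 * (4::real) ^ s)"
      have "2 ^ Suc i - K \<le> 2 ^ Suc i - 4 * K + 9 * real i + real (c s)"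
      proof -
        have "2 ^ i / (2 * 4 ^ s) = 4 * K" by (simp add: K_def)
        moreover have "(1 - 1 / (16 * 4 ^ s)) * real (2 ^ Suc i) = 2 ^ Suc i - K"
          by (simp add: K_def algebra_simps)
        moreover have "(1 - 1 / (16 * 4 ^ s)) * real (2 ^ Suc i) \<le> real h"
          by (rule q(3)[OF _ h(1)]) simp
        ultimately show ?thesis using h(2) by linarith
      qed
      moreover have "real i * real i \<le> K"
      proof -
        have "real (i * i * 2 ^ (2 * s + 3)) \<le> real (2 ^ i)" using q(1) by (simp only: of_nat_le_iff)
        moreover have "(2::real) ^ (2 * s + 3) = 8 * 4 ^ s" by (simp add: power_add power_mult)
        ultimately have "real i * real i * (8 * 4 ^ s) \<le> 2 ^ i" by simp
        then show ?thesis by (simp add: K_def field_simps)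
      qed
      ultimately have "3 * (real i * real i) \<le> 9 * real i + real (c s)" by linarith
      moreover have "40 * real i \<le> real i * real i" using q(2) by (intro mult_right_mono) auto
      moreover have "real (c s) < real i" using q(2) by simp
      ultimately show False by linarith
    qed
    have "real (forced_count P E (Suc i) (Suc i) m t (x (Suc i))) \<le>
        real (forced_count P E i (Suc i) m t (x (Suc i))) + 2 ^ m / 2 ^ (i + 4)"
      by (rule forced_count_activation[OF T(1) P(2)])
    also have "\<dots> \<le> (threshold i + 1 / 2 ^ (i + 3)) * 2 ^ m + 2 ^ m / 2 ^ (i + 4)"
      by (intro add_right_mono ext)
    also have "\<dots> = (threshold i + 1 / 2 ^ (i + 3) + 1 / 2 ^ (i + 4)) * 2 ^ m" by (simp add: algebra_simps)
    also have "\<dots> \<le> threshold (Suc i) * 2 ^ m"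
      by (intro mult_right_mono) (simp_all add: threshold_def power_add field_simps)
    finally show ?case .
  qed
  have "\<exists>y<2 ^ 2 ^ I. close E I (x I) y \<and> (\<forall>t. \<not> hit P E I (2 ^ I) t y)" for I
  proof -
    \<comment> \<open>A stage after which no string of this length is newly hit, so that escaping at
      it means escaping forever.\<close>
    have "\<forall>y<2 ^ 2 ^ I. \<exists>t. (\<exists>t. hit P E I (2 ^ I) t y) \<longrightarrow> hit P E I (2 ^ I) t y" by blast
    moreover have "hit P E I (2 ^ I) t' y" if "hit P E I (2 ^ I) t y" "t \<le> t'" for t t' y
      by (rule hit_mono[where P = P, OF _ that(2) order_refl that(1)]) (auto intro: P(3))
    ultimately obtain t where t: "\<forall>y<2 ^ 2 ^ I. (\<exists>t. hit P E I (2 ^ I) t y) \<longrightarrow> hit P E I (2 ^ I) t y"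
      using uniform_fuel[of "2 ^ 2 ^ I" "\<lambda>y t. (\<exists>t. hit P E I (2 ^ I) t y) \<longrightarrow> hit P E I (2 ^ I) t y"] by blast
    have "(0::real) < 1 / 2 ^ Suc I" by simp
    then have "threshold I < 1 / 2" unfolding threshold_def by linarith
    \<comment> \<open>For empty tails the count is 0 or 1, so the bound makes it 0: some admissible
      modification escapes.\<close>
    then have "threshold I * 2 ^ 0 < 1" by simp
    then have "forced_count P E I I 0 t (x I) = 0" using inv[of I 0 t] by linarith
    then have "\<not> forced P E I I 0 t (x I) 0" by (auto simp: forced_count_def)
    then obtain y where y: "y < 2 ^ 2 ^ I" "close E I (x I) y" "\<not> hit P E I (2 ^ I) t y"
      by (auto simp: forced_def)
    then show ?thesis using t by blast
  qed
  then obtain y where y: "\<And>I. close E I (x I) (y I)" "\<And>I t. \<not> hit P E I (2 ^ I) t (y I)" by metis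
  obtain Y where Y: "\<And>n m. \<exists>i\<ge>m. \<forall>b<n. bit (y i) b = Y b" using limit_sequence by blast
  have "strongly_random 1 Y" unfolding strongly_random_def
  proof (intro allI impI)
    fix V assume "strong_test 1 V"
    then obtain j where j: "\<forall>k\<ge>1. V k = T j k" using T(2) by blast
    obtain r where r: "E r" "phase E r = Suc j" using phase_attained[OF E(1)] by blast
    have "initial_segment Y l \<notin> T j (component r)" for l
    proof
      assume "initial_segment Y l \<in> T j (component r)"
      then obtain t where t: "P j (prod_encode (component r, string_encode (initial_segment Y l))) t" using P(2) by blast
      obtain I where I: "max r l \<le> I" "\<forall>b<l. bit (y I) b = Y b" using Y by blast
      have l: "l < Suc (2 ^ I)" using I(1) less_exp[of I] by linarith
      have "bits l (y I) = initial_segment Y l" using I(2) by (simp add: bits_def initial_segment_def)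
      then have "P (phase E r - 1) (prod_encode (component r, string_encode (bits l (y I)))) t" using t r(2) by simp
      then have "hit P E I (2 ^ I) t (y I)" unfolding hit_def using r(1) l I(1) by (intro exI[of _ r] conjI exI[of _ l]) auto
      then show False using y(2) by blast
    qed
    moreover have "1 \<le> component r" by (simp add: component_def)
    ultimately show "\<exists>k\<ge>1. \<forall>n. initial_segment Y n \<notin> V k" using j by (intro exI[of _ "component r"]) auto
  qed
  moreover have "besicovitch_distance X Y = 0"
  proof (rule besicovitch_distance_eq_0[where R = 0 and C = 1, OF E(1)])
    fix r
    obtain I where I: "Suc r \<le> I" "\<forall>b<2 ^ Suc r. bit (y I) b = Y b" using Y by blast
    have le: "(2::nat) ^ Suc r \<le> 2 ^ I" using I(1) by (intro power_increasing) auto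
    have "{i. 2 ^ r \<le> i \<and> i < 2 ^ Suc r \<and> X i \<noteq> Y i} = {i. 2 ^ r \<le> i \<and> i < 2 ^ Suc r \<and> bit (x I) i \<noteq> bit (y I) i}"
      using I(2) le by (auto simp: x_def bit_segment_number)
    then have "block_errors r X Y * 2 ^ phase E r \<le> 2 ^ r"
      using y(1)[of I] I(1) by (simp add: close_def block_differences_card)
    then have "real (block_errors r X Y * 2 ^ phase E r) \<le> real (2 ^ r)"
      by (simp only: of_nat_le_iff)
    then show "real (block_errors r X Y) \<le> 1 * 2 ^ r / 2 ^ phase E r"
      by (simp add: field_simps)
  qed
  ultimately show ?thesis by blast
qed

theorem mainTheorem5:
  fixes U :: "bitstring \<rightharpoonup> bitstring" and X :: bitseq and \<alpha> :: real
  assumes "optimal U"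
    and "effective_dimension U X = ereal \<alpha>"
  shows "\<exists>X'. strongly_random \<alpha> X' \<and> besicovitch_distance X X' = 0"
proof (cases "\<alpha> = 1")
  case True
  then show ?thesis using dimension_one[OF assms(1)] assms(2) by simp
next
  case False
  then have "\<alpha> < 1" using effective_dimension_le_1[OF assms] by simp
  then show ?thesis using dimension_less_than_one[OF assms] by simp
qed

end
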